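(* Let $X$ be a locally compact metrisable space, and let $(X,\Phi)$ be a dynamical system with $\Phi=\{\phi_{\mathbf n}:\mathbf n\in\mathbb{Z}_+^d\}$. The following are equivalent: (1) the strongly recurrent points are dense in $X$; (2) $C_0(X)\times_\phi\mathbb{Z}_+^d$ is semisimple; (3) $C_0(X)\times_\phi\mathbb{Z}_+^d$ is semiprime.
   Context: Let $d\ge1$ and $\mathbb{Z}_+=\{0,1,2,\dots\}$. Dynamical system: $X$ is a locally compact metrisable space and $\Phi=\{\phi_{\mathbf n}:\mathbf n=(n_1,\dots,n_d)\in\mathbb{Z}_+^d\}$ is a semigroup (under composition) of continuous proper surjections $X\to X$, isomorphic as a semigroup to $\mathbb{Z}_+^d$ via $\mathbf n\mapsto\phi_{\mathbf n}$ (so $\phi_{\mathbf n+\mathbf m}=\phi_{\mathbf n}\circ\phi_{\mathbf m}$, $\phi_{\mathbf 0}=\mathrm{id}$). A point $x\in X$ is strongly recurrent if there is a sequence $(\mathbf n_k)$ in $\mathbb{Z}_+^d$, strictly increasing in every coordinate (for every $j\in\{1,\dots,d\}$ and every $k$ the $j$-th entry of $\mathbf n_{k+1}$ is greater than that of $\mathbf n_k$), with $\lim_k\phi_{\mathbf n_k}(x)=x$. Analytic crossed product: write elements of the Banach space $\ell^1(\mathbb{Z}_+^d,C_0(X))$ as formal series $\sum_{\mathbf n}U_{\mathbf n}f_{\mathbf n}$ with norm $\sum_{\mathbf n}\|f_{\mathbf n}\|_\infty$. Put $\alpha_{\mathbf n}(f)=f\circ\phi_{\mathbf n}$. The multiplication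 determined by $(U_{\mathbf n}f)(U_{\mathbf m}g)=U_{\mathbf n+\mathbf m}(\alpha_{\mathbf m}(f)g)$, extended by linearity and continuity, makes it a Banach algebra. Let $C_0(X)$ be represented faithfully (by a $*$-representation) on a Hilbert space $H_o$, and define a faithful contractive representation $\pi$ of $\ell^1(\mathbb{Z}_+^d,C_0(X))$ on $\mathcal{H}=H_o\otimes\ell^2(\mathbb{Z}_+^d)$ by $\pi(U_{\mathbf n}f)(\xi\otimes e_{\mathbf k})=\alpha_{\mathbf k}(f)\xi\otimes e_{\mathbf k+\mathbf n}$. The analytic crossed product $C_0(X)\times_\phi\mathbb{Z}_+^d$ is the norm closure of the image of $\pi$ in $\mathcal{B}(\mathcal{H})$ (independent, up to isometric isomorphism, of the faithful representation of $C_0(X)$). Ideals are two-sided. The Jacobson radical of an algebra is the intersection of all its primitive ideals (kernels of algebraically irreducible representations); the algebra is semisimple if its Jacobson radical is $\{0\}$. An ideal $\mathcal{J}$ is prime if, whenever $\mathcal{J}_1,\mathcal{J}_2$ are ideals with $\mathcal{J}_1\mathcal{J}_2\subseteq\mathcal{J}$, then $\mathcal{J}_1\subseteq\mathcal{J}$ or $\mathcal{J}_2\subseteq\mathcal{J}$. The prime radical is the intersection of all prime ideals; the algebra is semiprime if its prime radical is $\{0\}$, equivalently if it has no nonzero nilpotent ideals. *)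

theory Defs
  imports "HOL-Analysis.Analysis"
begin

section \<open>Complex Hilbert spaces and complex algebras\<close>

class complex_vector = real_vector +
  fixes scaleC :: "complex \<Rightarrow> 'a \<Rightarrow> 'a"  (infixr \<open>*\<^sub>C\<close> 75)
  assumes scaleC_add_right: "c *\<^sub>C (x + y) = c *\<^sub>C x + c *\<^sub>C y"
    and scaleC_add_left: "(c + d) *\<^sub>C x = c *\<^sub>C x + d *\<^sub>C x"
    and scaleC_scaleC: "c *\<^sub>C d *\<^sub>C x = (c * d) *\<^sub>C x"
    and scaleR_scaleC: "r *\<^sub>R x = complex_of_real r *\<^sub>C x"

class complex_inner = complex_vector + real_inner +
  fixes cinner :: "'a \<Rightarrow> 'a \<Rightarrow> complex"
  assumes cinner_commute: "cinner x y = cnj (cinner y x)"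
    and cinner_add_left: "cinner (x + y) z = cinner x z + cinner y z"
    and cinner_scaleC_left: "cinner (c *\<^sub>C x) y = c * cinner x y"
    and inner_eq_Re_cinner: "inner x y = Re (cinner x y)"

class complex_hilbert = complex_inner + complete_space

subclass (in complex_hilbert) banach ..

class complex_algebra = complex_vector + ring +
  assumes mult_scaleC_left: "(c *\<^sub>C x) * y = c *\<^sub>C (x * y)"
    and mult_scaleC_right: "x * (c *\<^sub>C y) = c *\<^sub>C (x * y)"

lemma scaleC_one [simp]: "1 *\<^sub>C (x::'a::complex_vector) = x"
  using scaleR_scaleC[of 1 x] by simp

lemma vector_space_scaleC: "vector_space (scaleC :: complex \<Rightarrow> 'a::complex_vector \<Rightarrow> 'a)"
  by unfold_locales (auto simp: scaleC_add_right scaleC_add_left scaleC_scaleC)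

interpretation cvec: vector_space "scaleC :: complex \<Rightarrow> 'a::complex_vector \<Rightarrow> 'a"
  by (rule vector_space_scaleC)

interpretation cvec_pair: vector_space_pair
  "scaleC :: complex \<Rightarrow> 'a::complex_vector \<Rightarrow> 'a" "scaleC :: complex \<Rightarrow> 'b::complex_vector \<Rightarrow> 'b"
  by unfold_locales

lemma cinner_self: "cinner x x = complex_of_real ((norm (x::'a::complex_inner))\<^sup>2)"
proof (rule complex_eqI)
  show "Re (cinner x x) = Re (complex_of_real ((norm x)\<^sup>2))"
    by (simp add: inner_eq_Re_cinner[symmetric] power2_norm_eq_inner)
  have "Im (cinner x x) = - Im (cinner x x)"
    by (subst cinner_commute) simp
  then show "Im (cinner x x) = Im (complex_of_real ((norm x)\<^sup>2))"
    by simp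
qed

lemma cinner_scaleC_right: "cinner x (c *\<^sub>C y) = cnj c * cinner x (y::'a::complex_inner)"
  by (metis cinner_commute cinner_scaleC_left complex_cnj_mult)

lemma cinner_add_right: "cinner x (y + z) = cinner x y + cinner x (z::'a::complex_inner)"
  by (metis cinner_commute cinner_add_left complex_cnj_add)

lemma norm_scaleC: "norm (c *\<^sub>C x) = cmod c * norm (x::'a::complex_inner)"
proof -
  have "complex_of_real ((norm (c *\<^sub>C x))\<^sup>2) = (c * cnj c) * cinner x x"
    by (simp add: cinner_self[symmetric] cinner_scaleC_left cinner_scaleC_right del: of_real_power)
  also have "\<dots> = complex_of_real ((cmod c * norm x)\<^sup>2)"
    by (simp add: cinner_self complex_norm_square[symmetric] power_mult_distrib)
  finally have "(norm (c *\<^sub>C x))\<^sup>2 = (cmod c * norm x)\<^sup>2"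
    using of_real_eq_iff by blast
  then show ?thesis
    by (simp add: power2_eq_iff_nonneg)
qed

lemma norm_cinner_le: "cmod (cinner x y) \<le> norm x * norm (y::'a::complex_inner)"
proof (cases "cinner x y = 0")
  case False
  define u where "u = cnj (sgn (cinner x y))"
  have u: "cmod u = 1" using False by (simp add: u_def norm_sgn)
  have "cinner (u *\<^sub>C x) y = complex_of_real (cmod (cinner x y))"
    using False
    by (simp add: cinner_scaleC_left u_def sgn_div_norm scaleR_conv_of_real field_simps
        complex_norm_square[symmetric] power2_eq_square)
  then have "cmod (cinner x y) = inner (u *\<^sub>C x) y"
    by (simp add: inner_eq_Re_cinner)
  also have "\<dots> \<le> norm (u *\<^sub>C x) * norm y"
    by (rule norm_cauchy_schwarz)
  finally show ?thesis by (simp add: norm_scaleC u)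
qed simp

section \<open>Hilbert space tensor product with square-summable sequences\<close>

text \<open>
  The Hilbert space tensor product of \<open>H\<close> with \<open>\<ell>\<^sup>2(I)\<close> is modelled as the Hilbert space of
  square-summable families \<open>I \<rightarrow> H\<close>; the elementary tensor of \<open>\<xi>\<close> with the basis vector at \<open>k\<close>
  is the family with value \<open>\<xi>\<close> at \<open>k\<close> and \<open>0\<close> elsewhere.
\<close>

typedef (overloaded) ('i, 'h) ell2 =
  "{f :: 'i \<Rightarrow> 'h::complex_inner. (\<lambda>i. (norm (f i))\<^sup>2) summable_on UNIV}"
  morphisms ell2_nth Abs_ell2
  by (rule exI[of _ "\<lambda>_. 0"]) simp

setup_lifting type_definition_ell2

lemma ell2_add_summable:
  fixes f g :: "'i \<Rightarrow> 'h::complex_inner"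
  assumes "(\<lambda>i. (norm (f i))\<^sup>2) summable_on UNIV" "(\<lambda>i. (norm (g i))\<^sup>2) summable_on UNIV"
  shows "(\<lambda>i. (norm (f i + g i))\<^sup>2) summable_on UNIV"
proof (rule summable_on_comparison_test)
  show "(\<lambda>i. 2 * (norm (f i))\<^sup>2 + 2 * (norm (g i))\<^sup>2) summable_on UNIV"
    by (intro summable_on_add summable_on_cmult_right assms)
  fix i
  have "(norm (f i + g i))\<^sup>2 \<le> (norm (f i) + norm (g i))\<^sup>2"
    by (simp add: norm_triangle_ineq power_mono)
  also have "\<dots> \<le> 2 * (norm (f i))\<^sup>2 + 2 * (norm (g i))\<^sup>2"
    using sum_squares_bound[of "norm (f i)" "norm (g i)"] by (simp add: power2_sum)
  finally show "(norm (f i + g i))\<^sup>2 \<le> 2 * (norm (f i))\<^sup>2 + 2 * (norm (g i))\<^sup>2" .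
qed auto

lemma ell2_scale_summable:
  fixes f :: "'i \<Rightarrow> 'h::complex_inner"
  assumes "(\<lambda>i. (norm (f i))\<^sup>2) summable_on UNIV"
  shows "(\<lambda>i. (norm (c *\<^sub>C f i))\<^sup>2) summable_on UNIV"
  unfolding norm_scaleC power_mult_distrib by (intro summable_on_cmult_right assms)

lemma ell2_cinner_summable:
  fixes f g :: "'i \<Rightarrow> 'h::complex_inner"
  assumes "(\<lambda>i. (norm (f i))\<^sup>2) summable_on UNIV" "(\<lambda>i. (norm (g i))\<^sup>2) summable_on UNIV"
  shows "(\<lambda>i. cinner (f i) (g i)) summable_on UNIV"
proof (rule abs_summable_summable, rule summable_on_comparison_test)
  show "(\<lambda>i. (norm (f i))\<^sup>2 + (norm (g i))\<^sup>2) summable_on UNIV"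
    by (intro summable_on_add assms)
  fix i
  have "cmod (cinner (f i) (g i)) \<le> norm (f i) * norm (g i)"
    by (rule norm_cinner_le)
  also have "\<dots> \<le> (norm (f i))\<^sup>2 + (norm (g i))\<^sup>2"
    using sum_squares_bound[of "norm (f i)" "norm (g i)"]
      mult_nonneg_nonneg[of "norm (f i)" "norm (g i)"]
    by (simp del: mult_nonneg_nonneg) 
  finally show "cmod (cinner (f i) (g i)) \<le> (norm (f i))\<^sup>2 + (norm (g i))\<^sup>2" .
qed auto

lemma ell2_inner_summable:
  fixes f g :: "'i \<Rightarrow> 'h::complex_inner"
  assumes "(\<lambda>i. (norm (f i))\<^sup>2) summable_on UNIV" "(\<lambda>i. (norm (g i))\<^sup>2) summable_on UNIV"
  shows "(\<lambda>i. inner (f i) (g i)) summable_on UNIV"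
  using summable_on_Re[OF ell2_cinner_summable[OF assms]] by (simp add: inner_eq_Re_cinner)

instantiation ell2 :: (type, complex_inner) complex_inner
begin

lift_definition zero_ell2 :: "('a, 'b) ell2" is "\<lambda>_. 0" by simp
lift_definition plus_ell2 :: "('a, 'b) ell2 \<Rightarrow> ('a, 'b) ell2 \<Rightarrow> ('a, 'b) ell2"
  is "\<lambda>f g i. f i + g i" by (rule ell2_add_summable)
lift_definition uminus_ell2 :: "('a, 'b) ell2 \<Rightarrow> ('a, 'b) ell2"
  is "\<lambda>f i. - f i" by simp
lift_definition minus_ell2 :: "('a, 'b) ell2 \<Rightarrow> ('a, 'b) ell2 \<Rightarrow> ('a, 'b) ell2"
  is "\<lambda>f g i. f i - g i"
  subgoal for f g using ell2_add_summable[of f "\<lambda>i. - g i"] by simp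
  done
lift_definition scaleC_ell2 :: "complex \<Rightarrow> ('a, 'b) ell2 \<Rightarrow> ('a, 'b) ell2"
  is "\<lambda>c f i. c *\<^sub>C f i" by (rule ell2_scale_summable)
definition scaleR_ell2 :: "real \<Rightarrow> ('a, 'b) ell2 \<Rightarrow> ('a, 'b) ell2"
  where "scaleR_ell2 r f = complex_of_real r *\<^sub>C f"
lift_definition cinner_ell2 :: "('a, 'b) ell2 \<Rightarrow> ('a, 'b) ell2 \<Rightarrow> complex"
  is "\<lambda>f g. \<Sum>\<^sub>\<infinity>i. cinner (f i) (g i)" .
definition inner_ell2 :: "('a, 'b) ell2 \<Rightarrow> ('a, 'b) ell2 \<Rightarrow> real"
  where "inner_ell2 f g = Re (cinner f g)"
definition norm_ell2 :: "('a, 'b) ell2 \<Rightarrow> real"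
  where "norm_ell2 f = sqrt (inner f f)"
definition dist_ell2 :: "('a, 'b) ell2 \<Rightarrow> ('a, 'b) ell2 \<Rightarrow> real"
  where "dist_ell2 f g = norm (f - g)"
definition sgn_ell2 :: "('a, 'b) ell2 \<Rightarrow> ('a, 'b) ell2"
  where "sgn_ell2 f = inverse (norm f) *\<^sub>R f"
definition uniformity_ell2 :: "(('a, 'b) ell2 \<times> ('a, 'b) ell2) filter"
  where "uniformity_ell2 = (INF e\<in>{0<..}. principal {(x, y). dist x y < e})"
definition open_ell2 :: "('a, 'b) ell2 set \<Rightarrow> bool"
  where "open_ell2 S = (\<forall>x\<in>S. \<forall>\<^sub>F (x', y) in uniformity. x' = x \<longrightarrow> y \<in> S)"

instance
proof
  fix x y z :: "('a, 'b) ell2" and c d :: complex and r s :: real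
  show "x + y + z = x + (y + z)" by transfer (simp add: add.assoc)
  show "x + y = y + x" by transfer (simp add: add.commute)
  show "0 + x = x" by transfer simp
  show "- x + x = 0" by transfer simp
  show "x - y = x + - y" by transfer simp
  show cr: "c *\<^sub>C (x + y) = c *\<^sub>C x + c *\<^sub>C y"
    for c and x y :: "('a, 'b) ell2"
    by transfer (simp add: scaleC_add_right)
  show cl: "(c + d) *\<^sub>C x = c *\<^sub>C x + d *\<^sub>C x" for c d
    by transfer (simp add: scaleC_add_left)
  show cc: "c *\<^sub>C d *\<^sub>C x = (c * d) *\<^sub>C x" for c d
    by transfer (simp add: scaleC_scaleC)
  show "r *\<^sub>R x = complex_of_real r *\<^sub>C x" by (simp add: scaleR_ell2_def)
  show "r *\<^sub>R (x + y) = r *\<^sub>R x + r *\<^sub>R y" by (simp add: scaleR_ell2_def cr)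
  show "(r + s) *\<^sub>R x = r *\<^sub>R x + s *\<^sub>R x" by (simp add: scaleR_ell2_def cl)
  show "r *\<^sub>R s *\<^sub>R x = (r * s) *\<^sub>R x" by (simp add: scaleR_ell2_def cc)
  show "1 *\<^sub>R x = x" unfolding scaleR_ell2_def by transfer simp
  show "dist x y = norm (x - y)" by (simp add: dist_ell2_def)
  show "sgn x = inverse (norm x) *\<^sub>R x" by (simp add: sgn_ell2_def)
  show "uniformity = (INF e\<in>{0<..}. principal {(x::('a, 'b) ell2, y). dist x y < e})"
    by (simp add: uniformity_ell2_def)
  show "open S = (\<forall>x\<in>S. \<forall>\<^sub>F (x', y) in uniformity. x' = x \<longrightarrow> y \<in> S)"
    for S :: "('a, 'b) ell2 set"
    by (simp add: open_ell2_def)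
  show cic: "cinner x y = cnj (cinner y x)" for x y :: "('a, 'b) ell2"
  proof transfer
    fix f g :: "'a \<Rightarrow> 'b"
    have "cnj (\<Sum>\<^sub>\<infinity>i. cinner (g i) (f i)) = (\<Sum>\<^sub>\<infinity>i. cnj (cinner (g i) (f i)))"
      by (rule infsum_cnj[symmetric])
    also have "\<dots> = (\<Sum>\<^sub>\<infinity>i. cinner (f i) (g i))"
      by (rule infsum_cong) (rule cinner_commute[symmetric])
    finally show "(\<Sum>\<^sub>\<infinity>i. cinner (f i) (g i)) = cnj (\<Sum>\<^sub>\<infinity>i. cinner (g i) (f i))" by simp
  qed
  show cia: "cinner (x + y) z = cinner x z + cinner y z"
    by transfer (simp add: cinner_add_left infsum_add ell2_cinner_summable)
  show cis: "cinner (c *\<^sub>C x) y = c * cinner x y" for c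
    by transfer (simp add: cinner_scaleC_left infsum_cmult_right ell2_cinner_summable)
  show "inner x y = Re (cinner x y)" by (simp add: inner_ell2_def)
  show "inner x y = inner y x"
    unfolding inner_ell2_def by (subst cic) simp
  show "inner (x + y) z = inner x z + inner y z" by (simp add: inner_ell2_def cia)
  show "inner (r *\<^sub>R x) y = r * inner x y" by (simp add: inner_ell2_def scaleR_ell2_def cis)
  have self: "inner x x = (\<Sum>\<^sub>\<infinity>i. (norm (ell2_nth x i))\<^sup>2)"
    unfolding inner_ell2_def
  proof transfer
    fix f :: "'a \<Rightarrow> 'b"
    assume "(\<lambda>i. (norm (f i))\<^sup>2) summable_on UNIV"
    then have "((\<lambda>i. complex_of_real ((norm (f i))\<^sup>2)) has_sum
        complex_of_real (\<Sum>\<^sub>\<infinity>i. (norm (f i))\<^sup>2)) UNIV"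
      by (intro has_sum_of_real) simp
    then show "Re (\<Sum>\<^sub>\<infinity>i. cinner (f i) (f i)) = (\<Sum>\<^sub>\<infinity>i. (norm (f i))\<^sup>2)"
      by (simp add: cinner_self infsumI)
  qed
  show "0 \<le> inner x x" unfolding self by (rule infsum_nonneg) simp
  show "(inner x x = 0) = (x = 0)"
  proof
    assume 0: "inner x x = 0"
    have "(norm (ell2_nth x i))\<^sup>2 = 0" for i
    proof (rule nonneg_infsum_le_0D[of "\<lambda>i. (norm (ell2_nth x i))\<^sup>2" UNIV])
      show "(\<lambda>i. (norm (ell2_nth x i))\<^sup>2) summable_on UNIV"
        using ell2_nth[of x] by simp
    qed (use 0 self in auto)
    then show "x = 0" by transfer auto
  next
    assume "x = 0"
    then show "inner x x = 0" unfolding self by (simp add: zero_ell2.rep_eq)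
  qed
  show "norm x = sqrt (inner x x)" by (simp add: norm_ell2_def)
qed

end

lemma ell2_nth_summable: "(\<lambda>i. (norm (ell2_nth x i))\<^sup>2) summable_on UNIV"
  using ell2_nth[of x] by simp

lemma norm_ell2_sq: "(norm (x::('i, 'h::complex_inner) ell2))\<^sup>2 = (\<Sum>\<^sub>\<infinity>i. (norm (ell2_nth x i))\<^sup>2)"
proof -
  have "((\<lambda>i. complex_of_real ((norm (ell2_nth x i))\<^sup>2)) has_sum
        complex_of_real (\<Sum>\<^sub>\<infinity>i. (norm (ell2_nth x i))\<^sup>2)) UNIV"
    by (intro has_sum_of_real) (simp add: ell2_nth_summable)
  then have "cinner x x = complex_of_real (\<Sum>\<^sub>\<infinity>i. (norm (ell2_nth x i))\<^sup>2)"
    by (simp add: cinner_ell2.rep_eq cinner_self[of "ell2_nth x _"] infsumI)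
  then show ?thesis by (simp add: cinner_self del: of_real_power)
qed

lemma sum_norm_sq_le_ell2:
  assumes "finite S"
  shows "(\<Sum>i\<in>S. (norm (ell2_nth x i))\<^sup>2) \<le> (norm x)\<^sup>2"
  unfolding norm_ell2_sq
  by (rule finite_sum_le_infsum[OF ell2_nth_summable assms]) auto

lemma norm_nth_le_ell2: "norm (ell2_nth x i) \<le> norm x"
proof (rule power2_le_imp_le)
  show "(norm (ell2_nth x i))\<^sup>2 \<le> (norm x)\<^sup>2"
    using sum_norm_sq_le_ell2[of "{i}" x] by simp
qed simp

lemma bounded_sums_ell2:
  fixes f :: "'i \<Rightarrow> 'h::complex_inner"
  assumes "\<And>S. finite S \<Longrightarrow> (\<Sum>i\<in>S. (norm (f i))\<^sup>2) \<le> B\<^sup>2" "0 \<le> B"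
  shows "(\<lambda>i. (norm (f i))\<^sup>2) summable_on UNIV" "norm (Abs_ell2 f) \<le> B"
proof -
  show s: "(\<lambda>i. (norm (f i))\<^sup>2) summable_on UNIV"
  proof (rule nonneg_bounded_partial_sums_imp_summable_on)
    show "\<forall>\<^sub>F S in finite_subsets_at_top UNIV. (\<Sum>i\<in>S. (norm (f i))\<^sup>2) \<le> B\<^sup>2"
      by (rule eventually_finite_subsets_at_top_weakI) (rule assms(1))
  qed simp
  then have "(norm (Abs_ell2 f))\<^sup>2 = (\<Sum>\<^sub>\<infinity>i. (norm (f i))\<^sup>2)"
    by (subst norm_ell2_sq) (simp add: Abs_ell2_inverse)
  also have "\<dots> \<le> B\<^sup>2"
    by (rule infsum_le_finite_sums[OF s]) (rule assms(1))
  finally show "norm (Abs_ell2 f) \<le> B"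
    using assms(2) by (rule power2_le_imp_le)
qed

instance ell2 :: (type, complex_hilbert) complex_hilbert
proof
  fix X :: "nat \<Rightarrow> ('a, 'b) ell2"
  assume X: "Cauchy X"
  have "Cauchy (\<lambda>n. ell2_nth (X n) i)" for i
  proof (rule CauchyI)
    fix e :: real assume "0 < e"
    then obtain M where "\<And>m n. m \<ge> M \<Longrightarrow> n \<ge> M \<Longrightarrow> norm (X m - X n) < e"
      using CauchyD[OF X] by blast
    then show "\<exists>M. \<forall>m\<ge>M. \<forall>n\<ge>M. norm (ell2_nth (X m) i - ell2_nth (X n) i) < e"
      by (metis minus_ell2.rep_eq norm_nth_le_ell2 order_le_less_trans)
  qed
  then have L: "(\<lambda>n. ell2_nth (X n) i) \<longlonglongrightarrow> lim (\<lambda>n. ell2_nth (X n) i)" for i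
    by (simp add: Cauchy_convergent convergent_LIMSEQ_iff[symmetric])
  define L where "L i = lim (\<lambda>n. ell2_nth (X n) i)" for i
  note L = L[folded L_def]
  have key: "\<exists>M. \<forall>n\<ge>M. (\<lambda>i. (norm (ell2_nth (X n) i - L i))\<^sup>2) summable_on UNIV \<and>
      norm (Abs_ell2 (\<lambda>i. ell2_nth (X n) i - L i)) \<le> e" if e: "e > 0" for e
  proof -
    obtain M where M: "\<And>m n. m \<ge> M \<Longrightarrow> n \<ge> M \<Longrightarrow> norm (X m - X n) < e"
      using CauchyD[OF X e] by blast
    have "(\<Sum>i\<in>S. (norm (ell2_nth (X n) i - L i))\<^sup>2) \<le> e\<^sup>2" if "n \<ge> M" "finite S" for n S
    proof (rule LIMSEQ_le_const2)
      show "(\<lambda>m. \<Sum>i\<in>S. (norm (ell2_nth (X n) i - ell2_nth (X m) i))\<^sup>2)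
          \<longlonglongrightarrow> (\<Sum>i\<in>S. (norm (ell2_nth (X n) i - L i))\<^sup>2)"
        by (intro tendsto_intros L)
      have "(\<Sum>i\<in>S. (norm (ell2_nth (X n) i - ell2_nth (X m) i))\<^sup>2) \<le> e\<^sup>2" if "m \<ge> M" for m
      proof -
        have "(\<Sum>i\<in>S. (norm (ell2_nth (X n) i - ell2_nth (X m) i))\<^sup>2) \<le> (norm (X n - X m))\<^sup>2"
          using sum_norm_sq_le_ell2[OF \<open>finite S\<close>, of "X n - X m"] by (simp add: minus_ell2.rep_eq)
        also have "\<dots> \<le> e\<^sup>2"
          using M[OF \<open>n \<ge> M\<close> that] by (simp add: power_mono)
        finally show ?thesis .
      qed
      then show "\<exists>N. \<forall>m\<ge>N. (\<Sum>i\<in>S. (norm (ell2_nth (X n) i - ell2_nth (X m) i))\<^sup>2) \<le> e\<^sup>2"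
        by blast
    qed
    then have "(\<lambda>i. (norm (ell2_nth (X n) i - L i))\<^sup>2) summable_on UNIV \<and>
        norm (Abs_ell2 (\<lambda>i. ell2_nth (X n) i - L i)) \<le> e" if "n \<ge> M" for n
      using bounded_sums_ell2[of "\<lambda>i. ell2_nth (X n) i - L i" e] that e by simp
    then show ?thesis by blast
  qed
  obtain M where M: "(\<lambda>i. (norm (ell2_nth (X M) i - L i))\<^sup>2) summable_on UNIV"
    using key[of 1] by auto
  have Ls: "(\<lambda>i. (norm (L i))\<^sup>2) summable_on UNIV"
    using ell2_add_summable[of "\<lambda>i. ell2_nth (X M) i" "\<lambda>i. - (ell2_nth (X M) i - L i)"] M
    by (simp add: ell2_nth_summable norm_minus_commute)
  have "X \<longlonglongrightarrow> Abs_ell2 L"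
  proof (rule LIMSEQ_I)
    fix e :: real assume "0 < e"
    then obtain N where N: "\<And>n. n \<ge> N \<Longrightarrow> (\<lambda>i. (norm (ell2_nth (X n) i - L i))\<^sup>2) summable_on UNIV \<and>
      norm (Abs_ell2 (\<lambda>i. ell2_nth (X n) i - L i)) \<le> e / 2"
      using key[of "e/2"] by auto
    have "Abs_ell2 (\<lambda>i. ell2_nth (X n) i - L i) = X n - Abs_ell2 L" if "n \<ge> N" for n
      using N[OF that] Ls
      by (subst ell2_nth_inject[symmetric], intro ext) (simp add: minus_ell2.rep_eq Abs_ell2_inverse)
    then have "norm (X n - Abs_ell2 L) < e" if "n \<ge> N" for n
      using N[OF that] that \<open>0 < e\<close> by fastforce
    then show "\<exists>N. \<forall>n\<ge>N. norm (X n - Abs_ell2 L) < e" by blast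
  qed
  then show "convergent X" by (auto simp: convergent_def)
qed

lift_definition tensor :: "'h::complex_inner \<Rightarrow> 'i \<Rightarrow> ('i, 'h) ell2"  (infix \<open>\<otimes>e\<close> 75)
  is "\<lambda>\<xi> k i. if i = k then \<xi> else 0"
  subgoal for \<xi> k
    by (rule finite_nonzero_values_imp_summable_on, rule finite_subset[of _ "{k}"]) auto
  done

section \<open>Bounded operators on a complex Hilbert space\<close>

typedef (overloaded) 'h bop =
  "{T :: 'h::complex_inner \<Rightarrow>\<^sub>L 'h. \<forall>c x. T (c *\<^sub>C x) = c *\<^sub>C T x}"
  morphisms blinfun_of_bop Abs_bop
  by (rule exI[of _ 0]) simp

setup_lifting type_definition_bop

lift_definition bop_apply :: "'h::complex_inner bop \<Rightarrow> 'h \<Rightarrow> 'h"  (infixl \<open>\<cdot>\<close> 80)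
  is "\<lambda>T. blinfun_apply T" .

text \<open>The norm on \<^typ>\<open>'h bop\<close> is the operator norm, multiplication is composition.\<close>

instantiation bop :: (complex_inner) "{complex_algebra, real_normed_algebra}"
begin

lift_definition zero_bop :: "'a bop" is 0 by simp
lift_definition plus_bop :: "'a bop \<Rightarrow> 'a bop \<Rightarrow> 'a bop" is "(+)"
  by (simp add: blinfun.add_left scaleC_add_right)
lift_definition uminus_bop :: "'a bop \<Rightarrow> 'a bop" is uminus
  by (simp add: blinfun.minus_left)
lift_definition minus_bop :: "'a bop \<Rightarrow> 'a bop \<Rightarrow> 'a bop" is "(-)"
  by (simp add: blinfun.diff_left cvec.scale_right_diff_distrib)
lift_definition times_bop :: "'a bop \<Rightarrow> 'a bop \<Rightarrow> 'a bop" is "(o\<^sub>L)"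
  by simp
lemma bounded_linear_scaleC: "bounded_linear (\<lambda>x::'a. c *\<^sub>C x)"
  by (rule bounded_linear_intro[of _ "cmod c"])
    (simp_all add: scaleC_add_right scaleR_scaleC scaleC_scaleC norm_scaleC mult.commute)
lift_definition scaleC_bop :: "complex \<Rightarrow> 'a bop \<Rightarrow> 'a bop"
  is "\<lambda>c T. Blinfun (\<lambda>x. c *\<^sub>C x) o\<^sub>L T"
  by (simp add: bounded_linear_Blinfun_apply bounded_linear_scaleC scaleC_scaleC mult.commute)
lift_definition scaleR_bop :: "real \<Rightarrow> 'a bop \<Rightarrow> 'a bop" is "scaleR"
  by (simp add: blinfun.scaleR_left scaleR_scaleC scaleC_scaleC mult.commute)
lift_definition norm_bop :: "'a bop \<Rightarrow> real" is norm .
definition dist_bop :: "'a bop \<Rightarrow> 'a bop \<Rightarrow> real"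
  where "dist_bop S T = norm (S - T)"
definition sgn_bop :: "'a bop \<Rightarrow> 'a bop"
  where "sgn_bop T = inverse (norm T) *\<^sub>R T"
definition uniformity_bop :: "('a bop \<times> 'a bop) filter"
  where "uniformity_bop = (INF e\<in>{0<..}. principal {(x, y). dist x y < e})"
definition open_bop :: "'a bop set \<Rightarrow> bool"
  where "open_bop S = (\<forall>x\<in>S. \<forall>\<^sub>F (x', y) in uniformity. x' = x \<longrightarrow> y \<in> S)"

instance
proof
  fix x y z :: "'a bop" and c d :: complex and r s :: real
  note bl = bounded_linear_Blinfun_apply[OF bounded_linear_scaleC]
  show "x + y + z = x + (y + z)" by transfer simp
  show "x + y = y + x" by transfer simp
  show "0 + x = x" by transfer simp
  show "- x + x = 0" by transfer simp
  show "x - y = x + - y" by transfer simp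
  show "c *\<^sub>C (x + y) = c *\<^sub>C x + c *\<^sub>C y"
    by transfer (rule blinfun_eqI, simp add: bl blinfun.add_left scaleC_add_right)
  show "(c + d) *\<^sub>C x = c *\<^sub>C x + d *\<^sub>C x"
    by transfer (rule blinfun_eqI, simp add: bl blinfun.add_left scaleC_add_left)
  show "c *\<^sub>C d *\<^sub>C x = (c * d) *\<^sub>C x"
    by transfer (rule blinfun_eqI, simp add: bl scaleC_scaleC)
  show "r *\<^sub>R x = complex_of_real r *\<^sub>C x"
    by transfer (rule blinfun_eqI, simp add: bl blinfun.scaleR_left scaleR_scaleC)
  show "r *\<^sub>R (x + y) = r *\<^sub>R x + r *\<^sub>R y" by transfer (simp add: scaleR_add_right)
  show "(r + s) *\<^sub>R x = r *\<^sub>R x + s *\<^sub>R x" by transfer (simp add: scaleR_add_left)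
  show "r *\<^sub>R s *\<^sub>R x = (r * s) *\<^sub>R x" by transfer simp
  show "1 *\<^sub>R x = x" by transfer simp
  show "x * y * z = x * (y * z)" by transfer (rule blinfun_eqI, simp)
  show "(x + y) * z = x * z + y * z"
    by transfer (rule blinfun_eqI, simp add: blinfun.add_left)
  show "x * (y + z) = x * y + x * z"
    by transfer (rule blinfun_eqI, simp add: blinfun.add_left blinfun.add_right)
  show "(c *\<^sub>C x) * y = c *\<^sub>C (x * y)" by transfer (rule blinfun_eqI, simp)
  show "x * (c *\<^sub>C y) = c *\<^sub>C (x * y)" by transfer (rule blinfun_eqI, simp add: bl)
  show "(r *\<^sub>R x) * y = r *\<^sub>R (x * y)"
    by transfer (rule blinfun_eqI, simp add: blinfun.scaleR_left)
  show "x * (r *\<^sub>R y) = r *\<^sub>R (x * y)"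
    by transfer (rule blinfun_eqI, simp add: blinfun.scaleR_left blinfun.scaleR_right)
  show "dist x y = norm (x - y)" by (simp add: dist_bop_def)
  show "sgn x = inverse (norm x) *\<^sub>R x" by (simp add: sgn_bop_def)
  show "uniformity = (INF e\<in>{0<..}. principal {(x::'a bop, y). dist x y < e})"
    by (simp add: uniformity_bop_def)
  show "open S = (\<forall>x\<in>S. \<forall>\<^sub>F (x', y) in uniformity. x' = x \<longrightarrow> y \<in> S)" for S :: "'a bop set"
    by (simp add: open_bop_def)
  show "(norm x = 0) = (x = 0)" by transfer simp
  show "norm (x + y) \<le> norm x + norm y" by transfer (rule norm_triangle_ineq)
  show "norm (r *\<^sub>R x) = \<bar>r\<bar> * norm x" by transfer simp
  show "norm (x * y) \<le> norm x * norm y" by transfer (rule norm_blinfun_compose)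
qed

end

lemma bop_eqI: "(\<And>x. S \<cdot> x = T \<cdot> x) \<Longrightarrow> S = T"
  by transfer (rule blinfun_eqI)

lemma bop_plus_apply: "(S + T) \<cdot> x = S \<cdot> x + T \<cdot> x"
  by transfer (simp add: blinfun.add_left)

lemma bop_minus_apply: "(S - T) \<cdot> x = S \<cdot> x - T \<cdot> x"
  by transfer (simp add: blinfun.diff_left)

lemma bop_scaleR_apply: "(r *\<^sub>R T) \<cdot> x = r *\<^sub>R (T \<cdot> x)"
  by transfer (simp add: blinfun.scaleR_left)

lemma bop_times_apply: "(S * T) \<cdot> x = S \<cdot> (T \<cdot> x)"
  by transfer simp

lemma bop_scaleC_apply: "(c *\<^sub>C T) \<cdot> x = c *\<^sub>C (T \<cdot> x)"
  by transfer (simp add: bounded_linear_Blinfun_apply bounded_linear_scaleC)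

lemma bop_apply_add: "T \<cdot> (x + y) = T \<cdot> x + T \<cdot> y"
  by transfer (simp add: blinfun.add_right)

lemma bop_apply_diff: "T \<cdot> (x - y) = T \<cdot> x - T \<cdot> y"
  by transfer (simp add: blinfun.diff_right)

lemma bop_apply_sum: "T \<cdot> (\<Sum>i\<in>S. f i) = (\<Sum>i\<in>S. T \<cdot> f i)"
  by transfer (simp add: blinfun.sum_right)

lemma bop_apply_scaleC: "T \<cdot> (c *\<^sub>C x) = c *\<^sub>C (T \<cdot> x)"
  by transfer simp

lemma norm_bop_apply: "norm (T \<cdot> x) \<le> norm T * norm x"
  by transfer (rule norm_blinfun)

lemma bounded_linear_bop_apply: "bounded_linear (\<lambda>T. T \<cdot> x)"
  by (rule bounded_linear_intro[of _ "norm x"])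
    (simp_all add: bop_plus_apply bop_scaleR_apply norm_bop_apply)

lemma bop_exI:
  fixes f :: "'h::complex_inner \<Rightarrow> 'h"
  assumes "\<And>x y. f (x + y) = f x + f y" "\<And>c x. f (c *\<^sub>C x) = c *\<^sub>C f x"
    "\<And>x. norm (f x) \<le> norm x * K"
  shows "\<exists>T. \<forall>x. T \<cdot> x = f x"
proof -
  have bl: "bounded_linear f"
    by (rule bounded_linear_intro[of _ K]) (simp_all add: assms scaleR_scaleC)
  have "Abs_bop (Blinfun f) \<cdot> x = f x" for x
    by (simp add: bop_apply.rep_eq Abs_bop_inverse bounded_linear_Blinfun_apply[OF bl] assms)
  then show ?thesis by blast
qed

lemma norm_bop_le: "0 \<le> K \<Longrightarrow> (\<And>x. norm (T \<cdot> x) \<le> K * norm x) \<Longrightarrow> norm T \<le> K"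
  by transfer (rule norm_blinfun_bound)

instance bop :: (complex_hilbert) banach
proof
  fix X :: "nat \<Rightarrow> 'a bop"
  assume X: "Cauchy X"
  have isom: "norm (blinfun_of_bop S - blinfun_of_bop T) = norm (S - T)" for S T :: "'a bop"
    by transfer simp
  have "Cauchy (\<lambda>n. blinfun_of_bop (X n))"
    using X by (simp add: Cauchy_iff isom)
  then obtain L where L: "(\<lambda>n. blinfun_of_bop (X n)) \<longlonglongrightarrow> L"
    using Cauchy_convergent convergent_def by blast
  have app: "(\<lambda>n. blinfun_of_bop (X n) x) \<longlonglongrightarrow> L x" for x
    by (intro blinfun.tendsto L tendsto_const)
  have "L (c *\<^sub>C x) = c *\<^sub>C L x" for c x
  proof (rule LIMSEQ_unique[OF app])
    have "blinfun_of_bop (X n) (c *\<^sub>C x) = c *\<^sub>C blinfun_of_bop (X n) x" for n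
      using blinfun_of_bop[of "X n"] by simp
    then show "(\<lambda>n. blinfun_of_bop (X n) (c *\<^sub>C x)) \<longlonglongrightarrow> c *\<^sub>C L x"
      using bounded_linear.tendsto[OF bounded_linear_scaleC app] by simp
  qed
  then have "blinfun_of_bop (Abs_bop L) = L"
    by (simp add: Abs_bop_inverse)
  then have "X \<longlonglongrightarrow> Abs_bop L"
    using L by (simp add: LIMSEQ_iff isom[symmetric])
  then show "convergent X" by (auto simp: convergent_def)
qed

section \<open>Ideals, representations and radicals\<close>

text \<open>
  All notions refer to a complex algebra, not necessarily unital, given as a subalgebra \<open>A\<close> of an
  ambient one.
\<close>

definition complex_subspace :: "'a::complex_vector set \<Rightarrow> bool" where
  "complex_subspace S \<longleftrightarrow> 0 \<in> S \<and> (\<forall>x\<in>S. \<forall>y\<in>S. x + y \<in> S) \<and> (\<forall>c. \<forall>x\<in>S. c *\<^sub>C x \<in> S)"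

definition two_sided_ideal :: "'a::complex_algebra set \<Rightarrow> 'a set \<Rightarrow> bool" where
  "two_sided_ideal A J \<longleftrightarrow>
     J \<subseteq> A \<and> complex_subspace J \<and> (\<forall>a\<in>A. \<forall>j\<in>J. a * j \<in> J \<and> j * a \<in> J)"

definition ideal_product :: "'a::complex_algebra set \<Rightarrow> 'a set \<Rightarrow> 'a set" where
  "ideal_product I J = {\<Sum>i<n. a i * b i | (n::nat) a b. \<forall>i<n. a i \<in> I \<and> b i \<in> J}"

text \<open>\<^term>\<open>P = A\<close> is admitted as a prime ideal; this does not affect the prime radical.\<close>

definition prime_ideal :: "'a::complex_algebra set \<Rightarrow> 'a set \<Rightarrow> bool" where
  "prime_ideal A P \<longleftrightarrow> two_sided_ideal A P \<and>
     (\<forall>I J. two_sided_ideal A I \<and> two_sided_ideal A J \<and> ideal_product I J \<subseteq> P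
        \<longrightarrow> I \<subseteq> P \<or> J \<subseteq> P)"

definition prime_radical :: "'a::complex_algebra set \<Rightarrow> 'a set" where
  "prime_radical A = A \<inter> \<Inter>{P. prime_ideal A P}"

definition semiprime :: "'a::complex_algebra set \<Rightarrow> bool" where
  "semiprime A \<longleftrightarrow> prime_radical A = {0}"

definition algebra_representation ::
    "'a::complex_algebra set \<Rightarrow> 'v::complex_vector set \<Rightarrow> ('a \<Rightarrow> 'v \<Rightarrow> 'v) \<Rightarrow> bool" where
  "algebra_representation A V \<pi> \<longleftrightarrow>
     complex_subspace V \<and>
     (\<forall>a\<in>A. \<forall>v\<in>V. \<pi> a v \<in> V) \<and>
     (\<forall>a\<in>A. \<forall>v\<in>V. \<forall>w\<in>V. \<pi> a (v + w) = \<pi> a v + \<pi> a w) \<and>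
     (\<forall>a\<in>A. \<forall>c. \<forall>v\<in>V. \<pi> a (c *\<^sub>C v) = c *\<^sub>C \<pi> a v) \<and>
     (\<forall>a\<in>A. \<forall>b\<in>A. \<forall>v\<in>V. \<pi> (a + b) v = \<pi> a v + \<pi> b v) \<and>
     (\<forall>c. \<forall>a\<in>A. \<forall>v\<in>V. \<pi> (c *\<^sub>C a) v = c *\<^sub>C \<pi> a v) \<and>
     (\<forall>a\<in>A. \<forall>b\<in>A. \<forall>v\<in>V. \<pi> (a * b) v = \<pi> a (\<pi> b v))"

definition irreducible_representation ::
    "'a::complex_algebra set \<Rightarrow> 'v::complex_vector set \<Rightarrow> ('a \<Rightarrow> 'v \<Rightarrow> 'v) \<Rightarrow> bool" where
  "irreducible_representation A V \<pi> \<longleftrightarrow>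
     algebra_representation A V \<pi> \<and>
     (\<exists>a\<in>A. \<exists>v\<in>V. \<pi> a v \<noteq> 0) \<and>
     (\<forall>W\<subseteq>V. complex_subspace W \<and> (\<forall>a\<in>A. \<forall>w\<in>W. \<pi> a w \<in> W) \<longrightarrow> W = {0} \<or> W = V)"

definition representation_kernel :: "'a set \<Rightarrow> 'v::zero set \<Rightarrow> ('a \<Rightarrow> 'v \<Rightarrow> 'v) \<Rightarrow> 'a set" where
  "representation_kernel A V \<pi> = {a\<in>A. \<forall>v\<in>V. \<pi> a v = 0}"

text \<open>
  HOL cannot quantify over the type of the representation space here, so the space ranges over the
  complex linear subspaces of the ambient algebra. This loses nothing: an irreducible module is
  a quotient of \<open>A\<close> by a left ideal, hence isomorphic to a linear complement of that left ideal; see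
  \<open>primitive_ideal_kernel\<close> below.
\<close>

definition primitive_ideal :: "'a::complex_algebra set \<Rightarrow> 'a set \<Rightarrow> bool" where
  "primitive_ideal A P \<longleftrightarrow>
     (\<exists>(V::'a set) \<pi>. irreducible_representation A V \<pi> \<and> P = representation_kernel A V \<pi>)"

lemma primitive_ideal_kernel:
  fixes A :: "'a::complex_algebra set" and V :: "'v::complex_vector set"
  assumes A: "complex_subspace A" "\<And>a b. a \<in> A \<Longrightarrow> b \<in> A \<Longrightarrow> a * b \<in> A"
    and irr: "irreducible_representation A V \<pi>"
  shows "primitive_ideal A (representation_kernel A V \<pi>)"
proof -
  note [simp] = scaleC_scaleC
  have A0: "0 \<in> A" and A_add: "\<And>a b. a \<in> A \<Longrightarrow> b \<in> A \<Longrightarrow> a + b \<in> A"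
    and A_scale: "\<And>c a. a \<in> A \<Longrightarrow> c *\<^sub>C a \<in> A"
    using A(1) by (auto simp: complex_subspace_def)
  have rep: "algebra_representation A V \<pi>"
    and min: "\<And>W. W \<subseteq> V \<Longrightarrow> complex_subspace W \<Longrightarrow> (\<And>a w. a \<in> A \<Longrightarrow> w \<in> W \<Longrightarrow> \<pi> a w \<in> W)
        \<Longrightarrow> W = {0} \<or> W = V"
    using irr unfolding irreducible_representation_def by blast+
  obtain a0 v0 where a0: "a0 \<in> A" "v0 \<in> V" "\<pi> a0 v0 \<noteq> 0"
    using irr unfolding irreducible_representation_def by blast
  have V: "complex_subspace V" and inV: "\<And>a v. a \<in> A \<Longrightarrow> v \<in> V \<Longrightarrow> \<pi> a v \<in> V"
    and addv: "\<And>a v w. a \<in> A \<Longrightarrow> v \<in> V \<Longrightarrow> w \<in> V \<Longrightarrow> \<pi> a (v + w) = \<pi> a v + \<pi> a w"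
    and scv: "\<And>a c v. a \<in> A \<Longrightarrow> v \<in> V \<Longrightarrow> \<pi> a (c *\<^sub>C v) = c *\<^sub>C \<pi> a v"
    and adda: "\<And>a b v. a \<in> A \<Longrightarrow> b \<in> A \<Longrightarrow> v \<in> V \<Longrightarrow> \<pi> (a + b) v = \<pi> a v + \<pi> b v"
    and sca: "\<And>a c v. a \<in> A \<Longrightarrow> v \<in> V \<Longrightarrow> \<pi> (c *\<^sub>C a) v = c *\<^sub>C \<pi> a v"
    and mul: "\<And>a b v. a \<in> A \<Longrightarrow> b \<in> A \<Longrightarrow> v \<in> V \<Longrightarrow> \<pi> (a * b) v = \<pi> a (\<pi> b v)"
    using rep unfolding algebra_representation_def by blast+
  have V0: "0 \<in> V" and V_add: "\<And>a b. a \<in> V \<Longrightarrow> b \<in> V \<Longrightarrow> a + b \<in> V"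
    and V_scale: "\<And>c a. a \<in> V \<Longrightarrow> c *\<^sub>C a \<in> V"
    using V by (auto simp: complex_subspace_def)
  have zero_v0: "\<pi> 0 v0 = 0"
    using sca[OF A0 a0(2), of 0] by simp
  have orbit: "(\<lambda>a. \<pi> a v0) ` A = V"
  proof -
    let ?W = "(\<lambda>a. \<pi> a v0) ` A"
    have "complex_subspace ?W"
      unfolding complex_subspace_def
    proof (intro conjI ballI allI)
      show "0 \<in> ?W" using A0 zero_v0 by force
    next
      fix x y assume "x \<in> ?W" "y \<in> ?W"
      then show "x + y \<in> ?W"
        using adda a0(2) A_add by (smt (verit, ccfv_threshold) image_iff)
    next
      fix c x assume "x \<in> ?W"
      then show "c *\<^sub>C x \<in> ?W"
        using sca a0(2) A_scale by (smt (verit, ccfv_threshold) image_iff)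
    qed
    moreover have "\<pi> a w \<in> ?W" if "a \<in> A" "w \<in> ?W" for a w
      using that mul a0(2) A(2) by (smt (verit, ccfv_threshold) image_iff)
    moreover have "?W \<subseteq> V" using inV a0 by auto
    ultimately have "?W = {0} \<or> ?W = V" by (intro min) auto
    then show ?thesis using a0 by auto
  qed
  have subV: "cvec.subspace V" using V by (auto simp: cvec.subspace_def complex_subspace_def)
  obtain B where B: "B \<subseteq> V" "cvec.independent B" "cvec.span B = V"
    by (metis cvec.basis_exists cvec.span_minimal subV subset_antisym)
  have "\<forall>b\<in>B. \<exists>a\<in>A. \<pi> a v0 = b"
    using B(1) orbit by blast
  then obtain s where s: "\<And>b. b \<in> B \<Longrightarrow> s b \<in> A" "\<And>b. b \<in> B \<Longrightarrow> \<pi> (s b) v0 = b"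
    by metis
  define g where "g = cvec_pair.construct B s"
  have lin: "Vector_Spaces.linear scaleC scaleC g"
    unfolding g_def by (rule cvec_pair.linear_construct[OF B(2)])
  interpret g: Vector_Spaces.linear scaleC scaleC g by (rule lin)
  note g_add = g.add and g_scale = g.scale
  note g0 = g.zero
  have g: "g v \<in> A \<and> \<pi> (g v) v0 = v" if "v \<in> V" for v
  proof -
    have "v \<in> cvec.span B" using that B by simp
    then show ?thesis
    proof (induction rule: cvec.span_induct_alt)
      case base
      then show ?case by (simp add: g0 A0 zero_v0)
    next
      case (step c x y)
      have "g x = s x" unfolding g_def
        by (rule cvec_pair.construct_basis[OF B(2) step(1)])
      with step s[of x] show ?case
        by (simp add: g_add g_scale A_add A_scale adda sca a0(2))
    qed
  qed
  have g_eq_0: "g v = 0 \<longleftrightarrow> v = 0" if "v \<in> V" for v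
    using g[OF that] g0 zero_v0 by auto
  define U where "U = g ` V"
  define \<sigma> where "\<sigma> a w = g (\<pi> a (\<pi> w v0))" for a w
  have \<sigma>: "\<sigma> a (g v) = g (\<pi> a v)" if "v \<in> V" for a v
    by (simp add: \<sigma>_def g[OF that])
  have U: "complex_subspace U"
    unfolding complex_subspace_def U_def
  proof (intro conjI ballI allI)
    show "0 \<in> g ` V" using V0 g0 by (metis imageI)
    show "x + y \<in> g ` V" if "x \<in> g ` V" "y \<in> g ` V" for x y
      using that V_add by (auto simp: g_add[symmetric])
    show "c *\<^sub>C x \<in> g ` V" if "x \<in> g ` V" for c x
      using that V_scale by (auto simp: g_scale[symmetric])
  qed
  have \<sigma>_add: "\<sigma> a (g v + g w) = g (\<pi> a (v + w))" if "v \<in> V" "w \<in> V" for a v w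
    using \<sigma>[OF V_add[OF that]] by (simp add: g_add)
  have \<sigma>_scale: "\<sigma> a (c *\<^sub>C g v) = g (\<pi> a (c *\<^sub>C v))" if "v \<in> V" for a c v
    using \<sigma>[OF V_scale[OF that]] by (simp add: g_scale)
  have "algebra_representation A U \<sigma>"
    unfolding algebra_representation_def
  proof (intro conjI)
    show "complex_subspace U" by (rule U)
  qed (auto simp: U_def \<sigma> \<sigma>_add \<sigma>_scale inV addv scv adda sca mul g_add g_scale)
  moreover have "\<exists>a\<in>A. \<exists>v\<in>U. \<sigma> a v \<noteq> 0"
    using a0 by (auto simp: U_def \<sigma> g_eq_0 inV)
  moreover have "W = {0} \<or> W = U"
    if W: "W \<subseteq> U" "complex_subspace W" "\<forall>a\<in>A. \<forall>w\<in>W. \<sigma> a w \<in> W" for W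
  proof -
    let ?W = "{v \<in> V. g v \<in> W}"
    have "complex_subspace ?W"
      using W(2) V0 V_add V_scale by (auto simp: complex_subspace_def g0 g_add g_scale)
    moreover have "\<pi> a w \<in> ?W" if "a \<in> A" "w \<in> ?W" for a w
      using that bspec[OF bspec[OF W(3)], of a "g w"] \<sigma>[of w a] inV by auto
    ultimately have "?W = {0} \<or> ?W = V"
      by (intro min) auto
    moreover have "W = g ` ?W" using W(1) by (auto simp: U_def)
    ultimately show ?thesis by (auto simp: U_def g0)
  qed
  moreover have "representation_kernel A V \<pi> = representation_kernel A U \<sigma>"
    by (auto simp: representation_kernel_def U_def \<sigma> g_eq_0 inV g0)
  ultimately show ?thesis
    unfolding primitive_ideal_def irreducible_representation_def by blast
qed

definition jacobson_radical :: "'a::complex_algebra set \<Rightarrow> 'a set" where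
  "jacobson_radical A = A \<inter> \<Inter>{P. primitive_ideal A P}"

definition semisimple :: "'a::complex_algebra set \<Rightarrow> bool" where
  "semisimple A \<longleftrightarrow> jacobson_radical A = {0}"

section \<open>Dynamical systems and the analytic crossed product\<close>

text \<open>\<^typ>\<open>nat ^ 'd\<close> with componentwise addition is the semigroup of multi-indices.\<close>

definition dynamical_system :: "(nat ^ 'd \<Rightarrow> 'x::topological_space \<Rightarrow> 'x) \<Rightarrow> bool" where
  "dynamical_system \<phi> \<longleftrightarrow>
     (\<forall>n. continuous_on UNIV (\<phi> n) \<and> proper_map euclidean euclidean (\<phi> n) \<and> surj (\<phi> n)) \<and>
     \<phi> 0 = id \<and> (\<forall>n m. \<phi> (n + m) = \<phi> n \<circ> \<phi> m) \<and> inj \<phi>"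

definition strongly_recurrent :: "(nat ^ 'd \<Rightarrow> 'x::topological_space \<Rightarrow> 'x) \<Rightarrow> 'x \<Rightarrow> bool" where
  "strongly_recurrent \<phi> x \<longleftrightarrow>
     (\<exists>s :: nat \<Rightarrow> nat ^ 'd. (\<forall>k j. s k $ j < s (Suc k) $ j) \<and> (\<lambda>k. \<phi> (s k) x) \<longlonglongrightarrow> x)"

definition C0 :: "('x::topological_space \<Rightarrow> complex) set" where
  "C0 = {f. continuous_on UNIV f \<and> (\<forall>e>0. \<exists>K. compact K \<and> (\<forall>x. x \<notin> K \<longrightarrow> cmod (f x) < e))}"

definition sup_norm :: "('x \<Rightarrow> complex) \<Rightarrow> real" where
  "sup_norm f = (SUP x. cmod (f x))"

definition faithful_star_rep ::
    "(('x::topological_space \<Rightarrow> complex) \<Rightarrow> 'h::complex_hilbert bop) \<Rightarrow> bool" where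
  "faithful_star_rep \<rho> \<longleftrightarrow>
     (\<forall>f\<in>C0. \<forall>g\<in>C0. \<rho> (\<lambda>x. f x + g x) = \<rho> f + \<rho> g) \<and>
     (\<forall>c. \<forall>f\<in>C0. \<rho> (\<lambda>x. c * f x) = c *\<^sub>C \<rho> f) \<and>
     (\<forall>f\<in>C0. \<forall>g\<in>C0. \<rho> (\<lambda>x. f x * g x) = \<rho> f * \<rho> g) \<and>
     (\<forall>f\<in>C0. \<forall>u v. cinner (\<rho> f \<cdot> u) v = cinner u (\<rho> (\<lambda>x. cnj (f x)) \<cdot> v)) \<and>
     inj_on \<rho> C0"

text \<open>The family \<open>F\<close> stands for the formal series with coefficients \<open>F n\<close>.\<close>

definition ell1_C0 :: "(nat ^ 'd \<Rightarrow> 'x::topological_space \<Rightarrow> complex) set" where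
  "ell1_C0 = {F. (\<forall>n. F n \<in> C0) \<and> (\<lambda>n. sup_norm (F n)) summable_on UNIV}"

text \<open>
  The bounded operator representing \<open>F\<close> is determined by its values on elementary tensors; see
  \<open>crossed_rep_unique_exists\<close> below for existence and uniqueness.
\<close>

definition crossed_rep ::
    "(('x::topological_space \<Rightarrow> complex) \<Rightarrow> 'h::complex_hilbert bop) \<Rightarrow> (nat ^ 'd \<Rightarrow> 'x \<Rightarrow> 'x) \<Rightarrow>
     (nat ^ 'd \<Rightarrow> 'x \<Rightarrow> complex) \<Rightarrow> (nat ^ 'd, 'h) ell2 bop" where
  "crossed_rep \<rho> \<phi> F =
     (THE T. \<forall>\<xi> k. ((\<lambda>n. (\<rho> (F n \<circ> \<phi> k) \<cdot> \<xi>) \<otimes>e (k + n)) has_sum T \<cdot> (\<xi> \<otimes>e k)) UNIV)"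

definition analytic_crossed_product ::
    "(('x::topological_space \<Rightarrow> complex) \<Rightarrow> 'h::complex_hilbert bop) \<Rightarrow> (nat ^ 'd \<Rightarrow> 'x \<Rightarrow> 'x) \<Rightarrow>
     (nat ^ 'd, 'h) ell2 bop set" where
  "analytic_crossed_product \<rho> \<phi> = closure (crossed_rep \<rho> \<phi> ` ell1_C0)"

subsection \<open>Existence and uniqueness of the representing operators\<close>

lemma C0_le_sup_norm:
  assumes "f \<in> C0"
  shows "cmod (f x) \<le> sup_norm f"
proof -
  obtain K where K: "compact K" "\<And>x. x \<notin> K \<Longrightarrow> cmod (f x) < 1"
    using assms zero_less_one unfolding C0_def by blast
  have "compact (f ` K)"
    using assms K(1) by (intro compact_continuous_image) (auto simp: C0_def intro: continuous_on_subset)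
  then obtain b where "\<And>y. y \<in> f ` K \<Longrightarrow> cmod y \<le> b"
    using compact_imp_bounded bounded_iff by metis
  then have "cmod (f x) \<le> max b 1" for x
    using K(2)[of x] by (cases "x \<in> K") force+
  then have "bdd_above (range (\<lambda>x. cmod (f x)))" by (auto simp: bdd_above_def)
  then show ?thesis unfolding sup_norm_def by (rule cSUP_upper[OF UNIV_I])
qed

lemma sup_norm_nonneg: "f \<in> C0 \<Longrightarrow> 0 \<le> sup_norm f"
  using C0_le_sup_norm[of f undefined] norm_ge_zero order_trans by blast

lemma C0_dominated:
  assumes "f \<in> C0" "continuous_on UNIV g" "\<And>x. cmod (g x) \<le> c * cmod (f x)"
  shows "g \<in> C0"
  unfolding C0_def
proof (intro CollectI conjI allI impI assms)
  fix e :: real assume "e > 0"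
  define d where "d = e / (\<bar>c\<bar> + 1)"
  have d: "d > 0" using \<open>e > 0\<close> by (simp add: d_def add_nonneg_pos)
  then obtain K where K: "compact K" "\<And>x. x \<notin> K \<Longrightarrow> cmod (f x) < d"
    using assms(1) unfolding C0_def by blast
  have "cmod (g x) < e" if "x \<notin> K" for x
  proof -
    have "cmod (g x) \<le> (\<bar>c\<bar> + 1) * cmod (f x)"
    proof (rule order_trans[OF assms(3) mult_right_mono])
      show "c \<le> \<bar>c\<bar> + 1" by linarith
    qed simp
    also have "\<dots> < (\<bar>c\<bar> + 1) * d"
      using K(2)[OF that] by (intro mult_strict_left_mono) (auto simp: add_nonneg_pos)
    also have "\<dots> = e" by (simp add: d_def add_nonneg_eq_0_iff)
    finally show ?thesis .
  qed
  with K(1) show "\<exists>K. compact K \<and> (\<forall>x. x \<notin> K \<longrightarrow> cmod (g x) < e)" by blast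
qed

lemma C0_comp_proper:
  assumes "f \<in> C0" "continuous_on UNIV h" "proper_map euclidean euclidean h"
  shows "f \<circ> h \<in> C0"
  unfolding C0_def
proof (intro CollectI conjI allI impI)
  show "continuous_on UNIV (f \<circ> h)"
    using assms by (intro continuous_on_compose) (auto simp: C0_def intro: continuous_on_subset)
  fix e :: real assume "e > 0"
  then obtain K where K: "compact K" "\<And>x. x \<notin> K \<Longrightarrow> cmod (f x) < e"
    using assms(1) unfolding C0_def by blast
  have "compact (h -` K)"
    using compactin_proper_map_preimage[OF assms(3), of K] K(1) by (simp add: vimage_def)
  with K(2) show "\<exists>K. compact K \<and> (\<forall>x. x \<notin> K \<longrightarrow> cmod ((f \<circ> h) x) < e)"
    by (intro exI[of _ "h -` K"]) auto
qed

lemma star_rep_contractive: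
  assumes rep: "faithful_star_rep \<rho>" and f: "f \<in> C0"
  shows "norm (\<rho> f \<cdot> u) \<le> sup_norm f * norm u"
proof (cases "sup_norm f = 0")
  case True
  then have "f = (\<lambda>x. 0 * f x)" using C0_le_sup_norm[OF f] by auto
  then have "\<rho> f = 0 *\<^sub>C \<rho> f" using rep f unfolding faithful_star_rep_def by metis
  then have "\<rho> f \<cdot> u = 0" by (metis bop_scaleC_apply cvec.scale_zero_left)
  with True show ?thesis by simp
next
  case False
  define M where "M = sup_norm f"
  have M: "M > 0" using False sup_norm_nonneg[OF f] by (simp add: M_def)
  have add: "\<And>f g. f \<in> C0 \<Longrightarrow> g \<in> C0 \<Longrightarrow> \<rho> (\<lambda>x. f x + g x) = \<rho> f + \<rho> g"
    and scale: "\<And>c f. f \<in> C0 \<Longrightarrow> \<rho> (\<lambda>x. c * f x) = c *\<^sub>C \<rho> f"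
    and mult: "\<And>f g. f \<in> C0 \<Longrightarrow> g \<in> C0 \<Longrightarrow> \<rho> (\<lambda>x. f x * g x) = \<rho> f * \<rho> g"
    and star: "\<And>f u v. f \<in> C0 \<Longrightarrow> cinner (\<rho> f \<cdot> u) v = cinner u (\<rho> (\<lambda>x. cnj (f x)) \<cdot> v)"
    using rep unfolding faithful_star_rep_def by blast+
  define r where "r x = (cmod (f x) / M)\<^sup>2" for x
  have r: "0 \<le> r x" "r x \<le> 1" for x
    using C0_le_sup_norm[OF f, of x] M by (auto simp: r_def M_def power_le_one)
  define k where "k x = complex_of_real (1 - sqrt (1 - r x))" for x
  have cont: "continuous_on UNIV f" using f by (simp add: C0_def)
  have k: "k \<in> C0"
  proof (rule C0_dominated[OF f])
    show "continuous_on UNIV k" unfolding k_def r_def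
      by (intro continuous_intros cont) (use M in auto)
    fix x
    have "1 - r x \<le> sqrt (1 - r x)"
      using r[of x] by (intro real_le_rsqrt) (simp add: power2_eq_square mult_left_le)
    then have "cmod (k x) \<le> r x"
      using r[of x] by (simp add: k_def norm_of_real del: of_real_diff)
    also have "\<dots> \<le> cmod (f x) / M"
    proof -
      have "cmod (f x) / M \<le> 1" using C0_le_sup_norm[OF f, of x] M by (simp add: M_def)
      then show ?thesis
        unfolding r_def power2_eq_square using M by (intro mult_left_le) auto
    qed
    finally show "cmod (k x) \<le> 1 / M * cmod (f x)" by simp
  qed
  have kk: "(\<lambda>x. k x * k x) \<in> C0"
  proof (rule C0_dominated[OF k])
    show "continuous_on UNIV (\<lambda>x. k x * k x)"
      using k by (intro continuous_intros) (auto simp: C0_def)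
    show "cmod (k x * k x) \<le> sup_norm k * cmod (k x)" for x
      by (simp add: norm_mult mult_right_mono C0_le_sup_norm[OF k])
  qed
  have cf: "(\<lambda>x. cnj (f x)) \<in> C0"
    by (rule C0_dominated[OF f, of _ 1]) (auto intro!: continuous_intros cont)
  have ff: "(\<lambda>x. cnj (f x) * f x) = (\<lambda>x. complex_of_real (M\<^sup>2) * (2 * k x + (-1) * (k x * k x)))"
  proof
    fix x
    have "(sqrt (1 - r x))\<^sup>2 = 1 - r x" using r[of x] by simp
    then have "2 * (1 - sqrt (1 - r x)) - (1 - sqrt (1 - r x)) * (1 - sqrt (1 - r x)) = r x"
      by (simp add: algebra_simps power2_eq_square)
    then have "complex_of_real (2 * (1 - sqrt (1 - r x)) - (1 - sqrt (1 - r x)) * (1 - sqrt (1 - r x)))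
        = complex_of_real (r x)"
      by (simp only:)
    then have "2 * k x + (-1) * (k x * k x) = complex_of_real (r x)"
      by (simp add: k_def)
    moreover have "cnj (f x) * f x = complex_of_real (M\<^sup>2 * r x)"
    proof -
      have "M\<^sup>2 * r x = (cmod (f x))\<^sup>2" using M by (simp add: r_def power_divide)
      then show ?thesis by (metis complex_norm_square mult.commute)
    qed
    ultimately show "cnj (f x) * f x = complex_of_real (M\<^sup>2) * (2 * k x + (-1) * (k x * k x))"
      by simp
  qed
  have k2: "(\<lambda>x. 2 * k x) \<in> C0"
    by (rule C0_dominated[OF k, of _ 2]) (use k in \<open>auto intro!: continuous_intros simp: C0_def norm_mult\<close>)
  have kkm: "(\<lambda>x. (-1) * (k x * k x)) \<in> C0"
    by (rule C0_dominated[OF kk, of _ 1]) (use kk in \<open>auto intro!: continuous_intros simp: C0_def norm_mult\<close>)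
  have sm: "(\<lambda>x. 2 * k x + (-1) * (k x * k x)) \<in> C0"
  proof (rule C0_dominated[OF k])
    show "continuous_on UNIV (\<lambda>x. 2 * k x + (-1) * (k x * k x))"
      using k by (intro continuous_intros) (auto simp: C0_def)
    fix x
    have "cmod (2 * k x + (-1) * (k x * k x)) \<le> cmod (2 * k x) + cmod ((-1) * (k x * k x))"
      by (rule norm_triangle_ineq)
    also have "\<dots> \<le> (2 + sup_norm k) * cmod (k x)"
      by (simp add: norm_mult distrib_right mult_right_mono C0_le_sup_norm[OF k])
    finally show "cmod (2 * k x + (-1) * (k x * k x)) \<le> (2 + sup_norm k) * cmod (k x)" .
  qed
  have e: "\<rho> (\<lambda>x. cnj (f x)) * \<rho> f = complex_of_real (M\<^sup>2) *\<^sub>C (2 *\<^sub>C \<rho> k + (-1) *\<^sub>C (\<rho> k * \<rho> k))"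
    unfolding mult[OF cf f, symmetric] ff scale[OF sm] add[OF k2 kkm] scale[OF k] scale[OF kk]
      mult[OF k k] ..
  have "\<rho> (\<lambda>x. cnj (f x)) \<cdot> (\<rho> f \<cdot> u) = (\<rho> (\<lambda>x. cnj (f x)) * \<rho> f) \<cdot> u"
    by (simp only: bop_times_apply)
  also have "\<dots> = complex_of_real (M\<^sup>2) *\<^sub>C (2 *\<^sub>C (\<rho> k \<cdot> u) + (-1) *\<^sub>C (\<rho> k \<cdot> (\<rho> k \<cdot> u)))"
    by (simp only: e bop_plus_apply bop_scaleC_apply bop_times_apply)
  finally have app: "\<rho> (\<lambda>x. cnj (f x)) \<cdot> (\<rho> f \<cdot> u)
      = complex_of_real (M\<^sup>2) *\<^sub>C (2 *\<^sub>C (\<rho> k \<cdot> u) + (-1) *\<^sub>C (\<rho> k \<cdot> (\<rho> k \<cdot> u)))" .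
  have kself: "cinner u (\<rho> k \<cdot> (\<rho> k \<cdot> u)) = cinner (\<rho> k \<cdot> u) (\<rho> k \<cdot> u)"
  proof -
    have "(\<lambda>x. cnj (k x)) = k" by (rule ext) (simp add: k_def)
    then show ?thesis using star[OF k, of u "\<rho> k \<cdot> u"] by simp
  qed
  have "cinner (\<rho> f \<cdot> u) (\<rho> f \<cdot> u) = complex_of_real (M\<^sup>2) *
      (cnj 2 * cinner u (\<rho> k \<cdot> u) + cnj (-1) * cinner (\<rho> k \<cdot> u) (\<rho> k \<cdot> u))"
    by (simp only: star[OF f] app cinner_scaleC_right cinner_add_right kself complex_cnj_complex_of_real)
  then have "Re (cinner (\<rho> f \<cdot> u) (\<rho> f \<cdot> u)) =
      M\<^sup>2 * (2 * Re (cinner u (\<rho> k \<cdot> u)) - Re (cinner (\<rho> k \<cdot> u) (\<rho> k \<cdot> u)))"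
    by (simp del: of_real_power)
  then have "(norm (\<rho> f \<cdot> u))\<^sup>2 = M\<^sup>2 * (2 * inner u (\<rho> k \<cdot> u) - (norm (\<rho> k \<cdot> u))\<^sup>2)"
    by (simp only: power2_norm_eq_inner inner_eq_Re_cinner)
  also have "\<dots> \<le> M\<^sup>2 * (norm u)\<^sup>2"
  proof (rule mult_left_mono)
    have "0 \<le> (norm (u - \<rho> k \<cdot> u))\<^sup>2" by simp
    also have "\<dots> = (norm u)\<^sup>2 - 2 * inner u (\<rho> k \<cdot> u) + (norm (\<rho> k \<cdot> u))\<^sup>2"
      by (simp add: power2_norm_eq_inner inner_diff_left inner_diff_right inner_commute[of "\<rho> k \<cdot> u" u])
    finally show "2 * inner u (\<rho> k \<cdot> u) - (norm (\<rho> k \<cdot> u))\<^sup>2 \<le> (norm u)\<^sup>2" by simp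
  qed simp
  finally have "(norm (\<rho> f \<cdot> u))\<^sup>2 \<le> (M * norm u)\<^sup>2" by (simp add: power_mult_distrib)
  then show ?thesis unfolding M_def[symmetric]
    by (rule power2_le_imp_le) (use M in simp)
qed

lemma ell2_nth_plus: "ell2_nth (x + y) i = ell2_nth x i + ell2_nth y i"
  by (simp add: plus_ell2.rep_eq)

lemma ell2_nth_sum: "ell2_nth (\<Sum>j\<in>S. f j) i = (\<Sum>j\<in>S. ell2_nth (f j) i)"
  by (induction S rule: infinite_finite_induct)
    (simp_all add: ell2_nth_plus zero_ell2.rep_eq)

lemma has_sum_tensor: "((\<lambda>i. ell2_nth x i \<otimes>e i) has_sum x) UNIV"
  unfolding has_sum_def tendsto_iff eventually_finite_subsets_at_top
proof (intro allI impI)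
  fix e :: real assume e: "e > 0"
  have "((\<lambda>i. (norm (ell2_nth x i))\<^sup>2) has_sum (norm x)\<^sup>2) UNIV"
    using has_sum_infsum[OF ell2_nth_summable[of x]] by (simp add: norm_ell2_sq)
  then have "\<forall>\<^sub>F Y in finite_subsets_at_top UNIV.
      dist (\<Sum>i\<in>Y. (norm (ell2_nth x i))\<^sup>2) ((norm x)\<^sup>2) < e\<^sup>2"
    unfolding has_sum_def by (rule tendstoD) (use e in simp)
  then obtain X where X: "finite X"
    "\<And>Y. finite Y \<Longrightarrow> X \<subseteq> Y \<Longrightarrow> dist (\<Sum>i\<in>Y. (norm (ell2_nth x i))\<^sup>2) ((norm x)\<^sup>2) < e\<^sup>2"
    unfolding eventually_finite_subsets_at_top by auto
  have "dist (\<Sum>i\<in>Y. ell2_nth x i \<otimes>e i) x < e" if Y: "finite Y" "X \<subseteq> Y" for Y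
  proof -
    let ?y = "x - (\<Sum>i\<in>Y. ell2_nth x i \<otimes>e i)"
    have y: "ell2_nth ?y i = (if i \<in> Y then 0 else ell2_nth x i)" for i
      using Y(1) by (simp add: minus_ell2.rep_eq ell2_nth_sum tensor.rep_eq if_distrib sum.delta)
    have "(\<lambda>i. (norm (ell2_nth x i))\<^sup>2) summable_on - Y"
      by (rule summable_on_subset_banach[OF ell2_nth_summable]) auto
    then have "(\<Sum>\<^sub>\<infinity>i\<in>Y \<union> - Y. (norm (ell2_nth x i))\<^sup>2)
        = (\<Sum>\<^sub>\<infinity>i\<in>Y. (norm (ell2_nth x i))\<^sup>2) + (\<Sum>\<^sub>\<infinity>i\<in>-Y. (norm (ell2_nth x i))\<^sup>2)"
      using Y(1) by (intro infsum_Un_disjoint) auto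
    then have "(norm x)\<^sup>2 = (\<Sum>i\<in>Y. (norm (ell2_nth x i))\<^sup>2) + (\<Sum>\<^sub>\<infinity>i\<in>-Y. (norm (ell2_nth x i))\<^sup>2)"
      using Y(1) by (simp add: norm_ell2_sq)
    also have "(\<Sum>\<^sub>\<infinity>i\<in>-Y. (norm (ell2_nth x i))\<^sup>2) = (norm ?y)\<^sup>2"
      unfolding norm_ell2_sq y by (rule infsum_cong_neutral) auto
    finally have "(norm ?y)\<^sup>2 < e\<^sup>2"
      using X(2)[OF Y] by (simp add: dist_real_def)
    then have "norm ?y < e" using e by (simp add: power_less_imp_less_base)
    then show ?thesis by (simp add: dist_norm norm_minus_commute)
  qed
  with X(1) show "\<exists>X. finite X \<and> X \<subseteq> UNIV \<and> (\<forall>Y. finite Y \<and> X \<subseteq> Y \<and> Y \<subseteq> UNIV \<longrightarrow>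
      dist (\<Sum>i\<in>Y. ell2_nth x i \<otimes>e i) x < e)"
    by blast
qed

lemma bop_eq_tensorI:
  fixes S T :: "('i, 'h::complex_inner) ell2 bop"
  assumes "\<And>\<xi> k. S \<cdot> (\<xi> \<otimes>e k) = T \<cdot> (\<xi> \<otimes>e k)"
  shows "S = T"
proof (rule bop_eqI)
  fix x
  have bl: "bounded_linear (\<lambda>x. R \<cdot> x)" for R :: "('i, 'h) ell2 bop"
    by (simp add: bop_apply.rep_eq blinfun.bounded_linear_right)
  have "((\<lambda>i. S \<cdot> (ell2_nth x i \<otimes>e i)) has_sum S \<cdot> x) UNIV"
    using has_sum_bounded_linear[OF bl has_sum_tensor] by (simp add: o_def)
  moreover have "((\<lambda>i. T \<cdot> (ell2_nth x i \<otimes>e i)) has_sum T \<cdot> x) UNIV"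
    using has_sum_bounded_linear[OF bl has_sum_tensor] by (simp add: o_def)
  ultimately show "S \<cdot> x = T \<cdot> x"
    unfolding assms by (rule has_sum_unique)
qed

lemma crossed_monomial_exists:
  fixes \<phi> :: "nat ^ 'd \<Rightarrow> 'x::topological_space \<Rightarrow> 'x"
    and \<rho> :: "('x \<Rightarrow> complex) \<Rightarrow> 'h::complex_hilbert bop"
  assumes dyn: "dynamical_system \<phi>" and rep: "faithful_star_rep \<rho>" and f: "f \<in> C0"
  shows "\<exists>T. norm T \<le> sup_norm f \<and> (\<forall>\<xi> k. T \<cdot> (\<xi> \<otimes>e k) = (\<rho> (f \<circ> \<phi> k) \<cdot> \<xi>) \<otimes>e (k + n))"
proof -
  let ?c = "sup_norm f"
  have c0: "0 \<le> ?c" by (rule sup_norm_nonneg[OF f])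
  have fC: "f \<circ> \<phi> k \<in> C0" for k
    using dyn by (intro C0_comp_proper f) (auto simp: dynamical_system_def)
  have "sup_norm (f \<circ> \<phi> k) \<le> ?c" for k
    unfolding sup_norm_def[of "f \<circ> \<phi> k"]
    by (rule cSUP_least) (auto intro: C0_le_sup_norm[OF f])
  then have bound: "norm (\<rho> (f \<circ> \<phi> k) \<cdot> u) \<le> ?c * norm u" for k u
    using star_rep_contractive[OF rep fC, of k u] by (meson mult_right_mono norm_ge_zero order_trans)
  define h where "h x m = (if m \<in> range (\<lambda>k. k + n)
      then \<rho> (f \<circ> \<phi> (m - n)) \<cdot> ell2_nth x (m - n) else 0)" for x :: "(nat ^ 'd, 'h) ell2" and m
  have sub: "k + n - n = k" for k :: "nat ^ 'd"
    by (simp add: vec_eq_iff)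
  have "(\<Sum>m\<in>S. (norm (h x m))\<^sup>2) \<le> (norm x * ?c)\<^sup>2" if S: "finite S" for S x
  proof -
    let ?S = "S \<inter> range (\<lambda>k. k + n)"
    have inj: "inj_on (\<lambda>m. m - n) ?S"
      by (auto simp: inj_on_def sub)
    have "(\<Sum>m\<in>S. (norm (h x m))\<^sup>2) = (\<Sum>m\<in>?S. (norm (h x m))\<^sup>2)"
      using S by (intro sum.mono_neutral_right) (auto simp: h_def)
    also have "\<dots> \<le> (\<Sum>m\<in>?S. ?c\<^sup>2 * (norm (ell2_nth x (m - n)))\<^sup>2)"
    proof (rule sum_mono)
      fix m assume "m \<in> ?S"
      then have "norm (h x m) \<le> ?c * norm (ell2_nth x (m - n))"
        using bound by (auto simp: h_def)
      then show "(norm (h x m))\<^sup>2 \<le> ?c\<^sup>2 * (norm (ell2_nth x (m - n)))\<^sup>2"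
        by (metis norm_ge_zero power_mono power_mult_distrib)
    qed
    also have "\<dots> = ?c\<^sup>2 * (\<Sum>i\<in>(\<lambda>m. m - n) ` ?S. (norm (ell2_nth x i))\<^sup>2)"
      by (simp add: sum.reindex[OF inj] sum_distrib_left)
    also have "\<dots> \<le> ?c\<^sup>2 * (norm x)\<^sup>2"
      using S by (intro mult_left_mono sum_norm_sq_le_ell2) auto
    finally show ?thesis by (simp add: power_mult_distrib mult.commute)
  qed
  then have sm: "(\<lambda>m. (norm (h x m))\<^sup>2) summable_on UNIV"
    and nb: "norm (Abs_ell2 (h x)) \<le> norm x * ?c" for x
    using bounded_sums_ell2[of "h x" "norm x * ?c"] c0 by simp_all
  have nth: "ell2_nth (Abs_ell2 (h x)) m = h x m" for x m
    using sm by (simp add: Abs_ell2_inverse)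
  have "\<exists>T. \<forall>x. T \<cdot> x = Abs_ell2 (h x)"
  proof (rule bop_exI)
    show "Abs_ell2 (h (x + y)) = Abs_ell2 (h x) + Abs_ell2 (h y)" for x y
      by (subst ell2_nth_inject[symmetric], rule ext)
        (simp only: ell2_nth_plus nth, simp add: h_def ell2_nth_plus bop_apply_add)
    show "Abs_ell2 (h (c *\<^sub>C x)) = c *\<^sub>C Abs_ell2 (h x)" for c x
      by (subst ell2_nth_inject[symmetric], rule ext)
        (simp only: scaleC_ell2.rep_eq nth, simp add: h_def scaleC_ell2.rep_eq bop_apply_scaleC)
    show "norm (Abs_ell2 (h x)) \<le> norm x * ?c" for x by (rule nb)
  qed
  then obtain T where T: "\<And>x. T \<cdot> x = Abs_ell2 (h x)" by blast
  have "norm T \<le> ?c"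
    by (rule norm_bop_le[OF c0]) (use nb in \<open>simp add: T mult.commute[of "sup_norm f"]\<close>)
  moreover have "T \<cdot> (\<xi> \<otimes>e k) = (\<rho> (f \<circ> \<phi> k) \<cdot> \<xi>) \<otimes>e (k + n)" for \<xi> k
  proof (subst ell2_nth_inject[symmetric], rule ext)
    have z: "R \<cdot> 0 = 0" for R :: "'h bop" by (simp add: bop_apply.rep_eq)
    show "ell2_nth (T \<cdot> (\<xi> \<otimes>e k)) m = ell2_nth ((\<rho> (f \<circ> \<phi> k) \<cdot> \<xi>) \<otimes>e (k + n)) m" for m
      by (auto simp: T nth h_def tensor.rep_eq sub z)
  qed
  ultimately show ?thesis by blast
qed

lemma crossed_rep_unique_exists:
  fixes \<phi> :: "nat ^ 'd \<Rightarrow> 'x::topological_space \<Rightarrow> 'x"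
    and \<rho> :: "('x \<Rightarrow> complex) \<Rightarrow> 'h::complex_hilbert bop"
  assumes dyn: "dynamical_system \<phi>" and rep: "faithful_star_rep \<rho>" and F: "F \<in> ell1_C0"
  shows "\<exists>!T. \<forall>\<xi> k. ((\<lambda>n. (\<rho> (F n \<circ> \<phi> k) \<cdot> \<xi>) \<otimes>e (k + n)) has_sum T \<cdot> (\<xi> \<otimes>e k)) UNIV"
proof (rule ex_ex1I)
  have FC: "F n \<in> C0" for n using F by (simp add: ell1_C0_def)
  have "\<forall>n. \<exists>T. norm T \<le> sup_norm (F n) \<and>
      (\<forall>\<xi> k. T \<cdot> (\<xi> \<otimes>e k) = (\<rho> (F n \<circ> \<phi> k) \<cdot> \<xi>) \<otimes>e (k + n))"
    by (intro allI crossed_monomial_exists[OF dyn rep FC])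
  from choice[OF this] obtain T where T: "\<And>n. norm (T n) \<le> sup_norm (F n)"
    "\<And>n \<xi> k. T n \<cdot> (\<xi> \<otimes>e k) = (\<rho> (F n \<circ> \<phi> k) \<cdot> \<xi>) \<otimes>e (k + n)"
    by blast
  have "(\<lambda>n. sup_norm (F n)) summable_on UNIV" using F by (simp add: ell1_C0_def)
  then have "(\<lambda>n. norm (T n)) summable_on UNIV"
    by (rule summable_on_comparison_test) (use T(1) in auto)
  then have "(T has_sum infsum T UNIV) UNIV"
    by (rule has_sum_infsum[OF abs_summable_summable])
  from has_sum_bounded_linear[OF bounded_linear_bop_apply this]
  have "((\<lambda>n. T n \<cdot> x) has_sum infsum T UNIV \<cdot> x) UNIV" for x
    by (simp add: o_def)
  then show "\<exists>T. \<forall>\<xi> k. ((\<lambda>n. (\<rho> (F n \<circ> \<phi> k) \<cdot> \<xi>) \<otimes>e (k + n)) has_sum T \<cdot> (\<xi> \<otimes>e k)) UNIV"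
    by (intro exI[of _ "infsum T UNIV"] allI) (simp only: T(2)[symmetric])
next
  show "S = T" if "\<forall>\<xi> k. ((\<lambda>n. (\<rho> (F n \<circ> \<phi> k) \<cdot> \<xi>) \<otimes>e (k + n)) has_sum S \<cdot> (\<xi> \<otimes>e k)) UNIV"
    "\<forall>\<xi> k. ((\<lambda>n. (\<rho> (F n \<circ> \<phi> k) \<cdot> \<xi>) \<otimes>e (k + n)) has_sum T \<cdot> (\<xi> \<otimes>e k)) UNIV" for S T
    by (rule bop_eq_tensorI, rule has_sum_unique) (rule that[rule_format])+
qed

end

theory Submission
  imports Defs
begin

text \<open>
  Density of the strongly recurrent points implies semisimplicity: every element of the Jacobson
  radical lies in the ideal of all \<open>T\<close> such that each \<open>a T\<close> is left quasi-regular. This ideal is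
  closed and invariant under the gauge action, so averaging over roots of unity shows that it
  contains the monomials \<open>U\<^bsub>n\<^esub> f\<close> of its elements, and one may take \<open>f \<ge> 0\<close>. If \<open>f \<noteq> 0\<close>, recurrence
  yields a series \<open>a\<close> of monomials with non-negative coefficients such that the coefficients
  of the formal geometric series of \<open>c = a U\<^bsub>n\<^esub> f\<close> are unbounded. A quasi-inverse of \<open>c\<close> would
  have these coefficients, which its norm bounds. Positivity thus replaces the spectral radius formula.

  Semisimple algebras are semiprime because primitive ideals are prime. If the strongly recurrent
  points are not dense, the Baire category theorem gives a ball \<open>B\<close> and an \<open>N\<close> such that no point
  of \<open>B\<close> is mapped into \<open>B\<close> by \<open>\<phi>\<^bsub>n\<^esub>\<close> for \<open>n \<ge> N\<close>; for \<open>f\<close> supported in \<open>B\<close> the monomial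
  \<open>t = U\<^bsub>N\<^esub> f\<close> satisfies \<open>t A t = 0\<close> and generates a nilpotent ideal.
\<close>

section \<open>Quasi-regularity and the Jacobson radical\<close>

text \<open>An element of the crossed product is only a norm limit of finite sums of monomials; the
  series of its Fourier terms need not converge. Coefficients are therefore read off from matrix
  entries of the operator, and to see that these entries still come from functions in
  \<open>C0\<close> after a limit one needs that \<open>\<rho>\<close> is isometric. The same fact
  bounds every coefficient by the norm of the operator, which is what makes unbounded coefficients
  contradictory.

  The finite averages over roots of unity do the work of an integral over the torus without
  vector-valued integration. They are bounded by the norm and exact on a given monomial once their
  order exceeds the entries of the indices involved.

  The series \<open>a\<close> must converge although products of many of its terms must not decay.
  The nested words resolve this: the letter \<open>q j\<close> occurs \<open>2 ^ (k - 1 - j)\<close>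
  times in the word number \<open>k\<close>, so the late letters, which carry the small weights, are
  rare. If each occurrence of \<open>q j\<close> contributes the factor \<open>2 / 2 ^ j\<close>,
  the whole word contributes exactly \<open>2 ^ k\<close>.\<close>

definition complex_subalgebra :: "'a::complex_algebra set \<Rightarrow> bool" where
  "complex_subalgebra A \<longleftrightarrow> complex_subspace A \<and> (\<forall>a\<in>A. \<forall>b\<in>A. a * b \<in> A)"

lemma complex_subspace_iff_subspace: "complex_subspace S \<longleftrightarrow> cvec.subspace S"
  by (auto simp: complex_subspace_def cvec.subspace_def)

lemma complex_subalgebraD:
  assumes "complex_subalgebra A"
  shows "complex_subspace A" "0 \<in> A"
    and "\<And>x y. x \<in> A \<Longrightarrow> y \<in> A \<Longrightarrow> x + y \<in> A"
    and "\<And>x y. x \<in> A \<Longrightarrow> y \<in> A \<Longrightarrow> x - y \<in> A"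
    and "\<And>x. x \<in> A \<Longrightarrow> - x \<in> A"
    and "\<And>c x. x \<in> A \<Longrightarrow> c *\<^sub>C x \<in> A"
    and "\<And>x y. x \<in> A \<Longrightarrow> y \<in> A \<Longrightarrow> x * y \<in> A"
proof -
  show s: "complex_subspace A"
    using assms by (simp add: complex_subalgebra_def)
  then show "0 \<in> A"
    and "\<And>x y. x \<in> A \<Longrightarrow> y \<in> A \<Longrightarrow> x + y \<in> A"
    and "\<And>c x. x \<in> A \<Longrightarrow> c *\<^sub>C x \<in> A"
    by (auto simp: complex_subspace_def)
  show "\<And>x y. x \<in> A \<Longrightarrow> y \<in> A \<Longrightarrow> x - y \<in> A"
    using s cvec.subspace_diff by (auto simp: complex_subspace_iff_subspace)
  show "\<And>x. x \<in> A \<Longrightarrow> - x \<in> A"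
    using s cvec.subspace_neg by (auto simp: complex_subspace_iff_subspace)
  show "\<And>x y. x \<in> A \<Longrightarrow> y \<in> A \<Longrightarrow> x * y \<in> A"
    using assms by (simp add: complex_subalgebra_def)
qed

text \<open>In the unitization the equation reads \<open>(1 - b) (1 - x) = 1\<close>.\<close>

definition left_quasi_regular :: "'a::complex_algebra set \<Rightarrow> 'a \<Rightarrow> bool" where
  "left_quasi_regular A x \<longleftrightarrow> (\<exists>b\<in>A. b + x - b * x = 0)"

text \<open>The classical description of the Jacobson radical by quasi-regularity. As
  \<open>A\<close> may lack a unit, the condition concerns the multiples \<open>a * x\<close> rather
  than \<open>x\<close> itself.\<close>

definition quasi_regular_ideal :: "'a::complex_algebra set \<Rightarrow> 'a set" where
  "quasi_regular_ideal A = {x \<in> A. \<forall>a\<in>A. left_quasi_regular A (a * x)}"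

text \<open>In the unitization, \<open>(1 - b) (1 - x) = 1\<close> gives
  \<open>(1 - b) (1 - x - y) = 1 - (y - b y)\<close>. If \<open>1 - e\<close> is a left inverse of
  the right-hand side, then \<open>(1 - e) (1 - b)\<close> is one of \<open>1 - x - y\<close>; this
  is the element \<open>e + b - e b\<close>.\<close>

lemma left_quasi_regular_add:
  assumes A: "complex_subalgebra A" and b: "b \<in> A" "b + x - b * x = 0"
    and y: "left_quasi_regular A (y - b * y)"
  shows "left_quasi_regular A (x + y)"
proof -
  note AD = complex_subalgebraD[OF A]
  obtain e where e: "e \<in> A" "e + (y - b * y) - e * (y - b * y) = 0"
    using y by (auto simp: left_quasi_regular_def)
  have "(e + b - e * b) + (x + y) - (e + b - e * b) * (x + y)
      = (e + (y - b * y) - e * (y - b * y)) + (b + x - b * x) - e * (b + x - b * x)"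
    by (simp add: algebra_simps)
  also have "\<dots> = 0" unfolding e(2) b(2) by simp
  finally show ?thesis
    unfolding left_quasi_regular_def using AD(4)[OF AD(3)[OF e(1) b(1)] AD(7)[OF e(1) b(1)]] by blast
qed

lemma quasi_regular_ideal_add:
  assumes A: "complex_subalgebra A"
    and x: "x \<in> quasi_regular_ideal A" and y: "y \<in> quasi_regular_ideal A"
  shows "x + y \<in> quasi_regular_ideal A"
proof -
  note AD = complex_subalgebraD[OF A]
  have xy: "x \<in> A" "y \<in> A" using x y by (auto simp: quasi_regular_ideal_def)
  have "left_quasi_regular A (a * (x + y))" if a: "a \<in> A" for a
  proof -
    obtain b where b: "b \<in> A" "b + a * x - b * (a * x) = 0"
      using x a by (auto simp: quasi_regular_ideal_def left_quasi_regular_def)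
    \<comment> \<open>The correction by \<open>b\<close> only changes the multiplier of
      \<open>y\<close> from \<open>a\<close> to \<open>a - b * a\<close>, so having the condition
      for all multipliers makes the set additive.\<close>
    have "left_quasi_regular A ((a - b * a) * y)"
      using y a b AD by (auto simp: quasi_regular_ideal_def)
    then have "left_quasi_regular A (a * y - b * (a * y))"
      by (simp add: algebra_simps)
    then show ?thesis
      using left_quasi_regular_add[OF A b] by (simp add: distrib_left)
  qed
  then show ?thesis using xy AD by (simp add: quasi_regular_ideal_def)
qed

lemma quasi_regular_ideal_scaleC:
  assumes A: "complex_subalgebra A" and x: "x \<in> quasi_regular_ideal A"
  shows "c *\<^sub>C x \<in> quasi_regular_ideal A"
proof -
  note AD = complex_subalgebraD[OF A]
  have "left_quasi_regular A (a * (c *\<^sub>C x))" if a: "a \<in> A" for a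
  proof -
    have "left_quasi_regular A ((c *\<^sub>C a) * x)"
      using x a AD by (auto simp: quasi_regular_ideal_def)
    then show ?thesis by (simp add: mult_scaleC_left mult_scaleC_right)
  qed
  then show ?thesis using x AD by (auto simp: quasi_regular_ideal_def)
qed

lemma quasi_regular_ideal_sum:
  assumes A: "complex_subalgebra A" and x: "\<And>i. i \<in> S \<Longrightarrow> f i \<in> quasi_regular_ideal A"
  shows "(\<Sum>i\<in>S. f i) \<in> quasi_regular_ideal A"
proof -
  have "0 \<in> quasi_regular_ideal A"
    using complex_subalgebraD(2)[OF A]
    by (auto simp: quasi_regular_ideal_def left_quasi_regular_def)
  with x show ?thesis
    by (induction S rule: infinite_finite_induct) (auto intro: quasi_regular_ideal_add[OF A])
qed

text \<open>The usual passage from \<open>1 - u v\<close> to \<open>1 - v u\<close>: with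
  \<open>y = a * x\<close>, if \<open>1 - b\<close> is a left inverse of \<open>1 - c y\<close>,
  then \<open>1 + y (1 - b) c\<close> is a left inverse of \<open>1 - y c\<close>.\<close>

lemma quasi_regular_ideal_mult_right:
  assumes A: "complex_subalgebra A" and x: "x \<in> quasi_regular_ideal A" and c: "c \<in> A"
  shows "x * c \<in> quasi_regular_ideal A"
proof -
  note AD = complex_subalgebraD[OF A]
  have xA: "x \<in> A" using x by (auto simp: quasi_regular_ideal_def)
  have "left_quasi_regular A (a * (x * c))" if a: "a \<in> A" for a
  proof -
    obtain b where b: "b \<in> A" "b + (c * a) * x - b * ((c * a) * x) = 0"
      using x AD(7)[OF c a] unfolding quasi_regular_ideal_def left_quasi_regular_def by blast
    let ?y = "a * x" and ?b = "- (a * x * c - a * x * b * c)"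
    have "?b + ?y * c - ?b * (?y * c) = ?y * (b + (c * a) * x - b * ((c * a) * x)) * c"
      by (simp add: algebra_simps)
    also have "\<dots> = 0" by (simp add: b)
    finally have "?b + a * (x * c) - ?b * (a * (x * c)) = 0"
      by (simp add: mult.assoc)
    moreover have "?b \<in> A" using a b xA c by (intro AD(4,5,7))
    ultimately show ?thesis unfolding left_quasi_regular_def by blast
  qed
  then show ?thesis using xA c AD by (simp add: quasi_regular_ideal_def)
qed

text \<open>The equation for \<open>b\<close> is the fixed point equation
  \<open>b = b * x - x\<close>, whose right-hand side contracts by the factor \<open>norm x\<close>
  and maps the complete set \<open>A\<close> to itself.\<close>

lemma left_quasi_regular_if_norm_less_1:
  fixes A :: "'a::{complex_algebra, real_normed_algebra, banach} set"
  assumes A: "complex_subalgebra A" and cl: "closed A" and x: "x \<in> A" "norm x < 1"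
  shows "left_quasi_regular A x"
proof -
  note AD = complex_subalgebraD[OF A]
  have "\<exists>!b\<in>A. b * x - x = b"
  proof (rule Banach_fix)
    show "complete A" using cl by (simp add: complete_eq_closed)
    show "A \<noteq> {}" using x by auto
    show "(\<lambda>b. b * x - x) ` A \<subseteq> A" using x AD by auto
    show "dist (b * x - x) (c * x - x) \<le> norm x * dist b c" for b c
      using norm_mult_ineq[of "b - c" x] by (simp add: dist_norm algebra_simps)
  qed (use x in auto)
  then obtain b where "b \<in> A" "b * x - x = b" by blast
  then show ?thesis unfolding left_quasi_regular_def by (intro bexI[of _ b]) (simp_all add: algebra_simps)
qed

text \<open>Write \<open>a * x = a * (x - X n) + a * X n\<close>. For large \<open>n\<close> the
  first summand has norm below 1, hence is quasi-regular, and the second is absorbed by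
  \<open>left_quasi_regular_add\<close> because \<open>X n\<close> lies in the ideal.\<close>

lemma closed_quasi_regular_ideal:
  fixes A :: "'a::{complex_algebra, real_normed_algebra, banach} set"
  assumes A: "complex_subalgebra A" and cl: "closed A"
  shows "closed (quasi_regular_ideal A)"
  unfolding closed_sequential_limits
proof (intro allI impI, elim conjE)
  fix X x assume X: "\<forall>n. X n \<in> quasi_regular_ideal A" "X \<longlonglongrightarrow> x"
  note AD = complex_subalgebraD[OF A]
  have XA: "X n \<in> A" for n using X by (auto simp: quasi_regular_ideal_def)
  then have xA: "x \<in> A" using cl X(2) by (auto simp: closed_sequential_limits)
  have "left_quasi_regular A (a * x)" if a: "a \<in> A" for a
  proof -
    have "(\<lambda>n. norm (a * (x - X n))) \<longlonglongrightarrow> norm (a * (x - x))"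
      by (intro tendsto_intros X)
    then have "\<forall>\<^sub>F n in sequentially. norm (a * (x - X n)) < 1"
      by (rule order_tendstoD) simp
    then obtain n where n: "norm (a * (x - X n)) < 1"
      by (auto simp: eventually_sequentially)
    have "left_quasi_regular A (a * (x - X n))"
      by (rule left_quasi_regular_if_norm_less_1[OF A cl _ n]) (use a xA XA AD in auto)
    then obtain b where b: "b \<in> A" "b + a * (x - X n) - b * (a * (x - X n)) = 0"
      by (auto simp: left_quasi_regular_def)
    have "left_quasi_regular A ((a - b * a) * X n)"
      using X a b AD by (auto simp: quasi_regular_ideal_def)
    then have "left_quasi_regular A (a * X n - b * (a * X n))"
      by (simp add: algebra_simps)
    from left_quasi_regular_add[OF A b this] show ?thesis by (simp add: algebra_simps)
  qed
  with xA show "x \<in> quasi_regular_ideal A" by (simp add: quasi_regular_ideal_def)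
qed

section \<open>Representation kernels and prime ideals\<close>

lemma representation_kernel_ideal:
  assumes A: "complex_subalgebra A" and rep: "algebra_representation A V \<pi>"
  shows "two_sided_ideal A (representation_kernel A V \<pi>)"
proof -
  note AD = complex_subalgebraD[OF A]
  have V: "0 \<in> V" using rep by (auto simp: algebra_representation_def complex_subspace_def)
  have inV: "\<And>a v. a \<in> A \<Longrightarrow> v \<in> V \<Longrightarrow> \<pi> a v \<in> V"
    and scv: "\<And>a c v. a \<in> A \<Longrightarrow> v \<in> V \<Longrightarrow> \<pi> a (c *\<^sub>C v) = c *\<^sub>C \<pi> a v"
    and adda: "\<And>a b v. a \<in> A \<Longrightarrow> b \<in> A \<Longrightarrow> v \<in> V \<Longrightarrow> \<pi> (a + b) v = \<pi> a v + \<pi> b v"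
    and sca: "\<And>a c v. a \<in> A \<Longrightarrow> v \<in> V \<Longrightarrow> \<pi> (c *\<^sub>C a) v = c *\<^sub>C \<pi> a v"
    and mul: "\<And>a b v. a \<in> A \<Longrightarrow> b \<in> A \<Longrightarrow> v \<in> V \<Longrightarrow> \<pi> (a * b) v = \<pi> a (\<pi> b v)"
    using rep unfolding algebra_representation_def by blast+
  have z: "\<pi> a 0 = 0" if "a \<in> A" for a
    using scv[OF that V, of 0] by simp
  have z': "\<pi> 0 v = 0" if "v \<in> V" for v
    using sca[OF AD(2) that, of 0] by simp
  show ?thesis
    unfolding two_sided_ideal_def complex_subspace_def representation_kernel_def
    using AD by (auto simp: z z' adda sca mul inV)
qed

text \<open>If \<open>J\<close> does not annihilate \<open>v\<close>, then \<open>J v\<close> is a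
  nonzero submodule, hence all of \<open>V\<close>; so \<open>I\<close> annihilates
  \<open>V = J v\<close> as soon as \<open>I J\<close> annihilates \<open>v\<close>.\<close>

lemma primitive_ideal_imp_prime_ideal:
  fixes A :: "'a::complex_algebra set"
  assumes A: "complex_subalgebra A" and P: "primitive_ideal A P"
  shows "prime_ideal A P"
proof -
  note AD = complex_subalgebraD[OF A]
  obtain V :: "'a set" and \<pi> where irr: "irreducible_representation A V \<pi>"
    and P: "P = representation_kernel A V \<pi>"
    using P unfolding primitive_ideal_def by blast
  have rep: "algebra_representation A V \<pi>"
    and min: "\<And>W. W \<subseteq> V \<Longrightarrow> complex_subspace W \<Longrightarrow> (\<And>a w. a \<in> A \<Longrightarrow> w \<in> W \<Longrightarrow> \<pi> a w \<in> W)
        \<Longrightarrow> W = {0} \<or> W = V"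
    using irr unfolding irreducible_representation_def by blast+
  have V: "complex_subspace V" and inV: "\<And>a v. a \<in> A \<Longrightarrow> v \<in> V \<Longrightarrow> \<pi> a v \<in> V"
    and adda: "\<And>a b v. a \<in> A \<Longrightarrow> b \<in> A \<Longrightarrow> v \<in> V \<Longrightarrow> \<pi> (a + b) v = \<pi> a v + \<pi> b v"
    and sca: "\<And>a c v. a \<in> A \<Longrightarrow> v \<in> V \<Longrightarrow> \<pi> (c *\<^sub>C a) v = c *\<^sub>C \<pi> a v"
    and mul: "\<And>a b v. a \<in> A \<Longrightarrow> b \<in> A \<Longrightarrow> v \<in> V \<Longrightarrow> \<pi> (a * b) v = \<pi> a (\<pi> b v)"
    using rep unfolding algebra_representation_def by blast+
  have "I \<subseteq> P" if I: "two_sided_ideal A I" and J: "two_sided_ideal A J"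
    and IJ: "ideal_product I J \<subseteq> P" and nJ: "\<not> J \<subseteq> P" for I J
  proof -
    have JA: "J \<subseteq> A" "complex_subspace J" "\<And>a j. a \<in> A \<Longrightarrow> j \<in> J \<Longrightarrow> a * j \<in> J"
      and IA: "I \<subseteq> A"
      using I J unfolding two_sided_ideal_def by blast+
    obtain j v where j: "j \<in> J" "v \<in> V" "\<pi> j v \<noteq> 0"
      using nJ JA(1) unfolding P representation_kernel_def by blast
    let ?W = "(\<lambda>j. \<pi> j v) ` J"
    have J0: "0 \<in> J" "\<And>x y. x \<in> J \<Longrightarrow> y \<in> J \<Longrightarrow> x + y \<in> J" "\<And>c x. x \<in> J \<Longrightarrow> c *\<^sub>C x \<in> J"
      using JA(2) by (auto simp: complex_subspace_def)
    have "\<pi> 0 v = 0" using sca[OF AD(2) j(2), of 0] by simp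
    then have "complex_subspace ?W"
      unfolding complex_subspace_def using J0 JA(1) j(2)
      by (force simp: adda[symmetric] sca[symmetric] subset_iff)
    moreover have "\<pi> a w \<in> ?W" if "a \<in> A" "w \<in> ?W" for a w
      using that JA j(2) mul by (force simp: mul[symmetric])
    moreover have "?W \<subseteq> V" using inV JA(1) j(2) by auto
    ultimately have "?W = {0} \<or> ?W = V" by (intro min) auto
    then have W: "?W = V" using j by auto
    show "I \<subseteq> P"
    proof
      fix x assume x: "x \<in> I"
      have "\<pi> x w = 0" if w: "w \<in> V" for w
      proof -
        obtain k where k: "k \<in> J" "w = \<pi> k v" using W w by blast
        have "x * k = (\<Sum>i<1::nat. (\<lambda>_. x) i * (\<lambda>_. k) i)" by simp
        then have "x * k \<in> ideal_product I J"
          unfolding ideal_product_def using x k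
          by (intro CollectI exI[of _ "1::nat"] exI[of _ "\<lambda>_. x"] exI[of _ "\<lambda>_. k"]) simp
        then have "\<pi> (x * k) v = 0" using IJ j(2) by (auto simp: P representation_kernel_def)
        then show ?thesis using k x IA JA(1) j(2) mul by (metis subsetD)
      qed
      then show "x \<in> P" using x IA by (auto simp: P representation_kernel_def)
    qed
  qed
  then show ?thesis
    unfolding prime_ideal_def using representation_kernel_ideal[OF A rep] P by blast
qed

corollary prime_radical_subset_jacobson_radical:
  assumes "complex_subalgebra A"
  shows "prime_radical A \<subseteq> jacobson_radical A"
  using primitive_ideal_imp_prime_ideal[OF assms]
  unfolding prime_radical_def jacobson_radical_def by blast

section \<open>Maximal left ideals and the inclusion of the Jacobson radical\<close>

definition left_ideal :: "'a::complex_algebra set \<Rightarrow> 'a set \<Rightarrow> bool" where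
  "left_ideal A J \<longleftrightarrow> J \<subseteq> A \<and> complex_subspace J \<and> (\<forall>a\<in>A. \<forall>j\<in>J. a * j \<in> J)"

text \<open>Without a unit, a union of a chain of proper left ideals could be all of
  \<open>A\<close>. Avoiding one fixed element does pass to unions, so Zorn's lemma is applied to
  that condition.\<close>

lemma exists_maximal_left_ideal_avoiding:
  fixes A :: "'a::complex_algebra set"
  assumes L: "left_ideal A L" "c \<notin> L"
  obtains M where "left_ideal A M" "L \<subseteq> M" "c \<notin> M"
    "\<And>N. left_ideal A N \<Longrightarrow> M \<subseteq> N \<Longrightarrow> c \<notin> N \<Longrightarrow> N = M"
proof -
  let ?F = "{M. left_ideal A M \<and> L \<subseteq> M \<and> c \<notin> M}"
  have "\<exists>M\<in>?F. \<forall>X\<in>?F. M \<subseteq> X \<longrightarrow> X = M"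
  proof (rule subset_Zorn)
    fix C assume C: "subset.chain ?F C"
    show "\<exists>U\<in>?F. \<forall>X\<in>C. X \<subseteq> U"
    proof (cases "C = {}")
      case True
      then show ?thesis using L by blast
    next
      case False
      have F: "\<And>M. M \<in> C \<Longrightarrow> left_ideal A M \<and> L \<subseteq> M \<and> c \<notin> M"
        and lin: "\<And>M N. M \<in> C \<Longrightarrow> N \<in> C \<Longrightarrow> M \<subseteq> N \<or> N \<subseteq> M"
        using C by (auto simp: subset_chain_def)
      have "complex_subspace (\<Union>C)"
        unfolding complex_subspace_def
      proof (intro conjI ballI allI)
        show "0 \<in> \<Union>C" using False F by (auto simp: left_ideal_def complex_subspace_def)
        show "x + y \<in> \<Union>C" if xy: "x \<in> \<Union>C" "y \<in> \<Union>C" for x y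
        proof -
          obtain M N where "x \<in> M" "y \<in> N" "M \<in> C" "N \<in> C" using xy by blast
          then obtain K where "K \<in> C" "x \<in> K" "y \<in> K" using lin by blast
          then have "x + y \<in> K" using F[of K] by (simp add: left_ideal_def complex_subspace_def)
          then show ?thesis using \<open>K \<in> C\<close> by blast
        qed
        show "a *\<^sub>C x \<in> \<Union>C" if "x \<in> \<Union>C" for a x
          using that F unfolding left_ideal_def complex_subspace_def by (meson UnionE UnionI)
      qed
      then have "left_ideal A (\<Union>C)"
        unfolding left_ideal_def using F by (fastforce simp: left_ideal_def)
      moreover have "L \<subseteq> \<Union>C" using False F by blast
      moreover have "c \<notin> \<Union>C" using F by blast
      ultimately show ?thesis by blast
    qed
  qed
  then obtain M where M: "M \<in> ?F" "\<forall>X\<in>?F. M \<subseteq> X \<longrightarrow> X = M" by (rule bexE)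
  show ?thesis
  proof (rule that[of M])
    show "N = M" if "left_ideal A N" "M \<subseteq> N" "c \<notin> N" for N
      using M(1) that by (intro M(2)[rule_format]) blast+
  qed (use M(1) in blast)+
qed

text \<open>\<open>primitive_ideal\<close> asks for a module inside the ambient algebra, so the
  quotient of \<open>A\<close> by \<open>M\<close> is replaced by a complement \<open>V\<close>,
  with \<open>p\<close> as quotient map. A basis of \<open>M\<close> is extended to one of
  \<open>A\<close>; \<open>p\<close> kills the former and fixes the added vectors.\<close>

lemma subspace_complement_projection:
  fixes M A :: "'a::complex_vector set"
  assumes "complex_subspace M" "complex_subspace A" "M \<subseteq> A"
  obtains V p where "complex_subspace V" "V \<subseteq> A" "\<And>x y. p (x + y) = p x + p y"
    "\<And>c x. p (c *\<^sub>C x) = c *\<^sub>C p x" "\<And>x. x \<in> M \<Longrightarrow> p x = 0" "\<And>v. v \<in> V \<Longrightarrow> p v = v"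
    "\<And>x. x \<in> A \<Longrightarrow> p x \<in> V" "\<And>x. x \<in> A \<Longrightarrow> x - p x \<in> M"
proof -
  have sub: "cvec.subspace M" "cvec.subspace A"
    using assms by (auto simp: complex_subspace_iff_subspace)
  obtain B where B: "B \<subseteq> M" "cvec.independent B" "M \<subseteq> cvec.span B"
    by (rule cvec.maximal_independent_subset)
  have sB: "cvec.span B = M"
    using B cvec.span_minimal[OF B(1) sub(1)] by blast
  obtain C where C: "B \<subseteq> C" "C \<subseteq> A" "cvec.independent C" "A \<subseteq> cvec.span C"
    using cvec.maximal_independent_subset_extend[of B A] B assms(3) by blast
  have sC: "cvec.span C = A"
    using C cvec.span_minimal[OF C(2) sub(2)] by blast
  define p where "p = cvec_pair.construct C (\<lambda>b. if b \<in> B then 0 else b)"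
  interpret p: Vector_Spaces.linear scaleC scaleC p
    unfolding p_def by (rule cvec_pair.linear_construct[OF C(3)])
  have pC: "p b = (if b \<in> B then 0 else b)" if "b \<in> C" for b
    unfolding p_def by (rule cvec_pair.construct_basis[OF C(3) that])
  have add: "p (x + y) = p x + p y" for x y by (rule p.add)
  have scale: "p (c *\<^sub>C x) = c *\<^sub>C p x" for c x by (rule p.scale)
  have p0: "p 0 = 0" by (rule p.zero)
  let ?V = "cvec.span (C - B)"
  show ?thesis
  proof (rule that[of ?V p])
    show "complex_subspace ?V" by (simp add: complex_subspace_iff_subspace)
    show "?V \<subseteq> A" using sC cvec.span_mono[of "C - B" C] by blast
    show "p x = 0" if "x \<in> M" for x
    proof -
      have "x \<in> cvec.span B" using that sB by simp
      then show ?thesis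
        by (induction rule: cvec.span_induct_alt) (use C(1) pC in \<open>auto simp: add scale p0\<close>)
    qed
    show "p x = x" if "x \<in> ?V" for x
      using that
      by (induction rule: cvec.span_induct_alt) (use pC in \<open>auto simp: add scale p0\<close>)
    show "p x \<in> ?V" if "x \<in> A" for x
    proof -
      have "x \<in> cvec.span C" using that sC by simp
      then show ?thesis
      proof (induction rule: cvec.span_induct_alt)
        case (step c x y)
        have "p x \<in> ?V" using step(1) by (auto simp: pC cvec.span_zero intro: cvec.span_base)
        then show ?case
          using step(2) by (simp only: add scale) (intro cvec.span_add cvec.span_scale)
      qed (simp add: p0 cvec.span_zero)
    qed
    show "x - p x \<in> M" if "x \<in> A" for x
    proof -
      have "x \<in> cvec.span C" using that sC by simp
      then show ?thesis
      proof (induction rule: cvec.span_induct_alt)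
        case base
        then show ?case using cvec.subspace_0[OF sub(1)] by (simp add: p0)
      next
        case (step c x y)
        have "x - p x \<in> M"
          using step(1) B(1) cvec.subspace_0[OF sub(1)] by (auto simp: pC)
        then have "c *\<^sub>C (x - p x) + (y - p y) \<in> M"
          using step(2) by (intro cvec.subspace_add[OF sub(1)] cvec.subspace_scale[OF sub(1)])
        moreover have "c *\<^sub>C (x - p x) + (y - p y) = c *\<^sub>C x + y - p (c *\<^sub>C x + y)"
          by (simp add: add scale cvec.scale_right_diff_distrib)
        ultimately show ?case by simp
      qed
    qed
  qed (rule add scale)+
qed

text \<open>
  If \<open>c\<close> is not left quasi-regular, the left ideal of all \<open>x - x c\<close> avoids \<open>c\<close>, hence lies in a
  maximal such left ideal \<open>M\<close>; the quotient module \<open>A / M\<close>, realised on a complement of \<open>M\<close>, is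
  irreducible and \<open>c\<close> acts on it non-trivially.
\<close>

lemma jacobson_radical_subset_quasi_regular_ideal:
  fixes A :: "'a::complex_algebra set"
  assumes A: "complex_subalgebra A"
  shows "jacobson_radical A \<subseteq> quasi_regular_ideal A"
proof
  fix T assume T: "T \<in> jacobson_radical A"
  note AD = complex_subalgebraD[OF A]
  have "left_quasi_regular A (a * T)" if a: "a \<in> A" for a
  proof (rule ccontr)
    define c where "c = a * T"
    assume "\<not> left_quasi_regular A (a * T)"
    then have nq: "b + c - b * c \<noteq> 0" if "b \<in> A" for b
      using that unfolding left_quasi_regular_def c_def by blast
    have TA: "T \<in> A" using T by (simp add: jacobson_radical_def)
    have cA: "c \<in> A" using a TA AD by (simp add: c_def)
    define L where "L = (\<lambda>x. x - x * c) ` A"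
    have "left_ideal A L"
      unfolding left_ideal_def complex_subspace_def
    proof (intro conjI ballI allI)
      show "L \<subseteq> A" using AD cA by (auto simp: L_def)
      show "0 \<in> L" unfolding L_def using AD(2) by (intro image_eqI[of _ _ 0]) auto
      show "x + y \<in> L" if xy: "x \<in> L" "y \<in> L" for x y
      proof -
        obtain u v where u: "u \<in> A" "v \<in> A" "x = u - u * c" "y = v - v * c"
          using xy by (auto simp: L_def)
        have "x + y = (u + v) - (u + v) * c"
          unfolding u by (simp add: algebra_simps)
        then show ?thesis unfolding L_def using u AD(3) by blast
      qed
      show "r *\<^sub>C x \<in> L" if x: "x \<in> L" for r x
      proof -
        obtain u where u: "u \<in> A" "x = u - u * c" using x by (auto simp: L_def)
        have "r *\<^sub>C x = r *\<^sub>C u - (r *\<^sub>C u) * c"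
          unfolding u by (simp add: cvec.scale_right_diff_distrib mult_scaleC_left)
        then show ?thesis unfolding L_def using u AD(6) by blast
      qed
      show "y * x \<in> L" if y: "y \<in> A" and x: "x \<in> L" for y x
      proof -
        obtain u where u: "u \<in> A" "x = u - u * c" using x by (auto simp: L_def)
        have "y * x = y * u - (y * u) * c"
          unfolding u by (simp add: algebra_simps)
        then show ?thesis unfolding L_def using u y AD(7) by blast
      qed
    qed
    moreover have "c \<notin> L"
    proof
      assume "c \<in> L"
      then obtain x where "x \<in> A" "c = x - x * c" by (auto simp: L_def)
      then show False using nq[of "- x"] AD by (simp add: algebra_simps)
    qed
    ultimately obtain M where M: "left_ideal A M" "L \<subseteq> M" "c \<notin> M"
      and Mmax: "\<And>N. left_ideal A N \<Longrightarrow> M \<subseteq> N \<Longrightarrow> c \<notin> N \<Longrightarrow> N = M"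
      by (rule exists_maximal_left_ideal_avoiding) (rule that)
    have MA: "M \<subseteq> A" and Ms: "complex_subspace M" and Ml: "\<And>a m. a \<in> A \<Longrightarrow> m \<in> M \<Longrightarrow> a * m \<in> M"
      using M(1) by (auto simp: left_ideal_def)
    have M0: "0 \<in> M" and Ma: "\<And>x y. x \<in> M \<Longrightarrow> y \<in> M \<Longrightarrow> x + y \<in> M"
      using Ms by (auto simp: complex_subspace_def)
    \<comment> \<open>Modulo \<open>M\<close> the element \<open>c\<close> is a right identity,
      since \<open>M\<close> contains every \<open>x - x * c\<close>.\<close>
    have modular: "x \<in> M" if "x \<in> A" "x * c \<in> M" for x
    proof -
      have "x - x * c \<in> M" using that M(2) by (auto simp: L_def)
      then have "(x - x * c) + x * c \<in> M" using that Ma by blast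
      then show ?thesis by simp
    qed
    obtain V p where V: "complex_subspace V" "V \<subseteq> A"
      and p_add: "\<And>x y. p (x + y) = p x + p y" and p_scale: "\<And>r x. p (r *\<^sub>C x) = r *\<^sub>C p x"
      and pM: "\<And>x. x \<in> M \<Longrightarrow> p x = 0" and pV: "\<And>v. v \<in> V \<Longrightarrow> p v = v"
      and pA: "\<And>x. x \<in> A \<Longrightarrow> p x \<in> V" and pd: "\<And>x. x \<in> A \<Longrightarrow> x - p x \<in> M"
      using subspace_complement_projection[OF Ms AD(1) MA] by blast
    have p0: "x \<in> M" if "x \<in> A" "p x = 0" for x using pd[OF that(1)] that(2) by simp
    have pm: "p (b * p x) = p (b * x)" if "b \<in> A" "x \<in> A" for b x
    proof -
      have "p (b * (x - p x)) = 0" using Ml pd that pM by blast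
      moreover have "b * x = b * p x + b * (x - p x)" by (simp add: algebra_simps)
      ultimately show ?thesis using p_add by (metis add.right_neutral)
    qed
    have rep: "algebra_representation A V (\<lambda>b v. p (b * v))"
      unfolding algebra_representation_def
      using V AD by (auto simp: subset_iff pA p_add p_scale pm distrib_left distrib_right
          mult_scaleC_left mult_scaleC_right mult.assoc)
    \<comment> \<open>\<open>c\<close> moves its own class: otherwise \<open>c * c\<close> would lie
      in \<open>M\<close>, and then so would \<open>c\<close>.\<close>
    have cc: "p (c * p c) \<noteq> 0"
    proof
      assume "p (c * p c) = 0"
      then have "c * c \<in> M" using pm[OF cA cA] p0 AD(7)[OF cA cA] by simp
      then show False using modular[OF cA] M(3) by blast
    qed
    have irr: "irreducible_representation A V (\<lambda>b v. p (b * v))"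
      unfolding irreducible_representation_def
    proof (intro conjI rep allI impI)
      show "\<exists>b\<in>A. \<exists>v\<in>V. p (b * v) \<noteq> 0" using cc cA pA by blast
      fix W assume W: "W \<subseteq> V" and W': "complex_subspace W \<and> (\<forall>b\<in>A. \<forall>w\<in>W. p (b * w) \<in> W)"
      \<comment> \<open>\<open>N\<close> is the preimage of the submodule \<open>W\<close>, a left
        ideal above \<open>M\<close>. Either it avoids \<open>c\<close> and equals \<open>M\<close>
        by maximality, or it contains the right identity \<open>c\<close> modulo \<open>M\<close>
        and every class of \<open>A\<close> lies in \<open>W\<close>.\<close>
      define N where "N = {x \<in> A. p x \<in> W}"
      have "left_ideal A N"
        unfolding left_ideal_def N_def complex_subspace_def
      proof (intro conjI ballI allI)
        show "0 \<in> {x \<in> A. p x \<in> W}" using W' AD(2) pM[OF M0] by (auto simp: complex_subspace_def)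
        show "b * x \<in> {x \<in> A. p x \<in> W}" if "b \<in> A" "x \<in> {x \<in> A. p x \<in> W}" for b x
          using that W' AD(7) pm[of b x] by (metis (mono_tags, lifting) mem_Collect_eq)
      qed (use W' AD in \<open>auto simp: complex_subspace_def p_add p_scale\<close>)
      moreover have "M \<subseteq> N" using MA pM W' by (auto simp: N_def complex_subspace_def)
      ultimately have or: "c \<in> N \<or> N = M" using Mmax by blast
      show "W = {0} \<or> W = V"
      proof (cases "c \<in> N")
        case True
        have "v \<in> W" if v: "v \<in> V" for v
        proof -
          have vA: "v \<in> A" using v V by blast
          have "v - v * c \<in> M" using M(2) vA by (auto simp: L_def)
          then have "p (v - v * c) = 0" by (rule pM)
          moreover have "v = (v - v * c) + v * c" by simp
          ultimately have "p v = p (v * c)" using p_add by (metis add.left_neutral)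
          also have "\<dots> = p (v * p c)" by (rule pm[symmetric, OF vA cA])
          also have "\<dots> \<in> W" using True W' vA by (auto simp: N_def)
          finally show ?thesis using pV[OF v] by simp
        qed
        then show ?thesis using W by blast
      next
        case False
        then have NM: "N = M" using or by blast
        have "w = 0" if w: "w \<in> W" for w
        proof -
          have "w \<in> N" using w W V pV by (auto simp: N_def)
          then have "p w = 0" using NM pM by blast
          then show ?thesis using pV w W by auto
        qed
        then show ?thesis using W' by (auto simp: complex_subspace_def)
      qed
    qed
    then have "primitive_ideal A (representation_kernel A V (\<lambda>b v. p (b * v)))"
      unfolding primitive_ideal_def by blast
    then have TP: "T \<in> representation_kernel A V (\<lambda>b v. p (b * v))"
      using T by (auto simp: jacobson_radical_def)
    \<comment> \<open>\<open>T\<close> annihilates the module, hence so does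
      \<open>c = a * T\<close>, against \<open>cc\<close>.\<close>
    have "p (T * p c) = 0" using TP pA[OF cA] by (auto simp: representation_kernel_def)
    then have "p (a * p (T * p c)) = 0" using pM[OF M0] by simp
    moreover have "T * p c \<in> A" using TA cA pA V AD(7) by blast
    ultimately have "p (a * (T * p c)) = 0" using pm[OF a] by simp
    then show False using cc by (simp add: c_def mult.assoc)
  qed
  then show "T \<in> quasi_regular_ideal A"
    using T by (simp add: quasi_regular_ideal_def jacobson_radical_def)
qed

lemma zero_in_jacobson_radical:
  assumes "complex_subalgebra A"
  shows "0 \<in> jacobson_radical A"
  using representation_kernel_ideal[OF assms] complex_subalgebraD(2)[OF assms]
  by (fastforce simp: jacobson_radical_def primitive_ideal_def irreducible_representation_def
      two_sided_ideal_def complex_subspace_def)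

text \<open>Annihilators take the place of the ideal generated by \<open>t\<close>: \<open>J\<close>
  is the right annihilator of \<open>t\<close> and \<open>t A\<close>, and \<open>I\<close> is the
  left annihilator of \<open>J\<close>. Both contain \<open>t\<close> and their product is zero, so
  each prime ideal contains one of them.\<close>

lemma in_prime_radical_if_sandwich_zero:
  fixes A :: "'a::complex_algebra set"
  assumes A: "complex_subalgebra A" and t: "t \<in> A" "t * t = 0" "\<And>b. b \<in> A \<Longrightarrow> t * b * t = 0"
  shows "t \<in> prime_radical A"
proof -
  note AD = complex_subalgebraD[OF A]
  define J where "J = {j \<in> A. t * j = 0 \<and> (\<forall>b\<in>A. t * b * j = 0)}"
  have J: "two_sided_ideal A J"
    unfolding two_sided_ideal_def complex_subspace_def
  proof (intro conjI ballI allI)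
    fix a j assume a: "a \<in> A" and j: "j \<in> J"
    have "t * b * (a * j) = 0" if "b \<in> A" for b
    proof -
      have "t * (b * a) * j = 0" using j AD(7)[OF that a] unfolding J_def by blast
      then show ?thesis by (simp add: mult.assoc)
    qed
    moreover have "t * (a * j) = 0" using a j by (simp add: J_def mult.assoc)
    ultimately show "a * j \<in> J" using a j AD(7) by (simp add: J_def)
    show "j * a \<in> J" using a j AD(7) by (simp add: J_def mult.assoc[symmetric])
  qed (use AD in \<open>auto simp: J_def distrib_left mult_scaleC_right\<close>)
  define I where "I = {x \<in> A. \<forall>j\<in>J. x * j = 0}"
  have I: "two_sided_ideal A I"
    unfolding two_sided_ideal_def complex_subspace_def I_def
    using AD J by (auto simp: distrib_right mult_scaleC_left mult.assoc two_sided_ideal_def)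
  have tJ: "t \<in> J" using t by (auto simp: J_def)
  have tI: "t \<in> I" using t by (auto simp: I_def J_def)
  have prod: "ideal_product I J \<subseteq> {0}"
    by (auto simp: ideal_product_def I_def intro!: sum.neutral)
  have "t \<in> P" if P: "prime_ideal A P" for P
  proof -
    have "0 \<in> P" using P by (auto simp: prime_ideal_def two_sided_ideal_def complex_subspace_def)
    then have "ideal_product I J \<subseteq> P" using prod by blast
    then have "I \<subseteq> P \<or> J \<subseteq> P" using P I J by (auto simp: prime_ideal_def)
    then show ?thesis using tI tJ by blast
  qed
  then show ?thesis using t by (auto simp: prime_radical_def)
qed

section \<open>Continuous functions vanishing at infinity\<close>

lemma C0_continuous: "f \<in> C0 \<Longrightarrow> continuous_on UNIV f"
  by (simp add: C0_def)

lemma C0_zero: "(\<lambda>x. 0) \<in> C0"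
  by (auto simp: C0_def intro!: exI[of _ "{}"])

lemma C0_scale: "f \<in> C0 \<Longrightarrow> (\<lambda>x. c * f x) \<in> C0"
  by (rule C0_dominated[where f = f and c = "cmod c"]) (auto intro!: continuous_intros dest: C0_continuous simp: norm_mult)

lemma C0_mult: "f \<in> C0 \<Longrightarrow> g \<in> C0 \<Longrightarrow> (\<lambda>x. f x * g x) \<in> C0"
  by (rule C0_dominated[where f = f and c = "sup_norm g"])
    (auto intro!: continuous_intros mult_left_mono dest: C0_continuous
      simp: norm_mult mult.commute[of "sup_norm g"] C0_le_sup_norm)

lemma C0_cnj: "f \<in> C0 \<Longrightarrow> (\<lambda>x. cnj (f x)) \<in> C0"
  by (rule C0_dominated[where f = f and c = 1]) (auto intro!: continuous_intros dest: C0_continuous)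

lemma C0_add: assumes "f \<in> C0" "g \<in> C0" shows "(\<lambda>x. f x + g x) \<in> C0"
  unfolding C0_def
proof (intro CollectI conjI allI impI)
  show "continuous_on UNIV (\<lambda>x. f x + g x)"
    using assms by (intro continuous_intros C0_continuous)
  fix e :: real assume "e > 0"
  then have e: "e / 2 > 0" by simp
  obtain K where K: "compact K" "\<And>x. x \<notin> K \<Longrightarrow> cmod (f x) < e / 2"
    using assms(1) e unfolding C0_def by blast
  obtain L where L: "compact L" "\<And>x. x \<notin> L \<Longrightarrow> cmod (g x) < e / 2"
    using assms(2) e unfolding C0_def by blast
  have "cmod (f x + g x) < e" if "x \<notin> K \<union> L" for x
    using K(2)[of x] L(2)[of x] that norm_triangle_ineq[of "f x" "g x"] by auto
  then show "\<exists>K. compact K \<and> (\<forall>x. x \<notin> K \<longrightarrow> cmod (f x + g x) < e)"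
    using K L by (intro exI[of _ "K \<union> L"]) (auto intro: compact_Un)
qed

lemma C0_diff: "f \<in> C0 \<Longrightarrow> g \<in> C0 \<Longrightarrow> (\<lambda>x. f x - g x) \<in> C0"
  using C0_add[of f "\<lambda>x. (-1) * g x"] C0_scale[of g "-1"] by simp

lemma sup_norm_le: "(\<And>x. cmod (f x) \<le> c) \<Longrightarrow> sup_norm f \<le> c"
  unfolding sup_norm_def by (rule cSUP_least) auto

lemma C0_uniform_limit:
  assumes f: "\<And>n. f n \<in> C0" and lim: "uniform_limit UNIV f g sequentially"
  shows "g \<in> C0"
  unfolding C0_def
proof (intro CollectI conjI allI impI)
  show "continuous_on UNIV g"
    by (rule uniform_limit_theorem[OF _ lim]) (simp_all add: C0_continuous f)
  fix e :: real assume "e > 0"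
  then have e: "e / 2 > 0" by simp
  obtain n where n: "\<And>x. dist (f n x) (g x) < e / 2"
    using uniform_limitD[OF lim e] by (auto simp: eventually_sequentially)
  obtain K where K: "compact K" "\<And>x. x \<notin> K \<Longrightarrow> cmod (f n x) < e / 2"
    using f[of n] e unfolding C0_def by blast
  have "cmod (g x) < e" if "x \<notin> K" for x
    using K(2)[OF that] n[of x] norm_triangle_ineq4[of "f n x" "f n x - g x"] by (auto simp: dist_norm)
  then show "\<exists>K. compact K \<and> (\<forall>x. x \<notin> K \<longrightarrow> cmod (g x) < e)"
    using K by blast
qed

text \<open>A tent function of radius at most \<open>e\<close>, small enough that its support lies
  in a compact neighbourhood of \<open>z\<close>; this is where local compactness supplies functions
  in \<open>C0\<close>.\<close>

lemma C0_bump: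
  fixes z :: "'x::metric_space"
  assumes lc: "locally_compact_space (euclidean :: 'x topology)" and e: "e > 0"
  obtains f :: "'x \<Rightarrow> real" where "(\<lambda>x. complex_of_real (f x)) \<in> C0" "\<And>x. f x \<ge> 0" "f z > 0"
    "\<And>x. dist z x \<ge> e \<Longrightarrow> f x = 0"
proof -
  obtain U K where U: "open U" "compact K" "z \<in> U" "U \<subseteq> K"
    using lc unfolding locally_compact_space_def by simp metis
  obtain r where r: "r > 0" "ball z r \<subseteq> U"
    using U by (meson open_contains_ball)
  define s where "s = min r e"
  define f where "f x = max 0 (s - dist z x)" for x
  show ?thesis
  proof (rule that[of f])
    show "(\<lambda>x. complex_of_real (f x)) \<in> C0"
      unfolding C0_def
    proof (intro CollectI conjI allI impI)
      show "continuous_on UNIV (\<lambda>x. complex_of_real (f x))"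
        unfolding f_def by (intro continuous_intros)
      fix d :: real assume "d > 0"
      moreover have "f x = 0" if "x \<notin> K" for x
      proof -
        have "x \<notin> ball z r" using that r U by blast
        then show ?thesis by (simp add: f_def s_def)
      qed
      ultimately show "\<exists>K. compact K \<and> (\<forall>x. x \<notin> K \<longrightarrow> cmod (complex_of_real (f x)) < d)"
        using U by auto
    qed
  qed (use r e in \<open>auto simp: f_def s_def\<close>)
qed

section \<open>Faithful representations are isometric\<close>

context
  fixes \<rho> :: "('x::topological_space \<Rightarrow> complex) \<Rightarrow> 'h::complex_hilbert bop"
  assumes rep: "faithful_star_rep \<rho>"
begin

lemma star_rep_add: "f \<in> C0 \<Longrightarrow> g \<in> C0 \<Longrightarrow> \<rho> (\<lambda>x. f x + g x) = \<rho> f + \<rho> g"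
  and star_rep_scale: "f \<in> C0 \<Longrightarrow> \<rho> (\<lambda>x. c * f x) = c *\<^sub>C \<rho> f"
  and star_rep_mult: "f \<in> C0 \<Longrightarrow> g \<in> C0 \<Longrightarrow> \<rho> (\<lambda>x. f x * g x) = \<rho> f * \<rho> g"
  and star_rep_star: "f \<in> C0 \<Longrightarrow> cinner (\<rho> f \<cdot> u) v = cinner u (\<rho> (\<lambda>x. cnj (f x)) \<cdot> v)"
  and star_rep_eq_iff: "f \<in> C0 \<Longrightarrow> g \<in> C0 \<Longrightarrow> \<rho> f = \<rho> g \<longleftrightarrow> f = g"
  using rep unfolding faithful_star_rep_def by (blast dest: inj_onD)+

lemma star_rep_zero: "\<rho> (\<lambda>x. 0) = 0"
  using star_rep_scale[OF C0_zero, of 0] by simp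

lemma star_rep_diff:
  assumes "f \<in> C0" "g \<in> C0" shows "\<rho> (\<lambda>x. f x - g x) = \<rho> f - \<rho> g"
proof -
  have "\<rho> (\<lambda>x. f x + (-1) * g x) = \<rho> f + (-1) *\<^sub>C \<rho> g"
    by (simp only: star_rep_add[OF assms(1) C0_scale[OF assms(2)]] star_rep_scale[OF assms(2)])
  then show ?thesis by simp
qed

lemma norm_star_rep_apply_sq:
  assumes "f \<in> C0"
  shows "complex_of_real ((norm (\<rho> f \<cdot> u))\<^sup>2) = cinner u (\<rho> (\<lambda>x. complex_of_real ((cmod (f x))\<^sup>2)) \<cdot> u)"
proof -
  have "complex_of_real ((norm (\<rho> f \<cdot> u))\<^sup>2) = cinner u ((\<rho> (\<lambda>x. cnj (f x)) * \<rho> f) \<cdot> u)"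
    using star_rep_star[OF assms, of u "\<rho> f \<cdot> u"] by (simp only: cinner_self bop_times_apply)
  also have "\<rho> (\<lambda>x. cnj (f x)) * \<rho> f = \<rho> (\<lambda>x. cnj (f x) * f x)"
    by (rule star_rep_mult[OF C0_cnj[OF assms] assms, symmetric])
  also have "(\<lambda>x. cnj (f x) * f x) = (\<lambda>x. complex_of_real ((cmod (f x))\<^sup>2))"
    by (intro ext) (simp add: complex_norm_square[symmetric] mult.commute del: of_real_power)
  finally show ?thesis .
qed

text \<open>The difference of the squared moduli is the square of a function \<open>r\<close> in
  \<open>C0\<close>, so the squared norms of \<open>\<rho> f \<cdot> u\<close> and
  \<open>\<rho> r \<cdot> u\<close> add up to that of \<open>\<rho> g \<cdot> u\<close>.\<close>

lemma norm_star_rep_apply_mono: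
  assumes f: "f \<in> C0" and g: "g \<in> C0" and le: "\<And>x. cmod (f x) \<le> cmod (g x)"
  shows "norm (\<rho> f \<cdot> u) \<le> norm (\<rho> g \<cdot> u)"
proof -
  define r where "r x = complex_of_real (sqrt ((cmod (g x))\<^sup>2 - (cmod (f x))\<^sup>2))" for x
  have nn: "(cmod (g x))\<^sup>2 - (cmod (f x))\<^sup>2 \<ge> 0" for x using le[of x] by (simp add: power_mono)
  have r: "r \<in> C0"
  proof (rule C0_dominated[OF g, of _ 1])
    show "continuous_on UNIV r"
      unfolding r_def by (intro continuous_intros C0_continuous f g)
    show "cmod (r x) \<le> 1 * cmod (g x)" for x
    proof -
      have "sqrt ((cmod (g x))\<^sup>2 - (cmod (f x))\<^sup>2) \<le> sqrt ((cmod (g x))\<^sup>2)"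
        by (intro real_sqrt_le_mono) simp
      then show ?thesis using nn[of x] by (simp add: r_def)
    qed
  qed
  have sq: "(\<lambda>x. complex_of_real ((cmod (h x))\<^sup>2)) \<in> C0" if h: "h \<in> C0" for h :: "'x \<Rightarrow> complex"
  proof -
    have "(\<lambda>x. h x * cnj (h x)) \<in> C0" using C0_mult[OF h C0_cnj[OF h]] .
    then show ?thesis by (simp only: complex_norm_square)
  qed
  have "(\<lambda>x. complex_of_real ((cmod (g x))\<^sup>2))
      = (\<lambda>x. complex_of_real ((cmod (f x))\<^sup>2) + complex_of_real ((cmod (r x))\<^sup>2))"
    using nn by (intro ext) (simp add: r_def)
  then have "complex_of_real ((norm (\<rho> g \<cdot> u))\<^sup>2)
      = complex_of_real ((norm (\<rho> f \<cdot> u))\<^sup>2 + (norm (\<rho> r \<cdot> u))\<^sup>2)"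
    by (simp only: norm_star_rep_apply_sq f g r star_rep_add[OF sq sq] bop_plus_apply cinner_add_right
        of_real_add)
  then have "(norm (\<rho> g \<cdot> u))\<^sup>2 = (norm (\<rho> f \<cdot> u))\<^sup>2 + (norm (\<rho> r \<cdot> u))\<^sup>2"
    using of_real_eq_iff by blast
  then have "(norm (\<rho> f \<cdot> u))\<^sup>2 \<le> (norm (\<rho> g \<cdot> u))\<^sup>2" by simp
  then show ?thesis by (rule power2_le_imp_le) simp
qed

text \<open>For \<open>0 < s < cmod (g x)\<close> the function \<open>h\<close>, the positive part
  of \<open>cmod g - s\<close>, is nonzero, so by faithfulness \<open>\<rho> h\<close> has a nonzero
  value. Since \<open>cmod g\<close> exceeds \<open>s\<close> wherever \<open>h\<close> is nonzero,
  \<open>\<rho> g\<close> stretches that value by at least \<open>s\<close>.\<close>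

lemma cmod_le_norm_star_rep:
  assumes g: "g \<in> C0"
  shows "cmod (g x) \<le> norm (\<rho> g)"
proof (rule dense_le)
  fix s assume s: "s < cmod (g x)"
  show "s \<le> norm (\<rho> g)"
  proof (cases "s > 0")
    case False
    then show ?thesis using norm_ge_zero[of "\<rho> g"] by linarith
  next
    case True
    define h where "h y = complex_of_real (max 0 (cmod (g y) - s))" for y
    have h: "h \<in> C0"
    proof (rule C0_dominated[OF g, of _ 1])
      show "continuous_on UNIV h"
        unfolding h_def by (intro continuous_intros C0_continuous g)
    qed (use True in \<open>auto simp: h_def\<close>)
    have "h x \<noteq> 0" using s by (simp add: h_def)
    then have "\<rho> h \<noteq> \<rho> (\<lambda>x. 0)" unfolding star_rep_eq_iff[OF h C0_zero] by auto
    then obtain u where u: "\<rho> h \<cdot> u \<noteq> 0"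
      using bop_eqI[of "\<rho> h" 0] unfolding star_rep_zero by (auto simp: bop_apply.rep_eq zero_bop.rep_eq)
    have "norm (\<rho> (\<lambda>y. complex_of_real s * h y) \<cdot> u) \<le> norm (\<rho> (\<lambda>y. g y * h y) \<cdot> u)"
    proof (rule norm_star_rep_apply_mono)
      show "cmod (complex_of_real s * h y) \<le> cmod (g y * h y)" for y
        using True by (auto simp: h_def norm_mult max_def intro!: mult_right_mono)
    qed (intro C0_scale C0_mult g h)+
    then have "s * norm (\<rho> h \<cdot> u) \<le> norm (\<rho> g \<cdot> (\<rho> h \<cdot> u))"
      using True by (simp add: star_rep_scale[OF h] star_rep_mult[OF g h] bop_scaleC_apply
          bop_times_apply norm_scaleC)
    also have "\<dots> \<le> norm (\<rho> g) * norm (\<rho> h \<cdot> u)" by (rule norm_bop_apply)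
    finally show ?thesis using u by simp
  qed
qed

text \<open>The preceding bound turns a Cauchy sequence of operators into a uniformly Cauchy
  sequence of functions. It is used to recover coefficient functions of limits.\<close>

lemma star_rep_complete:
  assumes f: "\<And>n. f n \<in> C0" and C: "Cauchy (\<lambda>n. \<rho> (f n))"
  obtains g where "g \<in> C0" "(\<lambda>n. sup_norm (\<lambda>x. f n x - g x)) \<longlonglongrightarrow> 0"
proof -
  have d: "cmod (f m x - f n x) \<le> norm (\<rho> (f m) - \<rho> (f n))" for m n x
    using cmod_le_norm_star_rep[OF C0_diff[OF f[of m] f[of n]], of x] by (simp add: star_rep_diff f)
  have "uniformly_Cauchy_on UNIV f"
    unfolding uniformly_Cauchy_on_def dist_norm
  proof (intro allI impI)
    fix e :: real assume "e > 0"
    then obtain M where "\<And>m n. m \<ge> M \<Longrightarrow> n \<ge> M \<Longrightarrow> norm (\<rho> (f m) - \<rho> (f n)) < e"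
      using CauchyD[OF C] by blast
    then show "\<exists>M. \<forall>x\<in>UNIV. \<forall>m\<ge>M. \<forall>n\<ge>M. cmod (f m x - f n x) < e"
      using d by (meson order_le_less_trans)
  qed
  then obtain g where g: "uniform_limit UNIV f g sequentially"
    using Cauchy_uniformly_convergent unfolding uniformly_convergent_on_def by blast
  have gC: "g \<in> C0" by (rule C0_uniform_limit[OF f g])
  have "(\<lambda>n. sup_norm (\<lambda>x. f n x - g x)) \<longlonglongrightarrow> 0"
  proof (rule LIMSEQ_I)
    fix e :: real assume "e > 0"
    then have "e / 2 > 0" by simp
    from uniform_limitD[OF g this] obtain M where M: "\<And>n x. n \<ge> M \<Longrightarrow> dist (f n x) (g x) < e / 2"
      by (auto simp: eventually_sequentially)
    have "norm (sup_norm (\<lambda>x. f n x - g x) - 0) < e" if "n \<ge> M" for n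
    proof -
      have "sup_norm (\<lambda>x. f n x - g x) \<le> e / 2"
        by (rule sup_norm_le) (use M[OF that] in \<open>auto simp: dist_norm intro: less_imp_le\<close>)
      moreover have "0 \<le> sup_norm (\<lambda>x. f n x - g x)" by (rule sup_norm_nonneg[OF C0_diff[OF f gC]])
      ultimately show ?thesis using \<open>e > 0\<close> by simp
    qed
    then show "\<exists>M. \<forall>n\<ge>M. norm (sup_norm (\<lambda>x. f n x - g x) - 0) < e" by blast
  qed
  with gC show ?thesis by (rule that)
qed

end

section \<open>Monomials and Fourier coefficients\<close>

lemma bop_zero_apply [simp]: "0 \<cdot> x = 0"
  by (simp add: bop_apply.rep_eq zero_bop.rep_eq)

lemma bop_apply_zero [simp]: "T \<cdot> 0 = 0"
  by (simp add: bop_apply.rep_eq)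

lemma norm_tensor: "norm ((\<xi>::'h::complex_inner) \<otimes>e k) = norm \<xi>"
proof -
  have "(norm (\<xi> \<otimes>e k))\<^sup>2 = (\<Sum>\<^sub>\<infinity>i\<in>{k}. (norm \<xi>)\<^sup>2)"
    unfolding norm_ell2_sq by (rule infsum_cong_neutral) (auto simp: tensor.rep_eq)
  then show ?thesis by (simp add: power2_eq_iff_nonneg)
qed

lemma norm_scaleC_bop: "norm (c *\<^sub>C (T::'h::complex_inner bop)) \<le> cmod c * norm T"
proof (rule norm_bop_le)
  show "norm ((c *\<^sub>C T) \<cdot> x) \<le> cmod c * norm T * norm x" for x
    using mult_left_mono[OF norm_bop_apply[of T x], of "cmod c"]
    by (simp add: bop_scaleC_apply norm_scaleC mult.assoc)
qed simp

lemma tendsto_scaleC_bop: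
  assumes "(X \<longlongrightarrow> (T::'h::complex_inner bop)) F"
  shows "((\<lambda>n. c *\<^sub>C X n) \<longlongrightarrow> c *\<^sub>C T) F"
proof -
  have "bounded_linear (\<lambda>T::'h bop. c *\<^sub>C T)"
    by (rule bounded_linear_intro[of _ "cmod c"])
      (simp_all add: scaleC_add_right scaleR_scaleC scaleC_scaleC norm_scaleC_bop mult.commute[of _ "cmod c"] mult.commute[of c])
  then show ?thesis using assms by (rule bounded_linear.tendsto)
qed

lemma complex_subspace_closure:
  fixes S :: "'h::complex_inner bop set"
  assumes "complex_subspace S"
  shows "complex_subspace (closure S)"
  unfolding complex_subspace_def
proof (intro conjI ballI allI)
  show "0 \<in> closure S"
    using assms closure_subset[of S] by (auto simp: complex_subspace_def)
next
  fix x y assume "x \<in> closure S" "y \<in> closure S"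
  then obtain X Y where "\<And>n. X n \<in> S" "X \<longlonglongrightarrow> x" "\<And>n. Y n \<in> S" "Y \<longlonglongrightarrow> y"
    unfolding closure_sequential by blast
  then show "x + y \<in> closure S"
    unfolding closure_sequential using assms
    by (intro exI[of _ "\<lambda>n. X n + Y n"]) (auto simp: complex_subspace_def intro: tendsto_add)
next
  fix c x assume "x \<in> closure S"
  then obtain X where "\<And>n. X n \<in> S" "X \<longlonglongrightarrow> x"
    unfolding closure_sequential by blast
  then show "c *\<^sub>C x \<in> closure S"
    unfolding closure_sequential using assms
    by (intro exI[of _ "\<lambda>n. c *\<^sub>C X n"]) (auto simp: complex_subspace_def intro: tendsto_scaleC_bop)
qed

lemma ell2_nth_diff: "ell2_nth (x - y) i = ell2_nth x i - ell2_nth y i"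
  by (simp add: minus_ell2.rep_eq)

lemma ell2_nth_scaleC: "ell2_nth (c *\<^sub>C x) i = c *\<^sub>C ell2_nth x i"
  by (simp add: scaleC_ell2.rep_eq)

lemma ell2_nth_zero [simp]: "ell2_nth 0 i = 0"
  by (simp add: zero_ell2.rep_eq)

lemma tensor_zero [simp]: "0 \<otimes>e k = 0"
  by (subst ell2_nth_inject[symmetric], rule ext) (simp add: tensor.rep_eq)

lemma ell2_nth_tensor: "ell2_nth (\<xi> \<otimes>e k) i = (if i = k then \<xi> else 0)"
  by (simp add: tensor.rep_eq)

lemma tensor_add: "u \<otimes>e k + v \<otimes>e k = (u + v) \<otimes>e k"
  by (subst ell2_nth_inject[symmetric], rule ext) (simp add: ell2_nth_plus ell2_nth_tensor)

lemma tensor_scaleC: "c *\<^sub>C (u \<otimes>e k) = (c *\<^sub>C u) \<otimes>e k"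
  by (subst ell2_nth_inject[symmetric], rule ext) (simp add: ell2_nth_scaleC ell2_nth_tensor)

lemma bounded_linear_ell2_nth: "bounded_linear (\<lambda>x::('i, 'h::complex_inner) ell2. ell2_nth x i)"
  by (rule bounded_linear_intro[of _ 1])
    (auto simp: ell2_nth_plus scaleR_scaleC ell2_nth_scaleC norm_nth_le_ell2)

lemma bounded_linear_bop_entry: "bounded_linear (\<lambda>T. ell2_nth (T \<cdot> (\<xi> \<otimes>e k)) m)"
  using bounded_linear_compose[OF bounded_linear_ell2_nth bounded_linear_bop_apply] .

lemma norm_bop_entry: "norm (ell2_nth (T \<cdot> (\<xi> \<otimes>e k)) m) \<le> norm T * norm \<xi>"
  using norm_nth_le_ell2[of "T \<cdot> (\<xi> \<otimes>e k)" m] norm_bop_apply[of T "\<xi> \<otimes>e k"]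
  by (simp add: norm_tensor)

lemma nat_vec_le_add: "(k :: nat ^ 'd) \<le> k + n"
  by (simp add: less_eq_vec_def)

lemma nat_vec_add_diff: "k + n - (k :: nat ^ 'd) = n"
  by (simp add: vec_eq_iff)

lemma nat_vec_diff_add: "k \<le> m \<Longrightarrow> k + (m - k) = (m :: nat ^ 'd)"
  by (simp add: vec_eq_iff less_eq_vec_def)

locale crossed_product =
  fixes \<phi> :: "nat ^ 'd \<Rightarrow> 'x::metric_space \<Rightarrow> 'x"
    and \<rho> :: "('x \<Rightarrow> complex) \<Rightarrow> 'h::complex_hilbert bop"
  assumes dyn: "dynamical_system \<phi>" and rep: "faithful_star_rep \<rho>"
begin

abbreviation A :: "(nat ^ 'd, 'h) ell2 bop set" where
  "A \<equiv> analytic_crossed_product \<rho> \<phi>"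

lemmas rho = star_rep_add[OF rep] star_rep_scale[OF rep] star_rep_mult[OF rep]
  star_rep_diff[OF rep] star_rep_zero[OF rep] star_rep_eq_iff[OF rep]

lemma phi_zero: "\<phi> 0 = id"
  and phi_add: "\<phi> (n + m) x = \<phi> n (\<phi> m x)"
  and continuous_phi: "continuous_on UNIV (\<phi> n)"
  using dyn by (auto simp: dynamical_system_def)

lemma C0_phi: "f \<in> C0 \<Longrightarrow> (\<lambda>x. f (\<phi> n x)) \<in> C0"
  using dyn C0_comp_proper[of f "\<phi> n"] by (auto simp: dynamical_system_def o_def)

lemma sup_norm_phi_le: "f \<in> C0 \<Longrightarrow> sup_norm (\<lambda>x. f (\<phi> n x)) \<le> sup_norm f"
  by (intro sup_norm_le C0_le_sup_norm)

definition monom :: "nat ^ 'd \<Rightarrow> ('x \<Rightarrow> complex) \<Rightarrow> (nat ^ 'd, 'h) ell2 bop" where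
  "monom n f = (SOME T. norm T \<le> sup_norm f \<and>
     (\<forall>\<xi> k. T \<cdot> (\<xi> \<otimes>e k) = (\<rho> (\<lambda>x. f (\<phi> k x)) \<cdot> \<xi>) \<otimes>e (k + n)))"

lemma monom:
  assumes "f \<in> C0"
  shows norm_monom: "norm (monom n f) \<le> sup_norm f"
    and monom_apply: "monom n f \<cdot> (\<xi> \<otimes>e k) = (\<rho> (\<lambda>x. f (\<phi> k x)) \<cdot> \<xi>) \<otimes>e (k + n)"
proof -
  have "\<exists>T. norm T \<le> sup_norm f \<and>
     (\<forall>\<xi> k. T \<cdot> (\<xi> \<otimes>e k) = (\<rho> (\<lambda>x. f (\<phi> k x)) \<cdot> \<xi>) \<otimes>e (k + n))"
    using crossed_monomial_exists[OF dyn rep assms] by (simp add: o_def)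
  from someI_ex[OF this]
  show "norm (monom n f) \<le> sup_norm f"
    "monom n f \<cdot> (\<xi> \<otimes>e k) = (\<rho> (\<lambda>x. f (\<phi> k x)) \<cdot> \<xi>) \<otimes>e (k + n)"
    unfolding monom_def by blast+
qed

lemma monom_mult:
  assumes "f \<in> C0" "g \<in> C0"
  shows "monom n f * monom m g = monom (m + n) (\<lambda>x. f (\<phi> m x) * g x)"
proof (rule bop_eq_tensorI)
  fix \<xi> k
  have "\<rho> (\<lambda>x. f (\<phi> m (\<phi> k x)) * g (\<phi> k x)) = \<rho> (\<lambda>x. f (\<phi> (k + m) x)) * \<rho> (\<lambda>x. g (\<phi> k x))"
    using rho(3)[OF C0_phi[OF assms(1)] C0_phi[OF assms(2)], of "k + m" k]
    by (simp add: phi_add[symmetric] add.commute)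
  then show "(monom n f * monom m g) \<cdot> (\<xi> \<otimes>e k) = monom (m + n) (\<lambda>x. f (\<phi> m x) * g x) \<cdot> (\<xi> \<otimes>e k)"
    using assms by (simp add: bop_times_apply monom_apply C0_mult C0_phi add.assoc)
qed

lemma monom_add:
  assumes "f \<in> C0" "g \<in> C0"
  shows "monom n f + monom n g = monom n (\<lambda>x. f x + g x)"
  using assms
  by (intro bop_eq_tensorI)
    (simp add: bop_plus_apply monom_apply C0_add C0_phi rho tensor_add)

lemma monom_scaleC:
  assumes "f \<in> C0"
  shows "c *\<^sub>C monom n f = monom n (\<lambda>x. c * f x)"
  using assms
  by (intro bop_eq_tensorI)
    (simp add: bop_scaleC_apply monom_apply C0_scale C0_phi rho tensor_scaleC)

lemma monom_zero: "monom n (\<lambda>x. 0) = 0"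
  by (rule bop_eq_tensorI) (simp add: monom_apply[OF C0_zero] rho)

lemma crossed_rep_apply:
  assumes "F \<in> ell1_C0"
  shows "((\<lambda>n. (\<rho> (F n \<circ> \<phi> k) \<cdot> \<xi>) \<otimes>e (k + n)) has_sum crossed_rep \<rho> \<phi> F \<cdot> (\<xi> \<otimes>e k)) UNIV"
  using theI'[OF crossed_rep_unique_exists[OF dyn rep assms]] unfolding crossed_rep_def by blast

lemma crossed_rep_eqI:
  assumes "F \<in> ell1_C0"
    and "\<And>\<xi> k. ((\<lambda>n. (\<rho> (F n \<circ> \<phi> k) \<cdot> \<xi>) \<otimes>e (k + n)) has_sum T \<cdot> (\<xi> \<otimes>e k)) UNIV"
  shows "crossed_rep \<rho> \<phi> F = T"
  by (rule bop_eq_tensorI, rule has_sum_unique[OF crossed_rep_apply[OF assms(1)] assms(2)])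

lemma has_sum_crossed_rep:
  assumes F: "F \<in> ell1_C0"
  shows "((\<lambda>n. monom n (F n)) has_sum crossed_rep \<rho> \<phi> F) UNIV"
proof -
  have FC: "F n \<in> C0" for n using F by (simp add: ell1_C0_def)
  have "(\<lambda>n. sup_norm (F n)) summable_on UNIV" using F by (simp add: ell1_C0_def)
  then have "(\<lambda>n. norm (monom n (F n))) summable_on UNIV"
    by (rule summable_on_comparison_test) (use norm_monom[OF FC] in auto)
  then have s: "((\<lambda>n. monom n (F n)) has_sum (\<Sum>\<^sub>\<infinity>n. monom n (F n))) UNIV"
    by (rule has_sum_infsum[OF abs_summable_summable])
  have "crossed_rep \<rho> \<phi> F = (\<Sum>\<^sub>\<infinity>n. monom n (F n))"
  proof (rule crossed_rep_eqI[OF F])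
    fix \<xi> k
    from has_sum_bounded_linear[OF bounded_linear_bop_apply s, of "\<xi> \<otimes>e k"]
    show "((\<lambda>n. (\<rho> (F n \<circ> \<phi> k) \<cdot> \<xi>) \<otimes>e (k + n)) has_sum (\<Sum>\<^sub>\<infinity>n. monom n (F n)) \<cdot> (\<xi> \<otimes>e k)) UNIV"
      by (simp add: o_def monom_apply[OF FC])
  qed
  with s show ?thesis by simp
qed

lemma ell1_C0_add: "F \<in> ell1_C0 \<Longrightarrow> G \<in> ell1_C0 \<Longrightarrow> (\<lambda>n x. F n x + G n x) \<in> ell1_C0"
  unfolding ell1_C0_def
proof (elim CollectE conjE, intro CollectI conjI allI)
  assume FG: "\<forall>n. F n \<in> C0" "\<forall>n. G n \<in> C0"
    and s: "(\<lambda>n. sup_norm (F n)) summable_on UNIV" "(\<lambda>n. sup_norm (G n)) summable_on UNIV"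
  show C: "(\<lambda>x. F n x + G n x) \<in> C0" for n using FG by (auto intro: C0_add)
  have "sup_norm (\<lambda>x. F n x + G n x) \<le> sup_norm (F n) + sup_norm (G n)" for n
    using FG by (intro sup_norm_le norm_triangle_le add_mono C0_le_sup_norm) auto
  then show "(\<lambda>n. sup_norm (\<lambda>x. F n x + G n x)) summable_on UNIV"
    by (intro summable_on_comparison_test[OF summable_on_add[OF s]] sup_norm_nonneg C)
qed

lemma ell1_C0_scale: "F \<in> ell1_C0 \<Longrightarrow> (\<lambda>n x. c * F n x) \<in> ell1_C0"
  unfolding ell1_C0_def
proof (elim CollectE conjE, intro CollectI conjI allI)
  assume F: "\<forall>n. F n \<in> C0" and s: "(\<lambda>n. sup_norm (F n)) summable_on UNIV"
  show C: "(\<lambda>x. c * F n x) \<in> C0" for n using F by (auto intro: C0_scale)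
  have "sup_norm (\<lambda>x. c * F n x) \<le> cmod c * sup_norm (F n)" for n
    using F by (intro sup_norm_le) (auto simp: norm_mult intro!: mult_left_mono C0_le_sup_norm)
  then show "(\<lambda>n. sup_norm (\<lambda>x. c * F n x)) summable_on UNIV"
    by (intro summable_on_comparison_test[OF summable_on_cmult_right[OF s]] sup_norm_nonneg C)
qed

lemma ell1_C0_single: "f \<in> C0 \<Longrightarrow> (\<lambda>m. if m = n then f else (\<lambda>x. 0)) \<in> ell1_C0"
  unfolding ell1_C0_def
  by (auto intro!: C0_zero finite_nonzero_values_imp_summable_on
      intro: finite_subset[of _ "{n}"] simp: sup_norm_def)

lemma closed_A: "closed A"
  by (simp add: analytic_crossed_product_def)

lemma monom_in_A: assumes f: "f \<in> C0" shows "monom n f \<in> A"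
proof -
  let ?F = "\<lambda>m. if m = n then f else (\<lambda>x. 0)"
  have "((\<lambda>m. monom m (?F m)) has_sum monom n f) {n}"
    using has_sum_finite[of "{n}" "\<lambda>m. monom m (?F m)"] by simp
  then have "((\<lambda>m. monom m (?F m)) has_sum monom n f) UNIV"
    by (rule has_sum_cong_neutral[THEN iffD1, rotated -1]) (auto simp: monom_zero)
  then have "crossed_rep \<rho> \<phi> ?F = monom n f"
    by (rule has_sum_unique[OF has_sum_crossed_rep[OF ell1_C0_single[OF f]]])
  then show ?thesis
    using subsetD[OF closure_subset imageI[OF ell1_C0_single[OF f, of n], of "crossed_rep \<rho> \<phi>"]]
    by (simp only: analytic_crossed_product_def)
qed

lemma complex_subspace_A: "complex_subspace A"
  unfolding analytic_crossed_product_def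
proof (rule complex_subspace_closure)
  show "complex_subspace (crossed_rep \<rho> \<phi> ` ell1_C0)"
    unfolding complex_subspace_def
  proof (intro conjI ballI allI)
    have "monom 0 (\<lambda>x. 0) = crossed_rep \<rho> \<phi> (\<lambda>m. if m = 0 then (\<lambda>x. 0) else (\<lambda>x. 0))"
      by (rule crossed_rep_eqI[OF ell1_C0_single[OF C0_zero], symmetric])
        (simp add: monom_zero o_def rho)
    then show "0 \<in> crossed_rep \<rho> \<phi> ` ell1_C0"
      using ell1_C0_single[OF C0_zero, of 0] unfolding monom_zero by blast
  next
    fix S T assume "S \<in> crossed_rep \<rho> \<phi> ` ell1_C0" "T \<in> crossed_rep \<rho> \<phi> ` ell1_C0"
    then obtain F G where F: "F \<in> ell1_C0" "S = crossed_rep \<rho> \<phi> F"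
      and G: "G \<in> ell1_C0" "T = crossed_rep \<rho> \<phi> G" by blast
    have FC: "F n \<in> C0" "G n \<in> C0" for n using F G by (auto simp: ell1_C0_def)
    have "crossed_rep \<rho> \<phi> (\<lambda>n x. F n x + G n x) = S + T"
    proof (rule crossed_rep_eqI[OF ell1_C0_add[OF F(1) G(1)]])
      fix \<xi> k
      from has_sum_add[OF crossed_rep_apply[OF F(1)] crossed_rep_apply[OF G(1)], of k \<xi> k \<xi>]
      show "((\<lambda>n. (\<rho> ((\<lambda>x. F n x + G n x) \<circ> \<phi> k) \<cdot> \<xi>) \<otimes>e (k + n)) has_sum (S + T) \<cdot> (\<xi> \<otimes>e k)) UNIV"
        by (simp add: F G bop_plus_apply tensor_add o_def rho C0_phi[OF FC(1)] C0_phi[OF FC(2)])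
    qed
    then show "S + T \<in> crossed_rep \<rho> \<phi> ` ell1_C0"
      using imageI[OF ell1_C0_add[OF F(1) G(1)], of "crossed_rep \<rho> \<phi>"] by (simp only:)
  next
    fix c S assume "S \<in> crossed_rep \<rho> \<phi> ` ell1_C0"
    then obtain F where F: "F \<in> ell1_C0" "S = crossed_rep \<rho> \<phi> F" by blast
    have FC: "F n \<in> C0" for n using F by (auto simp: ell1_C0_def)
    have "crossed_rep \<rho> \<phi> (\<lambda>n x. c * F n x) = c *\<^sub>C S"
    proof (rule crossed_rep_eqI[OF ell1_C0_scale[OF F(1)]])
      fix \<xi> k
      from has_sum_bounded_linear[OF bounded_linear_scaleC crossed_rep_apply[OF F(1)], of c k \<xi>]
      show "((\<lambda>n. (\<rho> ((\<lambda>x. c * F n x) \<circ> \<phi> k) \<cdot> \<xi>) \<otimes>e (k + n)) has_sum (c *\<^sub>C S) \<cdot> (\<xi> \<otimes>e k)) UNIV"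
        by (simp add: F bop_scaleC_apply tensor_scaleC o_def rho C0_phi[OF FC])
    qed
    then show "c *\<^sub>C S \<in> crossed_rep \<rho> \<phi> ` ell1_C0"
      using imageI[OF ell1_C0_scale[OF F(1), of c], of "crossed_rep \<rho> \<phi>"] by (simp only:)
  qed
qed

text \<open>Serves as the induction rule for \<open>A\<close>: an absolutely summable family gives a
  norm convergent series of monomials, so the closed subspace spanned by the monomials is
  everything.\<close>

lemma A_subset:
  assumes cl: "closed S" and S: "complex_subspace S"
    and mon: "\<And>n f. f \<in> C0 \<Longrightarrow> monom n f \<in> S"
  shows "A \<subseteq> S"
  unfolding analytic_crossed_product_def
proof (rule closure_minimal[OF _ cl], rule image_subsetI)
  fix F :: "nat ^ 'd \<Rightarrow> 'x \<Rightarrow> complex" assume F: "F \<in> ell1_C0"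
  have fin: "(\<Sum>n\<in>I. monom n (F n)) \<in> S" for I
    by (induction I rule: infinite_finite_induct)
      (use S mon F in \<open>auto simp: complex_subspace_def ell1_C0_def\<close>)
  show "crossed_rep \<rho> \<phi> F \<in> S"
    using has_sum_crossed_rep[OF F] unfolding has_sum_def
    by (rule Lim_in_closed_set[OF cl always_eventually[OF allI[OF fin]], rotated]) simp
qed

lemma A_mult:
  assumes "a \<in> A" "b \<in> A"
  shows "a * b \<in> A"
proof -
  have sub: "complex_subspace {T. a * T \<in> A}" "complex_subspace {T. T * a \<in> A}" for a
    using complex_subspace_A
    by (auto simp: complex_subspace_def distrib_left distrib_right mult_scaleC_left mult_scaleC_right)
  have cl: "closed {T. a * T \<in> A}" "closed {T. T * a \<in> A}" for a
    by (intro closed_vimage[OF closed_A, unfolded vimage_def] continuous_intros)+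
  \<comment> \<open>The closure under products is extended from monomials one factor at a time:
    first the left factor varies against a fixed monomial, then the right one.\<close>
  have "A \<subseteq> {T. T * monom n f \<in> A}" if f: "f \<in> C0" for n f
    by (rule A_subset[OF cl(2) sub(2)])
      (auto simp: monom_mult f intro!: monom_in_A C0_mult C0_phi f)
  then have "monom n f \<in> {T. a * T \<in> A}" if "f \<in> C0" for n f using assms(1) that by blast
  then have "A \<subseteq> {T. a * T \<in> A}" by (rule A_subset[OF cl(1) sub(1)])
  then show ?thesis using assms(2) by blast
qed

lemma complex_subalgebra_A: "complex_subalgebra A"
  by (simp add: complex_subalgebra_def complex_subspace_A A_mult)

text \<open>The block matrix of \<open>T\<close>: its entry in row \<open>m\<close> and column
  \<open>k\<close> depends on the difference \<open>m - k\<close>, up to composition with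
  \<open>\<phi> k\<close>. Unlike an expansion into a series, this description survives norm
  limits.\<close>

definition has_coeffs :: "(nat ^ 'd, 'h) ell2 bop \<Rightarrow> (nat ^ 'd \<Rightarrow> 'x \<Rightarrow> complex) \<Rightarrow> bool" where
  "has_coeffs T F \<longleftrightarrow> (\<forall>n. F n \<in> C0) \<and>
     (\<forall>\<xi> k m. ell2_nth (T \<cdot> (\<xi> \<otimes>e k)) m =
       (if k \<le> m then \<rho> (\<lambda>x. F (m - k) (\<phi> k x)) \<cdot> \<xi> else 0))"

lemma has_coeffs_monom:
  assumes f: "f \<in> C0"
  shows "has_coeffs (monom n f) (\<lambda>m. if m = n then f else (\<lambda>x. 0))"
proof -
  have "ell2_nth (monom n f \<cdot> (\<xi> \<otimes>e k)) m =
      (if k \<le> m then \<rho> (\<lambda>x. (if m - k = n then f else (\<lambda>x. 0)) (\<phi> k x)) \<cdot> \<xi> else 0)" for \<xi> k m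
  proof (cases "k \<le> m")
    case True
    then have "m = k + n \<longleftrightarrow> m - k = n" using nat_vec_diff_add nat_vec_add_diff by metis
    then show ?thesis using True by (simp add: monom_apply[OF f] ell2_nth_tensor rho)
  next
    case False
    then have "m \<noteq> k + n" using nat_vec_le_add by metis
    then show ?thesis using False by (simp add: monom_apply[OF f] ell2_nth_tensor)
  qed
  then show ?thesis using f C0_zero by (auto simp: has_coeffs_def)
qed

lemma has_coeffs_add:
  "has_coeffs S F \<Longrightarrow> has_coeffs T G \<Longrightarrow> has_coeffs (S + T) (\<lambda>n x. F n x + G n x)"
  by (auto simp: has_coeffs_def C0_add C0_phi bop_plus_apply ell2_nth_plus rho)

lemma has_coeffs_scaleC:
  "has_coeffs S F \<Longrightarrow> has_coeffs (c *\<^sub>C S) (\<lambda>n x. c * F n x)"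
  by (auto simp: has_coeffs_def C0_scale C0_phi bop_scaleC_apply ell2_nth_scaleC rho)

lemma has_coeffs_zero_zero: "has_coeffs 0 (\<lambda>n x. 0)"
  by (auto simp: has_coeffs_def C0_zero rho)

lemma has_coeffs_diff:
  "has_coeffs S F \<Longrightarrow> has_coeffs T G \<Longrightarrow> has_coeffs (S - T) (\<lambda>n x. F n x - G n x)"
  by (auto simp: has_coeffs_def C0_diff C0_phi bop_minus_apply ell2_nth_diff rho)

text \<open>Column \<open>0\<close> carries the coefficients untwisted, because
  \<open>\<phi> 0\<close> is the identity, and an entry is bounded by the operator norm. The
  pointwise bound is then \<open>cmod_le_norm_star_rep\<close>.\<close>

lemma has_coeffs_bound:
  assumes "has_coeffs T F"
  shows "norm (\<rho> (F n)) \<le> norm T" "cmod (F n x) \<le> norm T"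
proof -
  show *: "norm (\<rho> (F n)) \<le> norm T"
  proof (rule norm_bop_le)
    fix \<xi>
    have "0 \<le> n" by (simp add: less_eq_vec_def)
    then have "ell2_nth (T \<cdot> (\<xi> \<otimes>e 0)) n = \<rho> (F n) \<cdot> \<xi>"
      using assms unfolding has_coeffs_def by (simp add: phi_zero)
    then show "norm (\<rho> (F n) \<cdot> \<xi>) \<le> norm T * norm \<xi>"
      using norm_bop_entry[of T \<xi> 0 n] by simp
  qed simp
  then show "cmod (F n x) \<le> norm T"
    using cmod_le_norm_star_rep[OF rep, of "F n" x] assms by (simp add: has_coeffs_def)
qed

text \<open>By \<open>has_coeffs_bound\<close> the coefficients at each index are Cauchy in operator
  norm, so they converge uniformly to a function in \<open>C0\<close>; composition with
  \<open>\<phi> k\<close> does not increase the distance, hence all matrix entries converge as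
  well.\<close>

lemma has_coeffs_limit:
  assumes T: "\<And>j. has_coeffs (T j) (F j)" and lim: "T \<longlonglongrightarrow> L"
  shows "\<exists>G. has_coeffs L G"
proof -
  have FC: "F j n \<in> C0" for j n using T by (simp add: has_coeffs_def)
  have "Cauchy (\<lambda>j. \<rho> (F j n))" for n
  proof (rule CauchyI)
    fix e :: real assume "e > 0"
    then obtain M where M: "\<And>i j. i \<ge> M \<Longrightarrow> j \<ge> M \<Longrightarrow> norm (T i - T j) < e"
      using CauchyD[OF LIMSEQ_imp_Cauchy[OF lim]] by blast
    have "norm (\<rho> (F i n) - \<rho> (F j n)) \<le> norm (T i - T j)" for i j
      using has_coeffs_bound(1)[OF has_coeffs_diff[OF T[of i] T[of j]], of n] by (simp add: rho FC)
    then show "\<exists>M. \<forall>i\<ge>M. \<forall>j\<ge>M. norm (\<rho> (F i n) - \<rho> (F j n)) < e"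
      using M by (meson order_le_less_trans)
  qed
  then have "\<exists>G\<in>C0. (\<lambda>j. sup_norm (\<lambda>x. F j n x - G x)) \<longlonglongrightarrow> 0" for n
    using star_rep_complete[OF rep, of "\<lambda>j. F j n"] FC by metis
  then obtain G where G: "\<And>n. G n \<in> C0" "\<And>n. (\<lambda>j. sup_norm (\<lambda>x. F j n x - G n x)) \<longlonglongrightarrow> 0"
    by metis
  have "has_coeffs L G"
    unfolding has_coeffs_def
  proof (intro conjI allI G(1))
    fix \<xi> k m
    have l: "(\<lambda>j. ell2_nth (T j \<cdot> (\<xi> \<otimes>e k)) m) \<longlonglongrightarrow> ell2_nth (L \<cdot> (\<xi> \<otimes>e k)) m"
      by (rule bounded_linear.tendsto[OF bounded_linear_bop_entry lim])
    show "ell2_nth (L \<cdot> (\<xi> \<otimes>e k)) m = (if k \<le> m then \<rho> (\<lambda>x. G (m - k) (\<phi> k x)) \<cdot> \<xi> else 0)"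
    proof (cases "k \<le> m")
      case False
      then have "(\<lambda>j. ell2_nth (T j \<cdot> (\<xi> \<otimes>e k)) m) = (\<lambda>j. 0)"
        using T by (auto simp: has_coeffs_def)
      then show ?thesis using l False by (simp add: LIMSEQ_const_iff)
    next
      case True
      let ?n = "m - k"
      have "(\<lambda>j. \<rho> (\<lambda>x. F j ?n (\<phi> k x)) \<cdot> \<xi> - \<rho> (\<lambda>x. G ?n (\<phi> k x)) \<cdot> \<xi>) \<longlonglongrightarrow> 0"
      proof (rule Lim_null_comparison[OF always_eventually])
        show "(\<lambda>j. sup_norm (\<lambda>x. F j ?n x - G ?n x) * norm \<xi>) \<longlonglongrightarrow> 0"
          using tendsto_mult_right[OF G(2)[of ?n], of "norm \<xi>"] by simp
        show "\<forall>j. norm (\<rho> (\<lambda>x. F j ?n (\<phi> k x)) \<cdot> \<xi> - \<rho> (\<lambda>x. G ?n (\<phi> k x)) \<cdot> \<xi>)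
            \<le> sup_norm (\<lambda>x. F j ?n x - G ?n x) * norm \<xi>"
        proof
          fix j
          have C: "(\<lambda>x. F j ?n x - G ?n x) \<in> C0" by (intro C0_diff FC G)
          have "norm (\<rho> (\<lambda>x. F j ?n (\<phi> k x) - G ?n (\<phi> k x)) \<cdot> \<xi>)
              \<le> sup_norm (\<lambda>x. F j ?n (\<phi> k x) - G ?n (\<phi> k x)) * norm \<xi>"
            by (rule star_rep_contractive[OF rep C0_phi[OF C]])
          also have "\<dots> \<le> sup_norm (\<lambda>x. F j ?n x - G ?n x) * norm \<xi>"
            by (intro mult_right_mono sup_norm_phi_le[OF C]) simp
          finally show "norm (\<rho> (\<lambda>x. F j ?n (\<phi> k x)) \<cdot> \<xi> - \<rho> (\<lambda>x. G ?n (\<phi> k x)) \<cdot> \<xi>)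
            \<le> sup_norm (\<lambda>x. F j ?n x - G ?n x) * norm \<xi>"
            by (simp add: rho C0_phi[OF FC] C0_phi[OF G(1)] bop_minus_apply)
        qed
      qed
      then have "(\<lambda>j. \<rho> (\<lambda>x. F j ?n (\<phi> k x)) \<cdot> \<xi>) \<longlonglongrightarrow> \<rho> (\<lambda>x. G ?n (\<phi> k x)) \<cdot> \<xi>"
        by (simp add: LIM_zero_iff)
      moreover have "(\<lambda>j. ell2_nth (T j \<cdot> (\<xi> \<otimes>e k)) m) = (\<lambda>j. \<rho> (\<lambda>x. F j ?n (\<phi> k x)) \<cdot> \<xi>)"
        using T True by (auto simp: has_coeffs_def)
      ultimately show ?thesis using l True LIMSEQ_unique by auto
    qed
  qed
  then show ?thesis by blast
qed

lemma has_coeffs_exists: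
  assumes "T \<in> A"
  shows "\<exists>F. has_coeffs T F"
proof -
  have "A \<subseteq> {T. \<exists>F. has_coeffs T F}"
  proof (rule A_subset)
    show "closed {T. \<exists>F. has_coeffs T F}"
      unfolding closed_sequential_limits
    proof (intro allI impI, elim conjE)
      fix X l assume "\<forall>n. X n \<in> {T. \<exists>F. has_coeffs T F}" "X \<longlonglongrightarrow> l"
      then obtain F where "\<And>n. has_coeffs (X n) (F n)" by (auto simp: choice_iff)
      then show "l \<in> {T. \<exists>F. has_coeffs T F}" using has_coeffs_limit \<open>X \<longlonglongrightarrow> l\<close> by blast
    qed
    show "complex_subspace {T. \<exists>F. has_coeffs T F}"
      unfolding complex_subspace_def
      using has_coeffs_zero_zero has_coeffs_add has_coeffs_scaleC by blast
  qed (use has_coeffs_monom in blast)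
  then show ?thesis using assms by blast
qed

definition coeff :: "(nat ^ 'd, 'h) ell2 bop \<Rightarrow> nat ^ 'd \<Rightarrow> 'x \<Rightarrow> complex" where
  "coeff T = (SOME F. has_coeffs T F)"

lemma has_coeffs_coeff: "T \<in> A \<Longrightarrow> has_coeffs T (coeff T)"
  unfolding coeff_def using has_coeffs_exists by (rule someI_ex)

lemma has_coeffs_unique:
  assumes "has_coeffs T F" "has_coeffs T G"
  shows "F = G"
proof (intro ext)
  fix n x
  have "cmod (F n x - G n x) \<le> 0"
    using has_coeffs_bound(2)[OF has_coeffs_diff[OF assms], of n x] by simp
  then show "F n x = G n x" by simp
qed

lemma coeff_eq: "has_coeffs T F \<Longrightarrow> coeff T = F"
  by (metis coeff_def has_coeffs_unique someI)

lemma coeff_in_C0: "T \<in> A \<Longrightarrow> coeff T n \<in> C0"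
  using has_coeffs_coeff by (auto simp: has_coeffs_def)

lemma coeff_bound: "T \<in> A \<Longrightarrow> cmod (coeff T n x) \<le> norm T"
  using has_coeffs_coeff by (rule has_coeffs_bound)

lemma sup_norm_coeff_le: "T \<in> A \<Longrightarrow> sup_norm (coeff T n) \<le> norm T"
  by (intro sup_norm_le coeff_bound)

lemma coeff_add: "S \<in> A \<Longrightarrow> T \<in> A \<Longrightarrow> coeff (S + T) n x = coeff S n x + coeff T n x"
  by (simp add: coeff_eq[OF has_coeffs_add[OF has_coeffs_coeff has_coeffs_coeff]])

lemma coeff_diff: "S \<in> A \<Longrightarrow> T \<in> A \<Longrightarrow> coeff (S - T) n x = coeff S n x - coeff T n x"
  by (simp add: coeff_eq[OF has_coeffs_diff[OF has_coeffs_coeff has_coeffs_coeff]])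

lemma coeff_scaleC: "T \<in> A \<Longrightarrow> coeff (c *\<^sub>C T) n x = c * coeff T n x"
  by (simp add: coeff_eq[OF has_coeffs_scaleC[OF has_coeffs_coeff]])

lemma coeff_zero: "coeff 0 n x = 0"
  by (simp add: coeff_eq[OF has_coeffs_zero_zero])

lemma coeff_monom: "f \<in> C0 \<Longrightarrow> coeff (monom n f) m x = (if m = n then f x else 0)"
  by (simp add: coeff_eq[OF has_coeffs_monom])

text \<open>Column \<open>0\<close> determines the coefficients, and there the right factor shifts
  the basis vector to index \<open>q\<close>, so only column \<open>q\<close> of \<open>T\<close>
  matters.\<close>

lemma coeff_mult_monom:
  assumes T: "T \<in> A" and h: "h \<in> C0"
  shows "coeff (T * monom q h) m x = (if q \<le> m then coeff T (m - q) (\<phi> q x) * h x else 0)"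
proof -
  let ?f = "if q \<le> m then (\<lambda>x. coeff T (m - q) (\<phi> q x) * h x) else (\<lambda>x. 0)"
  have TM: "T * monom q h \<in> A" using T h by (intro A_mult monom_in_A)
  have C: "coeff T n \<in> C0" for n using T by (rule coeff_in_C0)
  have le0: "0 \<le> m" by (simp add: less_eq_vec_def)
  have "\<rho> (coeff (T * monom q h) m) \<cdot> \<xi> = \<rho> ?f \<cdot> \<xi>" for \<xi>
  proof -
    have "\<rho> (coeff (T * monom q h) m) \<cdot> \<xi> = ell2_nth ((T * monom q h) \<cdot> (\<xi> \<otimes>e 0)) m"
      using has_coeffs_coeff[OF TM] le0 by (auto simp: has_coeffs_def phi_zero)
    also have "\<dots> = ell2_nth (T \<cdot> ((\<rho> h \<cdot> \<xi>) \<otimes>e q)) m"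
      by (simp add: bop_times_apply monom_apply[OF h] phi_zero)
    also have "\<dots> = (if q \<le> m then \<rho> (\<lambda>x. coeff T (m - q) (\<phi> q x)) \<cdot> (\<rho> h \<cdot> \<xi>) else 0)"
      using has_coeffs_coeff[OF T] by (simp add: has_coeffs_def)
    also have "\<dots> = \<rho> ?f \<cdot> \<xi>"
      by (simp add: rho C0_phi[OF C] h bop_times_apply)
    finally show ?thesis .
  qed
  then have "\<rho> (coeff (T * monom q h) m) = \<rho> ?f" by (rule bop_eqI)
  moreover have "?f \<in> C0" by (auto intro!: C0_mult C0_phi[OF C] h C0_zero)
  ultimately have "coeff (T * monom q h) m = ?f"
    using rho(6)[OF coeff_in_C0[OF TM]] by blast
  then show ?thesis by auto
qed

lemma eq_0_if_coeff_0:
  assumes T: "T \<in> A" and "\<And>n x. coeff T n x = 0"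
  shows "T = 0"
proof (rule bop_eq_tensorI, subst ell2_nth_inject[symmetric], rule ext)
  fix \<xi> k m
  have "coeff T n = (\<lambda>x. 0)" for n using assms(2) by auto
  then show "ell2_nth (T \<cdot> (\<xi> \<otimes>e k)) m = ell2_nth (0 \<cdot> (\<xi> \<otimes>e k)) m"
    using has_coeffs_coeff[OF T] by (auto simp: has_coeffs_def rho)
qed

end

section \<open>The gauge action\<close>

definition character :: "('d::finite \<Rightarrow> real) \<Rightarrow> nat ^ 'd \<Rightarrow> complex" where
  "character \<theta> k = cis (\<Sum>j\<in>UNIV. \<theta> j * real (k $ j))"

lemma character_add: "character \<theta> (k + n) = character \<theta> k * character \<theta> n"
  by (simp add: character_def cis_mult distrib_left sum.distrib)

lemma norm_character [simp]: "cmod (character \<theta> k) = 1"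
  by (simp add: character_def)

lemma character_uminus: "character (\<lambda>j. - \<theta> j) k = cnj (character \<theta> k)"
  by (simp add: character_def cis_cnj sum_negf)

lemma character_mult_cnj [simp]: "character \<theta> k * cnj (character \<theta> k) = 1"
  by (simp add: complex_norm_square[symmetric])

lemma character_unitary_exists:
  "\<exists>W :: (nat ^ 'd::finite, 'h::complex_inner) ell2 bop.
     \<forall>x. W \<cdot> x = Abs_ell2 (\<lambda>i. character \<theta> i *\<^sub>C ell2_nth x i)"
proof (rule bop_exI)
  let ?f = "\<lambda>(x :: (nat ^ 'd, 'h) ell2) i. character \<theta> i *\<^sub>C ell2_nth x i"
  have b: "(\<Sum>i\<in>S. (norm (?f x i))\<^sup>2) \<le> (norm x)\<^sup>2" if "finite S" for x S
    using sum_norm_sq_le_ell2[OF that, of x] by (simp add: norm_scaleC)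
  have nth: "ell2_nth (Abs_ell2 (?f x)) = ?f x" for x
    using bounded_sums_ell2(1)[OF b] by (simp add: Abs_ell2_inverse)
  show "Abs_ell2 (?f (x + y)) = Abs_ell2 (?f x) + Abs_ell2 (?f y)" for x y
    by (subst ell2_nth_inject[symmetric], rule ext)
      (subst nth, simp add: nth ell2_nth_plus scaleC_add_right)
  show "Abs_ell2 (?f (c *\<^sub>C x)) = c *\<^sub>C Abs_ell2 (?f x)" for c x
    by (subst ell2_nth_inject[symmetric], rule ext)
      (subst nth, simp add: nth ell2_nth_scaleC scaleC_scaleC mult.commute)
  show "norm (Abs_ell2 (?f x)) \<le> norm x * 1" for x
    using bounded_sums_ell2(2)[OF b] by simp
qed

definition character_unitary :: "('d::finite \<Rightarrow> real) \<Rightarrow> (nat ^ 'd, 'h::complex_inner) ell2 bop" where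
  "character_unitary \<theta> = (SOME W. \<forall>x. W \<cdot> x = Abs_ell2 (\<lambda>i. character \<theta> i *\<^sub>C ell2_nth x i))"

lemma
  fixes x :: "(nat ^ 'd::finite, 'h::complex_inner) ell2"
  shows ell2_nth_character_unitary:
      "ell2_nth (character_unitary \<theta> \<cdot> x) i = character \<theta> i *\<^sub>C ell2_nth x i"
    and norm_character_unitary_apply: "norm (character_unitary \<theta> \<cdot> x) \<le> norm x"
proof -
  have b: "(\<Sum>i\<in>S. (norm (character \<theta> i *\<^sub>C ell2_nth x i))\<^sup>2) \<le> (norm x)\<^sup>2" if "finite S" for S
    using sum_norm_sq_le_ell2[OF that, of x] by (simp add: norm_scaleC)
  have W: "character_unitary \<theta> \<cdot> x = Abs_ell2 (\<lambda>i. character \<theta> i *\<^sub>C ell2_nth x i)"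
    using someI_ex[OF character_unitary_exists[of \<theta>]] unfolding character_unitary_def by blast
  show "ell2_nth (character_unitary \<theta> \<cdot> x) i = character \<theta> i *\<^sub>C ell2_nth x i"
    unfolding W using bounded_sums_ell2(1)[OF b] by (simp add: Abs_ell2_inverse)
  show "norm (character_unitary \<theta> \<cdot> x) \<le> norm x"
    unfolding W using bounded_sums_ell2(2)[OF b] by simp
qed

lemma character_unitary_tensor:
  "character_unitary \<theta> \<cdot> (\<xi> \<otimes>e k) = (character \<theta> k *\<^sub>C \<xi>) \<otimes>e k"
  by (subst ell2_nth_inject[symmetric], rule ext)
    (simp add: ell2_nth_character_unitary ell2_nth_tensor)

lemma character_unitary_inverse:
  "character_unitary (\<lambda>j. - \<theta> j) \<cdot> (character_unitary \<theta> \<cdot> x) = x"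
  by (subst ell2_nth_inject[symmetric], rule ext)
    (simp add: ell2_nth_character_unitary character_uminus scaleC_scaleC mult.commute)

lemma character_unitary_inverse':
  "character_unitary \<theta> \<cdot> (character_unitary (\<lambda>j. - \<theta> j) \<cdot> x) = x"
  using character_unitary_inverse[of "\<lambda>j. - \<theta> j"] by simp

text \<open>The dual action of the torus: conjugation multiplies the matrix entry in row
  \<open>m\<close> and column \<open>k\<close> by the quotient of the characters at \<open>m\<close>
  and \<open>k\<close>, hence scales a monomial of degree \<open>n\<close> by
  \<open>character \<theta> n\<close>.\<close>

definition gauge :: "('d::finite \<Rightarrow> real) \<Rightarrow> (nat ^ 'd, 'h::complex_inner) ell2 bop \<Rightarrow> (nat ^ 'd, 'h) ell2 bop"
  where "gauge \<theta> T = character_unitary \<theta> * T * character_unitary (\<lambda>j. - \<theta> j)"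

lemma gauge_add: "gauge \<theta> (S + T) = gauge \<theta> S + gauge \<theta> T"
  and gauge_diff: "gauge \<theta> (S - T) = gauge \<theta> S - gauge \<theta> T"
  and gauge_scaleC: "gauge \<theta> (c *\<^sub>C T) = c *\<^sub>C gauge \<theta> T"
  and gauge_zero: "gauge \<theta> 0 = 0"
  by (simp_all add: gauge_def algebra_simps mult_scaleC_left mult_scaleC_right)

lemma gauge_mult: "gauge \<theta> (S * T) = gauge \<theta> S * gauge \<theta> T"
  by (rule bop_eqI) (simp add: gauge_def bop_times_apply character_unitary_inverse)

lemma gauge_inverse: "gauge \<theta> (gauge (\<lambda>j. - \<theta> j) T) = T"
  by (rule bop_eqI) (simp add: gauge_def bop_times_apply character_unitary_inverse')

lemma norm_gauge: "norm (gauge \<theta> T) \<le> norm T"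
proof (rule norm_bop_le)
  fix x
  have "norm (gauge \<theta> T \<cdot> x) \<le> norm (T \<cdot> (character_unitary (\<lambda>j. - \<theta> j) \<cdot> x))"
    by (simp add: gauge_def bop_times_apply norm_character_unitary_apply)
  also have "\<dots> \<le> norm T * norm (character_unitary (\<lambda>j. - \<theta> j) \<cdot> x)"
    by (rule norm_bop_apply)
  also have "\<dots> \<le> norm T * norm x"
    by (intro mult_left_mono norm_character_unitary_apply) simp
  finally show "norm (gauge \<theta> T \<cdot> x) \<le> norm T * norm x" .
qed simp

lemma continuous_gauge: "continuous_on UNIV (gauge \<theta>)"
  unfolding gauge_def by (intro continuous_intros)

section \<open>Averages over roots of unity\<close>

definition root_angles :: "nat \<Rightarrow> ('d \<Rightarrow> nat) \<Rightarrow> 'd \<Rightarrow> real" where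
  "root_angles N t j = 2 * pi * real (t j) / real N"

abbreviation root_indices :: "nat \<Rightarrow> ('d \<Rightarrow> nat) set" where
  "root_indices N \<equiv> PiE UNIV (\<lambda>_. {..<N})"

lemma card_root_indices: "card (root_indices N :: ('d::finite \<Rightarrow> nat) set) = N ^ CARD('d)"
  by (simp add: card_PiE)

text \<open>The average keeps exactly the Fourier coefficients at indices congruent to \<open>n\<close> modulo \<open>N\<close>.\<close>

definition spectral_average ::
    "nat \<Rightarrow> nat ^ 'd::finite \<Rightarrow> (nat ^ 'd, 'h::complex_inner) ell2 bop \<Rightarrow> (nat ^ 'd, 'h) ell2 bop" where
  "spectral_average N n T = (1 / of_nat (N ^ CARD('d))) *\<^sub>C
     (\<Sum>t\<in>root_indices N. cnj (character (root_angles N t) n) *\<^sub>C gauge (root_angles N t) T)"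

lemma spectral_average_add:
    "spectral_average N n (S + T) = spectral_average N n S + spectral_average N n T"
  and spectral_average_scaleC:
    "spectral_average N n (c *\<^sub>C T) = c *\<^sub>C spectral_average N n T"
  by (simp_all add: spectral_average_def gauge_add gauge_diff gauge_scaleC scaleC_add_right
      cvec.scale_right_diff_distrib sum.distrib sum_subtractf cvec.scale_sum_right scaleC_scaleC mult.left_commute
      mult.commute)

lemma norm_spectral_average:
  fixes T :: "(nat ^ 'd::finite, 'h::complex_inner) ell2 bop"
  assumes "N > 0"
  shows "norm (spectral_average N n T) \<le> norm T"
proof -
  have "norm (cnj (character (root_angles N t) n) *\<^sub>C gauge (root_angles N t) T) \<le> norm T" for t
    using norm_scaleC_bop[of "cnj (character (root_angles N t) n)" "gauge (root_angles N t) T"]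
      norm_gauge[of "root_angles N t" T] by simp
  then have "norm (\<Sum>t\<in>root_indices N. cnj (character (root_angles N t) n) *\<^sub>C gauge (root_angles N t) T)
      \<le> of_nat (card (root_indices N :: ('d \<Rightarrow> nat) set)) * norm T"
    by (intro sum_norm_bound)
  then have "norm (spectral_average N n T)
      \<le> cmod (1 / of_nat (N ^ CARD('d))) * (of_nat (N ^ CARD('d)) * norm T)"
    unfolding spectral_average_def card_root_indices
    by (intro order_trans[OF norm_scaleC_bop] mult_left_mono) auto
  also have "\<dots> = norm T" using assms by (simp add: norm_divide norm_power)
  finally show ?thesis .
qed

text \<open>The sum factors into one geometric sum per coordinate. In a coordinate where
  \<open>m\<close> and \<open>n\<close> differ, the ratio is an \<open>N\<close>-th root of unity,
  and it is not 1 because the difference of the entries is smaller than \<open>N\<close> in absolute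
  value.\<close>

lemma character_sum_orthogonal:
  fixes m n :: "nat ^ 'd::finite"
  assumes mn: "m \<noteq> n" and N: "\<And>j. m $ j < N" "\<And>j. n $ j < N"
  shows "(\<Sum>t\<in>root_indices N. cnj (character (root_angles N t) n) * character (root_angles N t) m) = 0"
proof -
  define z where "z j = cis (2 * pi * (real (m $ j) - real (n $ j)) / real N)" for j
  obtain i where i: "m $ i \<noteq> n $ i" using mn by (auto simp: vec_eq_iff)
  have N0: "N > 0" using N(1)[of i] by simp
  have "cnj (character (root_angles N t) n) * character (root_angles N t) m = (\<Prod>j\<in>UNIV. z j ^ t j)" for t
  proof -
    have "cnj (character (root_angles N t) n) * character (root_angles N t) m
        = cis (\<Sum>j\<in>UNIV. real (t j) * (2 * pi * (real (m $ j) - real (n $ j)) / real N))"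
      by (simp add: character_def cis_cnj cis_mult root_angles_def sum_negf[symmetric]
          sum.distrib[symmetric] algebra_simps diff_divide_distrib)
    also have "\<dots> = (\<Prod>j\<in>UNIV. cis (real (t j) * (2 * pi * (real (m $ j) - real (n $ j)) / real N)))"
      by (simp only: cis_conv_exp of_real_sum sum_distrib_left exp_sum[OF finite])
    also have "\<dots> = (\<Prod>j\<in>UNIV. z j ^ t j)"
      by (simp only: z_def Complex.DeMoivre)
    finally show ?thesis .
  qed
  then have "(\<Sum>t\<in>root_indices N. cnj (character (root_angles N t) n) * character (root_angles N t) m)
      = (\<Prod>j\<in>UNIV. \<Sum>s<N. z j ^ s)"
    by (simp add: prod_sum_PiE)
  also have "(\<Sum>s<N. z i ^ s) = 0"
  proof -
    have "z i \<noteq> 1"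
    proof
      assume "z i = 1"
      then have "cos (2 * pi * (real (m $ i) - real (n $ i)) / real N) = 1"
        by (simp add: z_def complex_eq_iff)
      then obtain k :: int where "2 * pi * (real (m $ i) - real (n $ i)) / real N = of_int k * 2 * pi"
        by (auto simp: cos_one_2pi_int)
      then have "(2 * pi) * (real (m $ i) - real (n $ i)) = (2 * pi) * (of_int k * real N)"
        using N0 by (simp add: field_simps)
      then have "real (m $ i) - real (n $ i) = of_int k * real N"
        by (metis mult_cancel_left pi_neq_zero mult_eq_0_iff zero_neq_numeral)
      then have "int (m $ i) - int (n $ i) = k * int N"
        by (metis (mono_tags, lifting) of_int_diff of_int_eq_iff of_int_mult of_int_of_nat_eq)
      then have "int N dvd int (m $ i) - int (n $ i)" by simp
      then have "int N \<le> \<bar>int (m $ i) - int (n $ i)\<bar>"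
        using i by (intro zdvd_imp_le) auto
      then show False using N(1)[of i] N(2)[of i] by linarith
    qed
    moreover have "z i ^ N = 1"
    proof -
      have "z i ^ N = cis (2 * pi * of_int (int (m $ i) - int (n $ i)))"
        using N0 by (simp add: z_def Complex.DeMoivre)
      then show ?thesis using cis_multiple_2pi[of "of_int (int (m $ i) - int (n $ i))"] by (simp del: of_int_diff)
    qed
    ultimately show ?thesis by (simp add: geometric_sum)
  qed
  then have "(\<Prod>j\<in>UNIV. \<Sum>s<N. z j ^ s) = 0" by (intro prod_zero) auto
  finally show ?thesis .
qed

context crossed_product
begin

lemma gauge_monom:
  assumes f: "f \<in> C0"
  shows "gauge \<theta> (monom n f) = character \<theta> n *\<^sub>C monom n f"
proof (rule bop_eq_tensorI)
  fix \<xi> k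
  have "character \<theta> (k + n) * cnj (character \<theta> k) = character \<theta> n"
    by (simp add: character_add algebra_simps)
  then show "gauge \<theta> (monom n f) \<cdot> (\<xi> \<otimes>e k) = (character \<theta> n *\<^sub>C monom n f) \<cdot> (\<xi> \<otimes>e k)"
    by (simp add: gauge_def bop_times_apply character_unitary_tensor monom_apply[OF f]
        bop_scaleC_apply bop_apply_scaleC scaleC_scaleC tensor_scaleC character_uminus)
qed

lemma gauge_in_A: "T \<in> A \<Longrightarrow> gauge \<theta> T \<in> A"
proof -
  have "A \<subseteq> {T. gauge \<theta> T \<in> A}"
  proof (rule A_subset)
    show "closed {T. gauge \<theta> T \<in> A}"
      by (rule closed_vimage[OF closed_A continuous_gauge, unfolded vimage_def])
    show "complex_subspace {T. gauge \<theta> T \<in> A}"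
      using complex_subspace_A by (auto simp: complex_subspace_def gauge_add gauge_scaleC gauge_zero)
    show "monom n f \<in> {T. gauge \<theta> T \<in> A}" if "f \<in> C0" for n f
      using complex_subspace_A monom_in_A[OF that] by (simp add: gauge_monom that complex_subspace_def)
  qed
  then show "T \<in> A \<Longrightarrow> gauge \<theta> T \<in> A" by blast
qed

text \<open>\<open>gauge \<theta>\<close> is an automorphism of \<open>A\<close>, so the multiplier
  \<open>a\<close> is pulled back by the inverse action and the resulting quasi-inverse is pushed
  forward.\<close>

lemma gauge_quasi_regular_ideal:
  assumes T: "T \<in> quasi_regular_ideal A"
  shows "gauge \<theta> T \<in> quasi_regular_ideal A"
proof -
  have TA: "T \<in> A" using T by (simp add: quasi_regular_ideal_def)
  have "left_quasi_regular A (a * gauge \<theta> T)" if a: "a \<in> A" for a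
  proof -
    let ?a = "gauge (\<lambda>j. - \<theta> j) a"
    obtain b where b: "b \<in> A" "b + ?a * T - b * (?a * T) = 0"
      using T gauge_in_A[OF a] unfolding quasi_regular_ideal_def left_quasi_regular_def by blast
    have "gauge \<theta> (b + ?a * T - b * (?a * T)) = 0"
      unfolding b(2) by (rule gauge_zero)
    then have "gauge \<theta> b + a * gauge \<theta> T - gauge \<theta> b * (a * gauge \<theta> T) = 0"
      by (simp add: gauge_add gauge_diff gauge_mult gauge_inverse)
    then show ?thesis using gauge_in_A[OF b(1)] unfolding left_quasi_regular_def by blast
  qed
  then show ?thesis using gauge_in_A[OF TA] by (simp add: quasi_regular_ideal_def)
qed

lemma spectral_average_quasi_regular_ideal:
  assumes "T \<in> quasi_regular_ideal A"
  shows "spectral_average N n T \<in> quasi_regular_ideal A"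
  unfolding spectral_average_def
  by (intro quasi_regular_ideal_sum quasi_regular_ideal_scaleC complex_subalgebra_A
      gauge_quasi_regular_ideal assms)

lemma spectral_average_monom:
  assumes f: "f \<in> C0" and N: "\<And>j. m $ j < N" "\<And>j. n $ j < N"
  shows "spectral_average N n (monom m f) = (if m = n then monom m f else 0)"
proof -
  have N0: "N > 0" using N(1)[of undefined] by simp
  have "spectral_average N n (monom m f) = ((1 / of_nat (N ^ CARD('d))) *
      (\<Sum>t\<in>root_indices N. cnj (character (root_angles N t) n) * character (root_angles N t) m))
      *\<^sub>C monom m f"
    by (simp add: spectral_average_def gauge_monom[OF f] scaleC_scaleC cvec.scale_sum_left[symmetric])
  also have "(1 / of_nat (N ^ CARD('d))) *
      (\<Sum>t\<in>root_indices N. cnj (character (root_angles N t) n) * character (root_angles N t) m)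
      = (if m = n then 1 else 0)"
    using character_sum_orthogonal[OF _ N] N0 card_root_indices[where 'd = 'd, of N]
    by (auto simp: mult.commute[of "cnj _"])
  finally show ?thesis by simp
qed

text \<open>A density argument: the error \<open>D N\<close> is linear on \<open>A\<close>, bounded
  by \<open>2 * norm T\<close> uniformly in \<open>N\<close>, and eventually zero on each monomial.
  \<open>Suc N\<close> excludes the average over an empty set of angles.\<close>

lemma spectral_average_tendsto:
  assumes T: "T \<in> A"
  shows "(\<lambda>N. spectral_average (Suc N) n T) \<longlonglongrightarrow> monom n (coeff T n)"
proof -
  note AD = complex_subalgebraD[OF complex_subalgebra_A]
  define D where "D N T = spectral_average (Suc N) n T - monom n (coeff T n)" for N T
  have norm_D: "norm (D N T) \<le> 2 * norm T" if "T \<in> A" for N T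
    using norm_triangle_ineq4[of "spectral_average (Suc N) n T" "monom n (coeff T n)"]
      norm_spectral_average[of "Suc N" n T] norm_monom[OF coeff_in_C0[OF that], of n n]
      sup_norm_coeff_le[OF that, of n]
    unfolding D_def by simp
  have D_add: "D N (S + T) = D N S + D N T" if "S \<in> A" "T \<in> A" for S T N
  proof -
    have "coeff (S + T) n = (\<lambda>x. coeff S n x + coeff T n x)" using coeff_add that by blast
    then show ?thesis using that
      by (simp add: D_def spectral_average_add monom_add[symmetric] coeff_in_C0)
  qed
  have D_scale: "D N (c *\<^sub>C T) = c *\<^sub>C D N T" if "T \<in> A" for c T N
  proof -
    have "coeff (c *\<^sub>C T) n = (\<lambda>x. c * coeff T n x)" using coeff_scaleC that by blast
    then show ?thesis using that
      by (simp add: D_def spectral_average_scaleC monom_scaleC[symmetric] coeff_in_C0 cvec.scale_right_diff_distrib)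
  qed
  have D_zero: "D N 0 = 0" for N using D_scale[OF AD(2), of N 0] by simp
  let ?S = "{T \<in> A. (\<lambda>N. D N T) \<longlonglongrightarrow> 0}"
  have "A \<subseteq> ?S"
  proof (rule A_subset)
    show "complex_subspace ?S"
      unfolding complex_subspace_def
      using AD D_zero tendsto_add[of "\<lambda>N. D N _" 0 sequentially "\<lambda>N. D N _" 0]
        tendsto_scaleC_bop[of "\<lambda>N. D N _" 0 sequentially]
      by (auto simp: D_add D_scale)
    show "closed ?S"
      unfolding closed_sequential_limits
    proof (intro allI impI, elim conjE)
      fix X L assume X: "\<forall>j. X j \<in> ?S" "X \<longlonglongrightarrow> L"
      then have XA: "X j \<in> A" for j by blast
      have LA: "L \<in> A" using closed_A XA X(2) by (auto simp: closed_sequential_limits)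
      have "(\<lambda>N. D N L) \<longlonglongrightarrow> 0"
      proof (rule LIMSEQ_I)
        fix e :: real assume "e > 0"
        then obtain j where j: "norm (X j - L) < e / 4"
          using LIMSEQ_D[OF X(2), of "e / 4"] by auto
        have "(\<lambda>N. D N (X j)) \<longlonglongrightarrow> 0" using X by blast
        then obtain M where M: "\<And>N. N \<ge> M \<Longrightarrow> norm (D N (X j)) < e / 2"
          using LIMSEQ_D[of "\<lambda>N. D N (X j)" 0 "e / 2"] \<open>e > 0\<close> by auto
        have "norm (D N L) < e" if "N \<ge> M" for N
        proof -
          have "D N L = D N (X j) + D N (L - X j)"
            using D_add[OF XA AD(4)[OF LA XA], of N j j] by simp
          then have "norm (D N L) \<le> norm (D N (X j)) + norm (D N (L - X j))"
            by (metis norm_triangle_ineq)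
          also have "norm (D N (L - X j)) \<le> 2 * norm (X j - L)"
            using norm_D[OF AD(4)[OF LA XA], of N j] by (simp add: norm_minus_commute)
          finally show ?thesis using M[OF that] j by linarith
        qed
        then show "\<exists>M. \<forall>N\<ge>M. norm (D N L - 0) < e" by auto
      qed
      then show "L \<in> ?S" using LA by blast
    qed
    show "monom m f \<in> ?S" if f: "f \<in> C0" for m f
    proof -
      define M where "M = Max (range (\<lambda>j. m $ j + n $ j))"
      have M: "m $ j + n $ j \<le> M" for j unfolding M_def by (rule Max_ge) auto
      have "D N (monom m f) = 0" if "N \<ge> M" for N
      proof -
        have "m $ j < Suc N" "n $ j < Suc N" for j using M[of j] that by auto
        then have "spectral_average (Suc N) n (monom m f) = (if m = n then monom m f else 0)"
          by (rule spectral_average_monom[OF f])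
        moreover have "monom n (coeff (monom m f) n) = (if m = n then monom m f else 0)"
        proof (cases "m = n")
          case True
          then have "coeff (monom m f) n = f" using coeff_monom[OF f] by auto
          then show ?thesis using True by simp
        next
          case False
          then have "coeff (monom m f) n = (\<lambda>x. 0)" using coeff_monom[OF f] by auto
          then show ?thesis using False by (simp add: monom_zero)
        qed
        ultimately show ?thesis by (simp add: D_def)
      qed
      then have "(\<lambda>N. D N (monom m f)) \<longlonglongrightarrow> 0"
        by (intro tendsto_eventually eventually_sequentiallyI)
      then show ?thesis using monom_in_A[OF f] by blast
    qed
  qed
  then show ?thesis using T by (auto simp: D_def LIM_zero_iff)
qed

lemma quasi_regular_ideal_coeff:
  assumes T: "T \<in> quasi_regular_ideal A"
  shows "monom n (coeff T n) \<in> quasi_regular_ideal A"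
proof -
  have TA: "T \<in> A" using T by (simp add: quasi_regular_ideal_def)
  show ?thesis
    by (rule closed_sequentially[OF closed_quasi_regular_ideal[OF complex_subalgebra_A closed_A]
          spectral_average_quasi_regular_ideal[OF T] spectral_average_tendsto[OF TA]])
qed

end

section \<open>Strong recurrence\<close>

text \<open>Strict growth in each coordinate forces \<open>k \<le> s k $ j\<close>, so the return
  times eventually dominate any prescribed \<open>N\<close>.\<close>

lemma strongly_recurrent_return:
  fixes \<phi> :: "nat ^ 'd \<Rightarrow> 'x::topological_space \<Rightarrow> 'x"
  assumes dense: "closure {x. strongly_recurrent \<phi> x} = UNIV" and V: "open V" "V \<noteq> {}"
  obtains y r where "y \<in> V" "N \<le> r" "\<phi> r y \<in> V"
proof -
  have "V \<inter> {x. strongly_recurrent \<phi> x} \<noteq> {}"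
    using open_Int_closure_eq_empty[OF V(1), of "{x. strongly_recurrent \<phi> x}"] V(2) dense by auto
  then obtain y where y: "y \<in> V" "strongly_recurrent \<phi> y" by blast
  obtain s where s: "\<And>k j. s k $ j < s (Suc k) $ j" "(\<lambda>k. \<phi> (s k) y) \<longlonglongrightarrow> y"
    using y(2) unfolding strongly_recurrent_def by blast
  have sk: "k \<le> s k $ j" for k j
    by (induction k) (use s(1) in \<open>auto simp: less_eq_Suc_le intro: order_trans\<close>)
  obtain K where K: "\<And>k. k \<ge> K \<Longrightarrow> \<phi> (s k) y \<in> V"
    using topological_tendstoD[OF s(2) V(1) y(1)] by (auto simp: eventually_sequentially)
  define k where "k = max K (Max (range (\<lambda>j. N $ j)))"
  have "N $ j \<le> s k $ j" for j
    using sk[of k j] Max_ge[of "range (\<lambda>j. N $ j)" "N $ j"] by (auto simp: k_def)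
  then have "N \<le> s k" by (simp add: less_eq_vec_def)
  then show ?thesis using that[of y "s k"] y(1) K[of k] by (simp add: k_def)
qed

text \<open>A point of \<open>V (Suc k)\<close> lies in \<open>V k\<close> and is carried back into
  \<open>V k\<close> after time \<open>q k + S k\<close>. Hence its orbit, followed along a nested
  word, meets \<open>U\<close> wherever a letter is evaluated. The bound \<open>n \<le> q k\<close>
  is there so that a monomial of degree \<open>n\<close> can be split off from one of degree
  \<open>q k\<close>.\<close>

lemma recurrence_scheme:
  fixes \<phi> :: "nat ^ 'd \<Rightarrow> 'x::topological_space \<Rightarrow> 'x" and n :: "nat ^ 'd"
  assumes cont: "\<And>n. continuous_on UNIV (\<phi> n)"
    and dense: "closure {x. strongly_recurrent \<phi> x} = UNIV" and U: "open U" "U \<noteq> {}"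
  obtains q S :: "nat \<Rightarrow> nat ^ 'd" and V :: "nat \<Rightarrow> 'x set"
    where "V 0 = U" "S 0 = 0" "\<And>k. S (Suc k) = S k + q k + S k"
      "\<And>k. V (Suc k) = V k \<inter> \<phi> (q k + S k) -` V k" "\<And>k. V k \<noteq> {}"
      "\<And>k. n \<le> q k" "\<And>k. q k \<noteq> 0"
proof -
  \<comment> \<open>The state carries a return time \<open>q\<close> already chosen for the current
    \<open>V\<close> and \<open>S\<close>; this is what makes the next set nonempty.\<close>
  define P where "P k = (\<lambda>(S, V, q). open V \<and> n \<le> q \<and> q \<noteq> 0 \<and> (\<exists>y\<in>V. \<phi> (q + S) y \<in> V) \<and>
    (k = (0::nat) \<longrightarrow> S = 0 \<and> V = U))" for k
  define Q where "Q = (\<lambda>(S, V, q) (S', V', q' :: nat ^ 'd). S' = S + q + S \<and> V' = V \<inter> \<phi> (q + S) -` V)"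
  have ret: "\<exists>q. n \<le> q \<and> q \<noteq> 0 \<and> (\<exists>y\<in>V. \<phi> (q + S) y \<in> V)" if V: "open V" "V \<noteq> {}" for V S
  proof -
    \<comment> \<open>A return time beyond \<open>S + (n + 1)\<close> leaves, after subtracting
      \<open>S\<close>, a \<open>q\<close> that is at least \<open>n\<close> and nonzero.\<close>
    obtain y r where y: "y \<in> V" "S + (n + 1) \<le> r" "\<phi> r y \<in> V"
      by (rule strongly_recurrent_return[OF dense V])
    have le: "S $ j + (n $ j + 1) \<le> r $ j" for j
      using y(2) by (simp add: less_eq_vec_def)
    have "S \<le> r" using add_leD1[OF le] by (simp add: less_eq_vec_def)
    then have "r - S + S = r"
      using nat_vec_diff_add[of S r] by (simp add: add.commute)
    moreover have "n \<le> r - S"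
      unfolding less_eq_vec_def
    proof
      show "n $ j \<le> (r - S) $ j" for j using le[of j] by simp
    qed
    moreover have "r - S \<noteq> 0"
    proof
      assume "r - S = 0"
      then have "(r - S) $ undefined = 0" by simp
      then show False using le[of undefined] by simp
    qed
    ultimately show ?thesis using y by (intro exI[of _ "r - S"]) auto
  qed
  have "\<exists>f. \<forall>k. P k (f k) \<and> Q (f k) (f (Suc k))"
  proof (rule dependent_nat_choice)
    obtain q where "n \<le> q" "q \<noteq> 0" "\<exists>y\<in>U. \<phi> (q + 0) y \<in> U"
      using ret[OF U, of 0] by blast
    then have "P 0 (0, U, q)" using U by (simp add: P_def)
    then show "\<exists>st. P 0 st" by blast
    fix st k assume st: "P k st"
    obtain S V q where stq: "st = (S, V, q)" by (cases st)
    let ?V = "V \<inter> \<phi> (q + S) -` V"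
    have "open ?V" using st cont by (auto simp: P_def stq intro!: open_Int open_vimage)
    moreover have "?V \<noteq> {}" using st by (auto simp: P_def stq)
    ultimately obtain q' where "n \<le> q'" "q' \<noteq> 0" "\<exists>y\<in>?V. \<phi> (q' + (S + q + S)) y \<in> ?V"
      using ret[of ?V "S + q + S"] by blast
    then have "P (Suc k) (S + q + S, ?V, q') \<and> Q st (S + q + S, ?V, q')"
      using \<open>open ?V\<close> by (auto simp: P_def Q_def stq)
    then show "\<exists>st'. P (Suc k) st' \<and> Q st st'" by blast
  qed
  then obtain f where f: "\<And>k. P k (f k)" "\<And>k. Q (f k) (f (Suc k))" by blast
  show ?thesis
  proof (rule that[of "\<lambda>k. fst (snd (f k))" "\<lambda>k. fst (f k)" "\<lambda>k. snd (snd (f k))"])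
    show "fst (snd (f k)) \<noteq> {}" for k
      using f(1)[of k] by (auto simp: P_def case_prod_beta)
  qed (use f in \<open>auto simp: P_def Q_def case_prod_beta\<close>)
qed

section \<open>Positive series and unbounded coefficients\<close>

lemma sums_complex_nonneg:
  fixes f :: "nat \<Rightarrow> complex"
  assumes f: "f sums L" and r: "\<And>k. f k = complex_of_real (r k)" "\<And>k. r k \<ge> 0"
  shows "L = complex_of_real (Re L)" "r k \<le> Re L" "0 \<le> Re L"
proof -
  have "(\<lambda>k. Im (f k)) sums Im L" using f by (simp add: sums_complex_iff)
  then have "Im L = 0" using r(1) by (simp add: sums_unique2[OF _ sums_zero])
  then show "L = complex_of_real (Re L)" by (simp add: complex_eq_iff)
  have "r sums Re L" using f r(1) by (simp add: sums_complex_iff)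
  then have "sum r {k} \<le> Re L"
    using sum_le_suminf[of r "{k}"] r(2) by (simp add: sums_iff)
  then show "r k \<le> Re L" by simp
  then show "0 \<le> Re L" using r(2)[of k] by linarith
qed

context crossed_product
begin

text \<open>Each coefficient at a point is a linear functional on \<open>A\<close> bounded by the
  norm, so it may be taken term by term.\<close>

lemma coeff_sums:
  assumes X: "\<And>k. X k \<in> A" and Y: "X sums Y"
  shows "Y \<in> A" "(\<lambda>k. coeff (X k) m x) sums coeff Y m x"
proof -
  note AD = complex_subalgebraD[OF complex_subalgebra_A]
  have P: "(\<Sum>k<N. X k) \<in> A" and cP: "coeff (\<Sum>k<N. X k) m x = (\<Sum>k<N. coeff (X k) m x)" for N
    by (induction N) (auto simp: coeff_zero coeff_add X AD)
  show YA: "Y \<in> A"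
    using Y closed_sequentially[OF closed_A P] by (simp add: sums_def)
  have "(\<lambda>N. norm ((\<Sum>k<N. X k) - Y)) \<longlonglongrightarrow> 0"
    using Y by (simp add: sums_def LIM_zero_iff tendsto_norm_zero_iff)
  then have "(\<lambda>N. (\<Sum>k<N. coeff (X k) m x) - coeff Y m x) \<longlonglongrightarrow> 0"
  proof (rule Lim_null_comparison[OF always_eventually, rotated], intro allI)
    show "cmod ((\<Sum>k<N. coeff (X k) m x) - coeff Y m x) \<le> norm ((\<Sum>k<N. X k) - Y)" for N
      using coeff_bound[OF AD(4)[OF P YA], of N m x] by (simp add: coeff_diff P YA cP)
  qed
  then show "(\<lambda>k. coeff (X k) m x) sums coeff Y m x"
    by (simp add: sums_def LIM_zero_iff)
qed

text \<open>
  With \<open>w k = 2 / s (1/2)\<^sup>k\<close>, the series \<open>c\<close> is the sum of the \<open>w k U\<^bsub>q k\<^esub> h\<close>. Let \<open>W\<^bsub>0\<^esub>\<close> be the empty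
  word and \<open>W\<^bsub>k+1\<^esub> = W\<^bsub>k\<^esub> q\<^bsub>k\<^esub> W\<^bsub>k\<^esub>\<close>. The word \<open>W\<^bsub>k\<^esub>\<close> has degree \<open>S k\<close> and at points of \<open>V k\<close> it contributes
  at least \<open>2\<^sup>k\<close> to the coefficient of \<open>1 + c + c\<^sup>2 + \<dots>\<close> at \<open>S k\<close>; nothing cancels because all
  coefficients are non-negative.
\<close>

lemma not_left_quasi_regular_recurrent_series:
  fixes h :: "'x \<Rightarrow> real"
  assumes h: "(\<lambda>x. complex_of_real (h x)) \<in> C0" "\<And>x. 0 \<le> h x"
    and s: "s > 0" "\<And>x. x \<in> V 0 \<Longrightarrow> s \<le> h x"
    and S: "S 0 = 0" "\<And>k. S (Suc k) = S k + q k + S k"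
    and V: "\<And>k. V (Suc k) = V k \<inter> \<phi> (q k + S k) -` V k" "\<And>k. V k \<noteq> {}"
    and q: "\<And>k. q k \<noteq> 0"
    and c: "(\<lambda>k. complex_of_real (2 / s * (1 / 2) ^ k) *\<^sub>C monom (q k) (\<lambda>x. complex_of_real (h x))) sums c"
  shows "\<not> left_quasi_regular A c"
proof
  note AD = complex_subalgebraD[OF complex_subalgebra_A]
  define w where "w k = 2 / s * (1 / 2) ^ k" for k :: nat
  have w: "w k > 0" for k using s by (simp add: w_def)
  let ?M = "\<lambda>k. monom (q k) (\<lambda>x. complex_of_real (h x))"
  have MA: "?M k \<in> A" for k by (rule monom_in_A[OF h(1)])
  have c: "(\<lambda>k. complex_of_real (w k) *\<^sub>C ?M k) sums c" using c by (simp only: w_def)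
  have cA: "c \<in> A" by (rule coeff_sums(1)[OF AD(6)[OF MA] c])
  assume "left_quasi_regular A c"
  then obtain b0 where b0: "b0 \<in> A" "b0 + c - b0 * c = 0" by (auto simp: left_quasi_regular_def)
  \<comment> \<open>With this sign \<open>1 + b\<close> is a left inverse of \<open>1 - c\<close>;
    the equation \<open>b = c + b * c\<close> says \<open>1 + b = 1 + (1 + b) c\<close>.\<close>
  define b where "b = - b0"
  have bA: "b \<in> A" and b: "b = c + b * c"
    using b0 AD(5) by (auto simp: b_def algebra_simps add_eq_0_iff)
  \<comment> \<open>The coefficients of \<open>1 + b\<close>; the unit, which \<open>A\<close> may
    lack, is added by hand at index \<open>0\<close>.\<close>
  define B where "B m x = (if m = 0 then 1 else 0) + coeff b m x" for m x
  define R where "R m x k = (if q k \<le> m then B (m - q k) (\<phi> (q k) x) * complex_of_real (h x) else 0)"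
    for m x k
  \<comment> \<open>The equation \<open>1 + b = 1 + (1 + b) c\<close> read at the coefficient
    \<open>m\<close>: a recursion expressing \<open>B m\<close> through the
    \<open>B (m - q k)\<close>.\<close>
  have B_sums: "(\<lambda>k. complex_of_real (w k) * R m x k) sums (B m x - (if m = 0 then 1 else 0))" for m x
  proof -
    have "(\<lambda>k. coeff (complex_of_real (w k) *\<^sub>C ?M k) m x) sums coeff c m x"
      by (rule coeff_sums(2)[OF AD(6)[OF MA] c])
    moreover have "(\<lambda>k. coeff (b * (complex_of_real (w k) *\<^sub>C ?M k)) m x) sums coeff (b * c) m x"
      by (rule coeff_sums(2)[OF AD(7)[OF bA AD(6)[OF MA]]
            bounded_linear.sums[OF bounded_linear_mult_right c]])
    ultimately have "(\<lambda>k. coeff (complex_of_real (w k) *\<^sub>C ?M k) m x +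
        coeff (b * (complex_of_real (w k) *\<^sub>C ?M k)) m x) sums (coeff c m x + coeff (b * c) m x)"
      by (rule sums_add)
    moreover have "coeff c m x + coeff (b * c) m x = B m x - (if m = 0 then 1 else 0)"
      using coeff_add[OF cA AD(7)[OF bA cA], of m x] b by (simp add: B_def)
    moreover have "coeff (complex_of_real (w k) *\<^sub>C ?M k) m x +
        coeff (b * (complex_of_real (w k) *\<^sub>C ?M k)) m x = complex_of_real (w k) * R m x k" for k
    proof -
      have "coeff (?M k) m x + coeff (b * ?M k) m x = R m x k"
      proof (cases "q k \<le> m")
        case True
        then have "m = q k \<longleftrightarrow> m - q k = 0" using nat_vec_diff_add nat_vec_add_diff[of _ 0] by (metis add.right_neutral)
        then show ?thesis using True
          by (simp add: R_def B_def coeff_mult_monom[OF bA h(1)] coeff_monom[OF h(1)] algebra_simps)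
      next
        case False
        then show ?thesis
          by (auto simp: R_def coeff_mult_monom[OF bA h(1)] coeff_monom[OF h(1)])
      qed
      then show ?thesis
        by (simp add: mult_scaleC_right coeff_scaleC MA AD(7)[OF bA MA] distrib_left[symmetric])
    qed
    ultimately show ?thesis by simp
  qed
  \<comment> \<open>Because \<open>q k\<close> is nonzero, the recursion only calls indices with a
    smaller sum of entries. Positivity of the coefficients of the hypothetical inverse thus follows
    from that of \<open>c\<close>.\<close>
  have B_real: "B m x = complex_of_real (Re (B m x)) \<and> 0 \<le> Re (B m x)" for m x
  proof (induction "\<Sum>j\<in>UNIV. m $ j" arbitrary: m x rule: less_induct)
    case less
    have "R m x k = complex_of_real (Re (R m x k)) \<and> 0 \<le> Re (R m x k)" for k
    proof (cases "q k \<le> m")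
      case True
      obtain i where "q k $ i \<noteq> 0" using q[of k] by (auto simp: vec_eq_iff)
      then have "(m - q k) $ i < m $ i"
        using True[unfolded less_eq_vec_def, rule_format, of i] by simp
      then have "(\<Sum>j\<in>UNIV. (m - q k) $ j) < (\<Sum>j\<in>UNIV. m $ j)"
        by (intro sum_strict_mono_ex1) auto
      from less[OF this, of "\<phi> (q k) x"] True h(2)[of x] show ?thesis
        by (simp add: R_def complex_eq_iff)
    qed (simp add: R_def)
    then have "complex_of_real (w k) * R m x k = complex_of_real (w k * Re (R m x k))"
      "0 \<le> w k * Re (R m x k)" for k
      using w[of k] by (metis of_real_mult, simp)
    from sums_complex_nonneg[OF B_sums this]
    show ?case by (auto simp: complex_eq_iff split: if_splits)
  qed
  define r where "r m x = Re (B m x)" for m x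
  have r_nonneg: "0 \<le> r m x" for m x using B_real by (simp add: r_def)
  have B_r: "B m x = complex_of_real (r m x)" for m x
    unfolding r_def by (rule conjunct1[OF B_real])
  have R_r: "complex_of_real (w k) * R m x k =
      complex_of_real (w k * (if q k \<le> m then r (m - q k) (\<phi> (q k) x) * h x else 0))" for k m x
    by (simp add: R_def B_r)
  have nn: "0 \<le> w k * (if q k \<le> m then r (m - q k) (\<phi> (q k) x) * h x else 0)" for k m x
    using w[of k] r_nonneg h(2) by simp
  note sums_r = sums_complex_nonneg[OF B_sums R_r nn]
  have r_0: "1 \<le> r 0 x" for x
    using sums_r(3)[of 0 x] by (simp add: r_def)
  \<comment> \<open>All but one term of the non-negative series is dropped.\<close>
  have r_step: "w k * (r p (\<phi> (q k) x) * h x) \<le> r (p + q k) x" for k p x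
  proof -
    have "p + q k \<noteq> 0" using q[of k] by (auto simp: vec_eq_iff)
    then show ?thesis
      using sums_r(2)[of k "p + q k" x] nat_vec_le_add[of "q k" p] nat_vec_add_diff[of "q k" p]
      by (simp add: r_def add.commute)
  qed
  \<comment> \<open>Guarantees the lower bound \<open>s\<close> for \<open>h\<close> at the point
    where the middle letter \<open>q k\<close> is evaluated.\<close>
  have S_V: "\<phi> (S k) x \<in> V 0" if "x \<in> V k" for k x
    using that
  proof (induction k arbitrary: x)
    case (Suc k)
    then have "\<phi> (S k) (\<phi> (q k + S k) x) \<in> V 0" by (auto simp: V)
    then show ?case by (simp add: S phi_add[symmetric] add.assoc)
  qed (simp add: S phi_zero)
  \<comment> \<open>The index \<open>p\<close> is arbitrary because the induction hypothesis is
    applied once for each copy of the word: with \<open>p\<close>, and with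
    \<open>p + S k + q k\<close>.\<close>
  have growth: "2 ^ k * r p (\<phi> (S k) x) \<le> r (p + S k) x" if "x \<in> V k" for k p x
    using that
  proof (induction k arbitrary: p x)
    case 0
    then show ?case by (simp add: S phi_zero)
  next
    case (Suc k)
    have x: "x \<in> V k" "\<phi> (q k + S k) x \<in> V k" using Suc.prems by (auto simp: V)
    \<comment> \<open>This explains the weights: \<open>s\<close> cancels the bound for
      \<open>h\<close>, the power \<open>(1 / 2) ^ k\<close> cancels one of the two factors
      \<open>2 ^ k\<close> coming from the two copies, and the constant 2 yields the
      doubling.\<close>
    have ws: "2 ^ k * (w k * ((2 ^ k * t) * s)) = 2 * 2 ^ k * t" for t
      using s by (simp add: w_def power_one_over field_simps)
    have "2 ^ Suc k * r p (\<phi> (S (Suc k)) x)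
        = 2 ^ k * (w k * ((2 ^ k * r p (\<phi> (S k) (\<phi> (q k + S k) x))) * s))"
      using ws by (simp add: S phi_add[symmetric] add.assoc)
    also have "\<dots> \<le> 2 ^ k * (w k * (r (p + S k) (\<phi> (q k + S k) x) * h (\<phi> (S k) x)))"
      using Suc.IH[OF x(2), of p] s(2)[OF S_V[OF x(1)]] w[of k] s(1) r_nonneg
      by (intro mult_left_mono mult_mono) auto
    also have "\<dots> \<le> 2 ^ k * r (p + S k + q k) (\<phi> (S k) x)"
      using r_step[of k "p + S k" "\<phi> (S k) x"] by (simp add: phi_add)
    also have "\<dots> \<le> r (p + S k + q k + S k) x"
      by (rule Suc.IH[OF x(1)])
    finally show ?case by (simp add: S add.assoc)
  qed
  obtain k where k: "1 + norm b < 2 ^ k"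
    using real_arch_pow[of 2 "1 + norm b"] by auto
  obtain x where x: "x \<in> V k" using V(2) by blast
  have "2 ^ k \<le> 2 ^ k * r 0 (\<phi> (S k) x)" using r_0 by simp
  also have "\<dots> \<le> r (S k) x" using growth[OF x, of 0] by simp
  also have "\<dots> \<le> cmod (B (S k) x)" by (simp add: r_def complex_Re_le_cmod)
  also have "\<dots> \<le> 1 + cmod (coeff b (S k) x)"
    unfolding B_def by (rule norm_triangle_le) auto
  also have "\<dots> \<le> 1 + norm b" using coeff_bound[OF bA] by simp
  finally show False using k by simp
qed

lemma quasi_regular_ideal_trivial:
  assumes lc: "locally_compact_space (euclidean :: 'x topology)"
    and dense: "closure {x. strongly_recurrent \<phi> x} = UNIV"
    and T: "T \<in> quasi_regular_ideal A"
  shows "T = 0"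
proof (rule ccontr)
  note AD = complex_subalgebraD[OF complex_subalgebra_A]
  have TA: "T \<in> A" using T by (simp add: quasi_regular_ideal_def)
  assume "T \<noteq> 0"
  then obtain n z where z: "coeff T n z \<noteq> 0" using eq_0_if_coeff_0[OF TA] by blast
  \<comment> \<open>Multiplying on the right by the degree \<open>0\<close> monomial of the
    conjugate replaces the coefficient by its squared modulus, without leaving the ideal or changing
    the degree.\<close>
  define f where "f x = (cmod (coeff T n x))\<^sup>2" for x
  have f: "(\<lambda>x. complex_of_real (f x)) = (\<lambda>x. coeff T n (\<phi> 0 x) * cnj (coeff T n x))"
    by (simp only: f_def complex_norm_square phi_zero id_apply)
  have fC: "(\<lambda>x. complex_of_real (f x)) \<in> C0"
    unfolding f by (intro C0_mult C0_phi C0_cnj coeff_in_C0 TA)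
  have fQ: "monom n (\<lambda>x. complex_of_real (f x)) \<in> quasi_regular_ideal A"
    using quasi_regular_ideal_mult_right[OF complex_subalgebra_A quasi_regular_ideal_coeff[OF T, of n]
        monom_in_A[OF C0_cnj[OF coeff_in_C0[OF TA, of n]], of 0]]
    by (simp add: monom_mult coeff_in_C0[OF TA] C0_cnj f)
  \<comment> \<open>The left factor needs a coefficient in \<open>C0\<close>, and the constant 1
    need not be one. It enters the product composed with \<open>\<phi> n\<close>, so the bump sits
    at \<open>\<phi> n z\<close> to keep \<open>h z\<close> positive.\<close>
  obtain g :: "'x \<Rightarrow> real" where g: "(\<lambda>x. complex_of_real (g x)) \<in> C0" "\<And>x. g x \<ge> 0" "g (\<phi> n z) > 0"
    by (rule C0_bump[OF lc zero_less_one, of "\<phi> n z"]) (rule that)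
  define h where "h x = g (\<phi> n x) * f x" for x
  have h: "(\<lambda>x. complex_of_real (h x)) \<in> C0"
    unfolding h_def of_real_mult by (intro C0_mult C0_phi[OF g(1)] fC)
  have h0: "0 \<le> h x" for x using g(2) by (simp add: h_def f_def)
  \<comment> \<open>Half the value at \<open>z\<close>, so that the open set where \<open>h\<close>
    exceeds \<open>s\<close> contains \<open>z\<close>.\<close>
  define s where "s = h z / 2"
  have s: "s > 0" using g(3) z by (simp add: s_def h_def f_def)
  let ?U = "{x. s < h x}"
  have "continuous_on UNIV h"
    using continuous_on_Re[OF C0_continuous[OF h]] by simp
  then have "open ?U" by (intro open_Collect_less continuous_on_const)
  moreover have "?U \<noteq> {}" using s by (auto simp: s_def intro!: exI[of _ z])
  ultimately obtain q S :: "nat \<Rightarrow> nat ^ 'd" and V :: "nat \<Rightarrow> 'x set"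
    where V0: "V 0 = ?U" and S: "S 0 = 0" "\<And>k. S (Suc k) = S k + q k + S k"
      and V: "\<And>k. V (Suc k) = V k \<inter> \<phi> (q k + S k) -` V k" "\<And>k. V k \<noteq> {}"
      and q: "\<And>k. n \<le> q k" "\<And>k. q k \<noteq> 0"
    by (rule recurrence_scheme[OF continuous_phi dense]) (rule that)
  define w where "w k = 2 / s * (1 / 2) ^ k" for k :: nat
  have w: "w k > 0" for k using s by (simp add: w_def)
  let ?a = "\<lambda>k. complex_of_real (w k) *\<^sub>C monom (q k - n) (\<lambda>x. complex_of_real (g x))"
  have "summable (\<lambda>k. norm (?a k))"
  proof (rule summable_comparison_test')
    show "summable (\<lambda>k. w k * sup_norm (\<lambda>x. complex_of_real (g x)))"
      unfolding w_def by (intro summable_mult summable_mult2 summable_geometric) simp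
    show "norm (norm (?a k)) \<le> w k * sup_norm (\<lambda>x. complex_of_real (g x))" if "k \<ge> 0" for k
    proof -
      have "norm (?a k) \<le> cmod (complex_of_real (w k)) * norm (monom (q k - n) (\<lambda>x. complex_of_real (g x)))"
        by (rule norm_scaleC_bop)
      also have "\<dots> = w k * norm (monom (q k - n) (\<lambda>x. complex_of_real (g x)))"
        using w[of k] by simp
      also have "\<dots> \<le> w k * sup_norm (\<lambda>x. complex_of_real (g x))"
        using w[of k] by (intro mult_left_mono norm_monom g(1)) simp
      finally show ?thesis by simp
    qed
  qed
  then have a: "?a sums suminf ?a" by (rule summable_sums[OF summable_norm_cancel])
  have aA: "suminf ?a \<in> A"
    by (rule coeff_sums(1)[OF AD(6)[OF monom_in_A[OF g(1)]] a])
  have "?a k * monom n (\<lambda>x. complex_of_real (f x))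
      = complex_of_real (w k) *\<^sub>C monom (q k) (\<lambda>x. complex_of_real (h x))" for k
    using nat_vec_diff_add[OF q(1)]
    by (simp add: mult_scaleC_left monom_mult[OF g(1) fC] h_def)
  then have c: "(\<lambda>k. complex_of_real (2 / s * (1 / 2) ^ k) *\<^sub>C monom (q k) (\<lambda>x. complex_of_real (h x)))
      sums (suminf ?a * monom n (\<lambda>x. complex_of_real (f x)))"
    using bounded_linear.sums[OF bounded_linear_mult_left a, of "monom n (\<lambda>x. complex_of_real (f x))"]
    by (simp only: w_def)
  have "s \<le> h x" if "x \<in> V 0" for x using that by (simp add: V0)
  from not_left_quasi_regular_recurrent_series[OF h h0 s this S V q(2) c]
  show False using fQ aA by (simp add: quasi_regular_ideal_def)
qed

text \<open>Putting a monomial of degree \<open>m\<close> between the two factors produces a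
  coefficient containing \<open>f (\<phi> (N + m) x) * f x\<close>, and \<open>N + m\<close> still
  dominates \<open>N\<close>. Linearity and continuity in the middle factor do the rest.\<close>

lemma sandwich_zero_monom:
  assumes f: "f \<in> C0" and wandering: "\<And>n x. N \<le> n \<Longrightarrow> f (\<phi> n x) * f x = 0"
  shows "monom N f * monom N f = 0"
    and "b \<in> A \<Longrightarrow> monom N f * b * monom N f = 0"
proof -
  have "(\<lambda>x. f (\<phi> N x) * f x) = (\<lambda>x. 0)" using wandering[of N] by auto
  then show "monom N f * monom N f = 0" by (simp add: monom_mult[OF f f] monom_zero)
  have "A \<subseteq> {b. monom N f * b * monom N f = 0}"
  proof (rule A_subset)
    show "closed {b. monom N f * b * monom N f = 0}"
      by (intro closed_Collect_eq continuous_intros)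
    show "complex_subspace {b. monom N f * b * monom N f = 0}"
      by (auto simp: complex_subspace_def distrib_left distrib_right mult_scaleC_left mult_scaleC_right)
    show "monom m g \<in> {b. monom N f * b * monom N f = 0}" if g: "g \<in> C0" for m g
    proof -
      have "f (\<phi> m (\<phi> N x)) * g (\<phi> N x) * f x = 0" for x
      proof -
        have "f (\<phi> (N + m) x) * f x = 0" by (rule wandering) (rule nat_vec_le_add)
        then show ?thesis by (auto simp: phi_add[symmetric] add.commute)
      qed
      then have "(\<lambda>x. f (\<phi> m (\<phi> N x)) * g (\<phi> N x) * f x) = (\<lambda>x. 0)" by blast
      then show ?thesis
        by (simp add: monom_mult f g C0_mult C0_phi monom_zero)
    qed
  qed
  then show "b \<in> A \<Longrightarrow> monom N f * b * monom N f = 0" by blast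
qed

end

section \<open>Baire category and wandering balls\<close>

definition almost_returns :: "(nat ^ 'd \<Rightarrow> 'x::metric_space \<Rightarrow> 'x) \<Rightarrow> nat \<Rightarrow> 'x set" where
  "almost_returns \<phi> k = {x. \<exists>n. (\<forall>j. k \<le> n $ j) \<and> dist (\<phi> n x) x < 1 / (real k + 1)}"

lemma open_almost_returns:
  assumes "\<And>n. continuous_on UNIV (\<phi> n)"
  shows "open (almost_returns \<phi> k)"
proof -
  have "almost_returns \<phi> k = (\<Union>n\<in>{n. \<forall>j. k \<le> n $ j}. {x. dist (\<phi> n x) x < 1 / (real k + 1)})"
    by (auto simp: almost_returns_def)
  also have "open \<dots>"
    by (intro open_UN ballI open_Collect_less continuous_intros assms)
  finally show ?thesis .
qed

text \<open>One parameter governs both the size of the return time and the tolerance, so a countable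
  family of open sets captures strong recurrence; the sequence is then built by dependent
  choice.\<close>

lemma strongly_recurrent_if_almost_returns:
  fixes \<phi> :: "nat ^ 'd \<Rightarrow> 'x::metric_space \<Rightarrow> 'x"
  assumes x: "\<And>k. x \<in> almost_returns \<phi> k"
  shows "strongly_recurrent \<phi> x"
proof -
  have "\<exists>s. \<forall>k. dist (\<phi> (s k) x) x < 1 / (real k + 1) \<and> (\<forall>j. s k $ j < s (Suc k) $ j)"
  proof (rule dependent_nat_choice)
    show "\<exists>n. dist (\<phi> n x) x < 1 / (real 0 + 1)"
      using x[of 0] by (auto simp: almost_returns_def)
    fix n k assume "dist (\<phi> n x) x < 1 / (real k + 1)"
    \<comment> \<open>Large enough to exceed every entry of the previous index \<open>n\<close> and
      to reach the tolerance required at stage \<open>Suc k\<close>.\<close>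
    define K where "K = Suc (k + Max (range (\<lambda>j. n $ j)))"
    obtain m where m: "\<And>j. K \<le> m $ j" "dist (\<phi> m x) x < 1 / (real K + 1)"
      using x[of K] by (auto simp: almost_returns_def)
    have "n $ j \<le> Max (range (\<lambda>j. n $ j))" for j by (rule Max_ge) auto
    then have "n $ j < m $ j" for j
      using m(1)[of j] unfolding K_def by (meson Suc_le_eq le_add2 le_trans le_less_trans)
    moreover have "1 / (real K + 1) \<le> 1 / (real (Suc k) + 1)"
      by (intro divide_left_mono) (auto simp: K_def)
    ultimately show "\<exists>m. dist (\<phi> m x) x < 1 / (real (Suc k) + 1) \<and> (\<forall>j. n $ j < m $ j)"
      using m(2) by (intro exI[of _ m]) auto
  qed
  then obtain s where s: "\<And>k. dist (\<phi> (s k) x) x < 1 / (real k + 1)" "\<And>k j. s k $ j < s (Suc k) $ j"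
    by blast
  have "(\<lambda>k. dist (\<phi> (s k) x) x) \<longlonglongrightarrow> 0"
  proof (rule Lim_null_comparison[OF always_eventually])
    show "(\<lambda>k. 1 / (real k + 1)) \<longlonglongrightarrow> 0"
      using LIMSEQ_inverse_real_of_nat by (simp add: inverse_eq_divide add.commute)
    show "\<forall>k. norm (dist (\<phi> (s k) x) x) \<le> 1 / (real k + 1)"
      using less_imp_le[OF s(1)] by simp
  qed
  then have "(\<lambda>k. \<phi> (s k) x) \<longlonglongrightarrow> x" by (rule tendsto_dist_iff[THEN iffD2])
  then show ?thesis unfolding strongly_recurrent_def using s(2) by blast
qed

text \<open>A locally compact metric space is a Baire space. If all the open sets
  \<open>almost_returns \<phi> k\<close> were dense, so would be their intersection, which consists
  of strongly recurrent points; hence some \<open>k\<close> leaves a ball free of almost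
  returns.\<close>

lemma exists_wandering_ball:
  fixes \<phi> :: "nat ^ 'd \<Rightarrow> 'x::metric_space \<Rightarrow> 'x"
  assumes lc: "locally_compact_space (euclidean :: 'x topology)"
    and cont: "\<And>n. continuous_on UNIV (\<phi> n)"
    and nd: "closure {x. strongly_recurrent \<phi> x} \<noteq> UNIV"
  obtains e N z where "e > 0" "\<And>n x. N \<le> n \<Longrightarrow> x \<in> ball z e \<Longrightarrow> \<phi> n x \<notin> ball z e"
proof -
  have "\<exists>k. closure (almost_returns \<phi> k) \<noteq> UNIV"
  proof (rule ccontr)
    assume "\<not> ?thesis"
    then have "euclidean closure_of \<Inter>(range (almost_returns \<phi>)) = topspace euclidean"
      using lc open_almost_returns[OF cont]
      by (intro Baire_category) (auto intro: metrizable_imp_regular_space simp: metrizable_space_euclidean)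
    moreover have "\<Inter>(range (almost_returns \<phi>)) \<subseteq> {x. strongly_recurrent \<phi> x}"
      using strongly_recurrent_if_almost_returns by blast
    ultimately show False using nd closure_mono[of "\<Inter>(range (almost_returns \<phi>))"] by auto
  qed
  then obtain k where "closure (almost_returns \<phi> k) \<noteq> UNIV" by blast
  then obtain z where z: "z \<in> - closure (almost_returns \<phi> k)" by blast
  then obtain r where r: "r > 0" "ball z r \<subseteq> - closure (almost_returns \<phi> k)"
    using open_contains_ball[of "- closure (almost_returns \<phi> k)"] by auto
  \<comment> \<open>Two points of a ball of this radius are closer than
    \<open>1 / (real k + 1)\<close>, so a return to the ball would be an almost return.\<close>
  define e where "e = min r (1 / (2 * (real k + 1)))"
  show ?thesis
  proof (rule that[of e "\<chi> j. k" z])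
    show "e > 0" using r by (simp add: e_def)
    fix n :: "nat ^ 'd" and x assume n: "(\<chi> j. k) \<le> n" and x: "x \<in> ball z e"
    have "x \<notin> almost_returns \<phi> k"
      using x r(2) closure_subset by (fastforce simp: e_def)
    moreover have "\<forall>j. k \<le> n $ j" using n by (simp add: less_eq_vec_def)
    ultimately have far: "1 / (real k + 1) \<le> dist (\<phi> n x) x"
      unfolding almost_returns_def by (auto simp: not_less)
    show "\<phi> n x \<notin> ball z e"
    proof
      assume "\<phi> n x \<in> ball z e"
      then have "dist (\<phi> n x) x < e + e"
        using x dist_triangle3[of "\<phi> n x" x z] by auto
      also have "e + e \<le> 1 / (real k + 1)" by (simp add: e_def min_def field_simps)
      finally show False using far by simp
    qed
  qed
qed

theorem theorem10:
  fixes \<phi> :: "nat ^ 'd \<Rightarrow> 'x::metric_space \<Rightarrow> 'x"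
    and \<rho> :: "('x \<Rightarrow> complex) \<Rightarrow> 'h::complex_hilbert bop"
  assumes "locally_compact_space (euclidean :: 'x topology)"
    and "dynamical_system \<phi>"
    and "faithful_star_rep \<rho>"
  shows "(closure {x. strongly_recurrent \<phi> x} = UNIV
            \<longleftrightarrow> semisimple (analytic_crossed_product \<rho> \<phi>)) \<and>
         (semisimple (analytic_crossed_product \<rho> \<phi>)
            \<longleftrightarrow> semiprime (analytic_crossed_product \<rho> \<phi>))"
proof -
  interpret crossed_product \<phi> \<rho> by unfold_locales (rule assms)+
  have "semisimple A" if "closure {x. strongly_recurrent \<phi> x} = UNIV"
    using quasi_regular_ideal_trivial[OF assms(1) that] zero_in_jacobson_radical[OF complex_subalgebra_A]
      jacobson_radical_subset_quasi_regular_ideal[OF complex_subalgebra_A]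
    unfolding semisimple_def by blast
  moreover have "semiprime A" if "semisimple A"
  proof -
    have "0 \<in> prime_radical A"
      using complex_subalgebraD(2)[OF complex_subalgebra_A]
      by (auto simp: prime_radical_def prime_ideal_def two_sided_ideal_def complex_subspace_def)
    then show ?thesis
      using that prime_radical_subset_jacobson_radical[OF complex_subalgebra_A]
      unfolding semisimple_def semiprime_def by blast
  qed
  moreover have "closure {x. strongly_recurrent \<phi> x} = UNIV" if sp: "semiprime A"
  proof (rule ccontr)
    assume "closure {x. strongly_recurrent \<phi> x} \<noteq> UNIV"
    then obtain e N z where e: "e > 0"
      and wander: "\<And>n x. N \<le> n \<Longrightarrow> x \<in> ball z e \<Longrightarrow> \<phi> n x \<notin> ball z e"
      by (rule exists_wandering_ball[OF assms(1) continuous_phi]) (rule that)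
    obtain g :: "'x \<Rightarrow> real" where g: "(\<lambda>x. complex_of_real (g x)) \<in> C0" "g z > 0"
      and supp: "\<And>x. dist z x \<ge> e \<Longrightarrow> g x = 0"
      by (rule C0_bump[OF assms(1) e, of z]) (rule that)
    let ?f = "\<lambda>x. complex_of_real (g x)"
    have w: "?f (\<phi> n x) * ?f x = 0" if "N \<le> n" for n x
    proof (cases "dist z x < e")
      case True
      then show ?thesis using wander[OF that, of x] supp[of "\<phi> n x"] by (simp add: not_less)
    qed (simp add: supp)
    have "monom N ?f \<in> prime_radical A"
      by (intro in_prime_radical_if_sandwich_zero complex_subalgebra_A monom_in_A g(1)
          sandwich_zero_monom[OF g(1) w])
    then have "monom N ?f = 0" using sp by (simp add: semiprime_def)
    then show False
      using coeff_monom[OF g(1), of N N z] coeff_zero[of N z] g(2) by simp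
  qed
  ultimately show ?thesis by blast
qed

end
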